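(* Let $L/K$ be a totally ramified extension of degree $n=up^\nu$ with $p\nmid u$. Let $j$ be an integer with $0\le j\le\nu$ and $\min\{v_p(i_j),\nu\}\ge j$. Then for every $r\in\mathbb{Z}$, $\mathcal{O}_K\cdot E_{p^j}(\mathcal{M}_L^r)=\mathcal{M}_K^{\lceil(i_j+rp^j)/n\rceil}$, i.e. $g_{p^j}(r)=\lceil(i_j+rp^j)/n\rceil$.
   Context: $K$ is a field complete with respect to a discrete valuation $v_K$ whose residue field is perfect of characteristic $p$; $K^{sep}$ is a separable closure and $L\subset K^{sep}$ is a finite (separable) totally ramified extension. $\mathcal{O}_K$ is the valuation ring of $K$; $\mathcal{M}_K,\mathcal{M}_L$ are the maximal ideals; $v_L$ is normalized with $v_L=nv_K$ on $K$; $e_L=v_L(p)$ ($=\infty$ if $\mathrm{char}\,K=p$); $v_p(0)=\infty$. $\sigma_1,\dots,\sigma_n$ are the $K$-embeddings $L\to K^{sep}$, and $E_h(\alpha)=e_h(\sigma_1(\alpha),\dots,\sigma_n(\alpha))$ where $e_h$ is the $h$th elementary symmetric polynomial; $g_h(r)=\min\{v_K(E_h(\alpha)):\alpha\in\mathcal{M}_L^r\}$. Indices of inseparability: let $\pi_L$ be a uniformizer of $L$ with minimal polynomial $X^n-c_1X^{n-1}+\dots+(-1)^nc_n$ over $K$; with $\overline{v}_p(k)=\min\{v_p(k),\nu\}$, set $i_j^{\pi_L}=\min\{nv_K(c_h)-h:1\le h\le n,\ \overline{v}_p(h)\le j\}$ and $i_j=\min\{i_{j'}^{\pi_L}+(j'-j)e_L:j\le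 j'\le\nu\}$ for $0\le j\le\nu$ (independent of $\pi_L$). *)

theory Defs
  imports
    "HOL-Algebra.QuotRing"
    "HOL-Library.Extended_Real"
    "HOL-Library.Extended_Nat"
    "HOL-Computational_Algebra.Computational_Algebra"
    "Jordan_Normal_Form.Char_Poly"
begin

section \<open>Complete discretely valued fields\<close>

text \<open>
  Valuations take values in \<open>\<int> \<union> {\<infinity>}\<close>, seen inside the extended reals, and are
  normalized: the value group is exactly \<open>\<int>\<close>.
\<close>

definition discrete_valuation :: "('a::field \<Rightarrow> ereal) \<Rightarrow> bool" where
  "discrete_valuation v \<longleftrightarrow>
     (\<forall>x. v x = \<infinity> \<longleftrightarrow> x = 0) \<and>
     v ` (UNIV - {0}) = range (\<lambda>m::int. ereal (real_of_int m)) \<and>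
     (\<forall>x y. v (x * y) = v x + v y) \<and>
     (\<forall>x y. min (v x) (v y) \<le> v (x + y))"

definition complete_valuation :: "('a::field \<Rightarrow> ereal) \<Rightarrow> bool" where
  "complete_valuation v \<longleftrightarrow>
     (\<forall>X :: nat \<Rightarrow> 'a.
        (\<forall>M::int. \<exists>N. \<forall>k\<ge>N. \<forall>l\<ge>N. ereal (real_of_int M) \<le> v (X k - X l)) \<longrightarrow>
        (\<exists>x. \<forall>M::int. \<exists>N. \<forall>k\<ge>N. ereal (real_of_int M) \<le> v (X k - x)))"

text \<open>
  The fractional ideal \<open>M\<^sup>r\<close> (\<open>r \<in> \<int>\<close>), where \<open>M\<close> is the maximal ideal of the
  valuation ring; \<open>r = 0\<close> is the valuation ring itself and \<open>r = 1\<close> is \<open>M\<close>.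
\<close>

definition max_ideal_power :: "('a::field \<Rightarrow> ereal) \<Rightarrow> int \<Rightarrow> 'a set" where
  "max_ideal_power v r = {x. ereal (real_of_int r) \<le> v x}"

definition valuation_ring :: "('a::field \<Rightarrow> ereal) \<Rightarrow> 'a ring" where
  "valuation_ring v =
     \<lparr>carrier = max_ideal_power v 0, monoid.mult = (*), one = 1, zero = 0, add = (+)\<rparr>"

definition residue_field :: "('a::field \<Rightarrow> ereal) \<Rightarrow> 'a set ring" where
  "residue_field v = valuation_ring v Quot max_ideal_power v 1"

definition perfect_of_char :: "('b, 'c) ring_scheme \<Rightarrow> nat \<Rightarrow> bool" where
  "perfect_of_char R p \<longleftrightarrow>
     field R \<and> prime p \<and> [p] \<cdot>\<^bsub>R\<^esub> \<one>\<^bsub>R\<^esub> = \<zero>\<^bsub>R\<^esub> \<and>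
     (\<forall>a\<in>carrier R. \<exists>b\<in>carrier R. b [^]\<^bsub>R\<^esub> p = a)"

text \<open>The submodule over the valuation ring generated by a set.\<close>

definition valuation_ring_span :: "('a::field \<Rightarrow> ereal) \<Rightarrow> 'a set \<Rightarrow> 'a set" where
  "valuation_ring_span v S =
     {\<Sum>i<m. a i * s i | (m::nat) a s. \<forall>i<m. a i \<in> max_ideal_power v 0 \<and> s i \<in> S}"

section \<open>Field extensions\<close>

text \<open>
  An extension is given by a field homomorphism from the base field; a tower
  \<open>K \<subseteq> L \<subseteq> K\<^sup>s\<^sup>e\<^sup>p\<close> by \<open>\<iota> : K \<rightarrow> L\<close> and \<open>\<kappa> : L \<rightarrow> K\<^sup>s\<^sup>e\<^sup>p\<close>.
\<close>

definition ext_degree :: "('k::field \<Rightarrow> 'l::field) \<Rightarrow> nat" where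
  "ext_degree \<iota> = vector_space.dim (\<lambda>c x. \<iota> c * x) (UNIV :: 'l set)"

definition separable_poly :: "'a::field poly \<Rightarrow> bool" where
  "separable_poly f \<longleftrightarrow> coprime f (pderiv f)"

definition separable_closure :: "('k::field \<Rightarrow> 's::field) \<Rightarrow> bool" where
  "separable_closure \<iota> \<longleftrightarrow>
     field_hom \<iota> \<and>
     (\<forall>x. \<exists>f. separable_poly f \<and> poly (map_poly \<iota> f) x = 0) \<and>
     (\<forall>f :: 's poly. separable_poly f \<and> degree f > 0 \<longrightarrow> (\<exists>x. poly f x = 0))"

definition min_poly :: "('k::field \<Rightarrow> 'l::field) \<Rightarrow> 'l \<Rightarrow> 'k poly" where
  "min_poly \<iota> x =
     (THE f. lead_coeff f = 1 \<and> poly (map_poly \<iota> f) x = 0 \<and>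
             (\<forall>g. g \<noteq> 0 \<and> poly (map_poly \<iota> g) x = 0 \<longrightarrow> degree f \<le> degree g))"

text \<open>
  \<open>v\<^sub>L\<close> is normalized, so this says that \<open>v\<^sub>L\<close> lies over \<open>v\<^sub>K\<close> and that the
  ramification index equals the degree.
\<close>

definition totally_ramified ::
  "('k::field \<Rightarrow> 'l::field) \<Rightarrow> ('k \<Rightarrow> ereal) \<Rightarrow> ('l \<Rightarrow> ereal) \<Rightarrow> bool" where
  "totally_ramified \<iota> vK vL \<longleftrightarrow>
     discrete_valuation vL \<and> (\<forall>x. vL (\<iota> x) = ereal (real (ext_degree \<iota>)) * vK x)"

definition embeddings :: "('k::field \<Rightarrow> 'l::field) \<Rightarrow> ('l \<Rightarrow> 's::field) \<Rightarrow> ('l \<Rightarrow> 's) set" where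
  "embeddings \<iota> \<kappa> = {\<sigma>. field_hom \<sigma> \<and> \<sigma> \<circ> \<iota> = \<kappa> \<circ> \<iota>}"

section \<open>Elementary symmetric functions of conjugates\<close>

text \<open>The \<open>h\<close>th elementary symmetric polynomial in the family \<open>(x i)\<close>, \<open>i \<in> I\<close>.\<close>

definition elem_sym :: "nat \<Rightarrow> ('i \<Rightarrow> 'a::comm_ring_1) \<Rightarrow> 'i set \<Rightarrow> 'a" where
  "elem_sym h x I = (\<Sum>S | S \<subseteq> I \<and> card S = h. \<Prod>i\<in>S. x i)"

text \<open>
  A symmetric function of the conjugates lies in the image of \<open>K\<close> in \<open>K\<^sup>s\<^sup>e\<^sup>p\<close>;
  \<open>conj_sym\<close> (the function \<open>E\<^sub>h\<close>) is its preimage in \<open>K\<close>.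
\<close>

definition conj_sym :: "('k::field \<Rightarrow> 'l::field) \<Rightarrow> ('l \<Rightarrow> 's::field) \<Rightarrow> nat \<Rightarrow> 'l \<Rightarrow> 'k" where
  "conj_sym \<iota> \<kappa> h \<alpha> = the_inv (\<kappa> \<circ> \<iota>) (elem_sym h (\<lambda>\<sigma>. \<sigma> \<alpha>) (embeddings \<iota> \<kappa>))"

text \<open>
  The function \<open>g\<^sub>h(r)\<close>: the values lie in \<open>\<int> \<union> {\<infinity>}\<close>, so a finite infimum is attained, i.e. it is a minimum.
\<close>

definition min_val_conj_sym ::
  "('k::field \<Rightarrow> 'l::field) \<Rightarrow> ('l \<Rightarrow> 's::field) \<Rightarrow> ('k \<Rightarrow> ereal) \<Rightarrow> ('l \<Rightarrow> ereal) \<Rightarrow>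
   nat \<Rightarrow> int \<Rightarrow> ereal" where
  "min_val_conj_sym \<iota> \<kappa> vK vL h r = (INF \<alpha>\<in>max_ideal_power vL r. vK (conj_sym \<iota> \<kappa> h \<alpha>))"

section \<open>Indices of inseparability\<close>

text \<open>The \<open>p\<close>-adic valuation of an integer, with value \<open>\<infinity>\<close> at \<open>0\<close>, truncated at \<open>\<nu>\<close>.\<close>

definition vp :: "nat \<Rightarrow> int \<Rightarrow> enat" where
  "vp p k = (if k = 0 then \<infinity> else enat (multiplicity (int p) k))"

definition vp_trunc :: "nat \<Rightarrow> nat \<Rightarrow> int \<Rightarrow> enat" where
  "vp_trunc p \<nu> k = min (vp p k) (enat \<nu>)"

text \<open>
  \<open>c\<^sub>h\<close> for the minimal polynomial \<open>X\<^sup>n - c\<^sub>1 X\<^sup>n\<^sup>-\<^sup>1 + \<dots> + (-1)\<^sup>n c\<^sub>n\<close> of \<open>\<pi>\<close>.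
\<close>

definition min_poly_c :: "('k::field \<Rightarrow> 'l::field) \<Rightarrow> 'l \<Rightarrow> nat \<Rightarrow> 'k" where
  "min_poly_c \<iota> \<pi> h = (-1) ^ h * coeff (min_poly \<iota> \<pi>) (ext_degree \<iota> - h)"

definition insep_index_unif ::
  "('k::field \<Rightarrow> 'l::field) \<Rightarrow> ('k \<Rightarrow> ereal) \<Rightarrow> nat \<Rightarrow> nat \<Rightarrow> 'l \<Rightarrow> nat \<Rightarrow> ereal" where
  "insep_index_unif \<iota> vK p \<nu> \<pi> j =
     Min {ereal (real (ext_degree \<iota>)) * vK (min_poly_c \<iota> \<pi> h) - ereal (real h) | h.
            1 \<le> h \<and> h \<le> ext_degree \<iota> \<and> vp_trunc p \<nu> (int h) \<le> enat j}"

text \<open>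
  Here \<open>vL (of_nat p)\<close> is \<open>e\<^sub>L\<close>; it is \<open>\<infinity>\<close> in characteristic \<open>p\<close>, in which case the term
  for \<open>j' = j\<close> is unaffected because \<open>0 * \<infinity> = 0\<close>.
\<close>

definition insep_index_ereal ::
  "('k::field \<Rightarrow> 'l::field) \<Rightarrow> ('k \<Rightarrow> ereal) \<Rightarrow> ('l \<Rightarrow> ereal) \<Rightarrow> nat \<Rightarrow> nat \<Rightarrow> 'l \<Rightarrow> nat \<Rightarrow> ereal"
  where
  "insep_index_ereal \<iota> vK vL p \<nu> \<pi> j =
     Min {insep_index_unif \<iota> vK p \<nu> \<pi> j' + ereal (real (j' - j)) * vL (of_nat p) | j'.
            j \<le> j' \<and> j' \<le> \<nu>}"

text \<open>
  For a separable extension the minimum is a (finite) integer; the floor only changes its type.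
\<close>

definition insep_index ::
  "('k::field \<Rightarrow> 'l::field) \<Rightarrow> ('k \<Rightarrow> ereal) \<Rightarrow> ('l \<Rightarrow> ereal) \<Rightarrow> nat \<Rightarrow> nat \<Rightarrow> 'l \<Rightarrow> nat \<Rightarrow> int"
  where
  "insep_index \<iota> vK vL p \<nu> \<pi> j = \<lfloor>real_of_ereal (insep_index_ereal \<iota> vK vL p \<nu> \<pi> j)\<rfloor>"

end

theory Submission
  imports Defs "HOL-Number_Theory.Cong" "HOL-Algebra.Exponent"
begin

text \<open>
  Let \<open>F = \<Prod>(1 - \<sigma>(\<pi>) X)\<close>, a series over \<open>K\<close> whose coefficients are the \<open>\<plusminus>c\<^sub>h\<close>. The operation
  \<open>1 - y X \<mapsto> 1 - y\<^sup>s X\<close> extends multiplicatively to all power series with constant term 1: it is the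
  Frobenius of the big Witt vectors, and it is a composite of norms \<open>F(X) \<mapsto> \<Prod>\<^sub>i F(\<omega>\<^sup>i X)\<close> for prime
  \<open>l\<close> and \<open>\<omega>\<^sup>l = 1\<close>. It maps \<open>F\<close> to \<open>\<Prod>(1 - \<sigma>(\<pi>)\<^sup>s X)\<close>, with coefficients \<open>\<plusminus>E\<^sub>k(\<pi>\<^sup>s)\<close>. Every series is a
  product of binomials \<open>1 - c X\<^sup>h\<close>, on which the operation is explicit. Reading valuations off the
  binomials shows that \<open>n v\<^sub>K(coeff\<^sub>k) \<ge> t k + i\<^sub>k\<close> (the index of inseparability at \<open>min {v\<^sub>p(k), \<nu>}\<close>)
  is preserved with \<open>t\<close> replaced by \<open>t s\<close>, and that the new \<open>k\<close>-th coefficient is \<open>s\<close> times the old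
  \<open>s k\<close>-th one up to terms of larger valuation.

  Lower bound: \<open>1 - \<alpha> X\<close> is a product of binomials \<open>1 - b \<pi>\<^sup>s X\<^sup>h\<close> with \<open>b\<close> in \<open>K\<close>, and so the norm of
  \<open>1 - \<alpha> X\<close> obeys the same estimate. Attainment: take \<open>\<alpha> = b \<pi>\<^sup>s\<close>. The index \<open>i\<^sub>j\<close> comes from
  exactly one \<open>c\<^sub>h\<close>, because its class modulo \<open>n\<close> determines \<open>h\<close>, and the contribution of this \<open>c\<^sub>h\<close> to
  \<open>E\<^bsub>p\<^sup>j\<^esub>(\<pi>\<^sup>s)\<close> is computed exactly.
\<close>

section \<open>Products of binomial series\<close>

no_notation vec_index (infixl "$" 100)

definition one_minus_monom :: "'a::comm_ring_1 \<Rightarrow> nat \<Rightarrow> 'a fps" where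
  "one_minus_monom c h = 1 - fps_const c * fps_X ^ h"

lemma one_minus_monom_0 [simp]: "one_minus_monom 0 h = 1"
  by (simp add: one_minus_monom_def)

lemma one_minus_monom_mult_nth:
  "(one_minus_monom c h * F) $ l = F $ l - (if h \<le> l then c * F $ (l - h) else 0)"
proof -
  have "one_minus_monom c h * F = F - fps_const c * (fps_X ^ h * F)"
    by (simp add: one_minus_monom_def algebra_simps)
  then show ?thesis by (simp add: fps_X_power_mult_nth)
qed

lemma one_minus_monom_nth:
  "h \<ge> 1 \<Longrightarrow> one_minus_monom c h $ l = (if l = 0 then 1 else if l = h then - c else 0)"
  using one_minus_monom_mult_nth[of c h 1 l] by auto

lemma one_minus_monom_nth_0 [simp]: "h > 0 \<Longrightarrow> one_minus_monom c h $ 0 = 1"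
  by (simp add: one_minus_monom_nth)

lemma fps_of_poly_one_minus_monom: "fps_of_poly [:1, - c:] = one_minus_monom c 1"
  by (rule fps_ext) (auto simp: one_minus_monom_nth coeff_pCons split: nat.splits)

lemma one_minus_monom_compose_linear:
  "one_minus_monom c h oo (fps_const z * fps_X) = one_minus_monom (c * z ^ h) h"
  by (rule fps_ext) (auto simp: one_minus_monom_def fps_compose_linear)

lemma one_minus_monom_compose_X_power:
  fixes c :: "'a::idom"
  assumes "d \<ge> 1"
  shows "one_minus_monom c h oo fps_X ^ d = one_minus_monom c (h * d)"
proof -
  have "(fps_X ^ d) $ 0 = (0 :: 'a)" using assms by simp
  then show ?thesis
    by (simp add: one_minus_monom_def fps_compose_sub_distrib fps_compose_mult_distrib
        fps_X_power_compose power_mult[symmetric] mult.commute)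
qed

lemma prod_one_minus_monom_nth:
  fixes a :: "'i \<Rightarrow> 'a::idom"
  assumes "h \<ge> 1"
  shows "(\<Prod>i\<in>I. one_minus_monom (a i) h) $ l =
    (if h dvd l then (\<Prod>i\<in>I. one_minus_monom (a i) 1) $ (l div h) else 0)"
proof -
  have "(fps_X ^ h) $ 0 = (0 :: 'a)" using assms by simp
  then have "(\<Prod>i\<in>I. one_minus_monom (a i) 1) oo fps_X ^ h = (\<Prod>i\<in>I. one_minus_monom (a i) h)"
    using assms by (simp add: fps_compose_prod_distrib one_minus_monom_compose_X_power)
  then show ?thesis by (metis fps_nth_compose_X_power)
qed

lemma prod_one_minus_monom_scale_nth:
  fixes a :: "'i \<Rightarrow> 'a::idom"
  shows "(\<Prod>i\<in>I. one_minus_monom (c * a i) 1) $ k =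
    c ^ k * (\<Prod>i\<in>I. one_minus_monom (a i) 1) $ k"
proof -
  have "(fps_const c * fps_X) $ 0 = 0" by simp
  then have "(\<Prod>i\<in>I. one_minus_monom (a i) 1) oo (fps_const c * fps_X) =
      (\<Prod>i\<in>I. one_minus_monom (a i * c ^ 1) 1)"
    by (simp only: fps_compose_prod_distrib one_minus_monom_compose_linear)
  then have "(\<Prod>i\<in>I. one_minus_monom (c * a i) 1) =
      (\<Prod>i\<in>I. one_minus_monom (a i) 1) oo (fps_const c * fps_X)"
    by (simp add: mult.commute[of c])
  then show ?thesis by (metis fps_compose_linear fps_nth_Abs_fps)
qed

lemma one_minus_monom_power_nth:
  fixes c :: "'a::idom"
  assumes "h \<ge> 1"
  shows "(one_minus_monom c h ^ m) $ l =
    (if h dvd l then of_nat (m choose (l div h)) * (- c) ^ (l div h) else 0)"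
proof -
  have "(one_minus_monom c 1 ^ m) $ k = of_nat (m choose k) * (- c) ^ k" for k
  proof (induction m arbitrary: k)
    case 0
    then show ?case by (cases k) auto
  next
    case (Suc m)
    then show ?case
      by (cases k) (auto simp: one_minus_monom_mult_nth algebra_simps)
  qed
  then show ?thesis
    using prod_one_minus_monom_nth[OF assms, of "\<lambda>_. c" "{..<m}" l] by simp
qed

lemma prod_one_minus_monom_elem_sym:
  assumes "finite I"
  shows "(\<Prod>i\<in>I. one_minus_monom (x i) 1) $ k = (-1) ^ k * elem_sym k x I"
proof -
  have monomial: "(\<Prod>i\<in>B. - (fps_const (x i) * fps_X)) =
    fps_const ((-1) ^ card B * (\<Prod>i\<in>B. x i)) * fps_X ^ card B" if "finite B" for B
    using that
    by (induction B rule: finite_induct)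
      (auto simp: algebra_simps fps_const_mult[symmetric] fps_const_neg[symmetric]
        simp del: fps_const_mult fps_const_neg)
  have "(\<Prod>i\<in>I. one_minus_monom (x i) 1) = (\<Prod>i\<in>I. - (fps_const (x i) * fps_X) + 1)"
    by (simp add: one_minus_monom_def)
  also have "\<dots> = (\<Sum>B\<in>Pow I. (\<Prod>i\<in>B. - (fps_const (x i) * fps_X)) * (\<Prod>i\<in>I-B. 1))"
    by (rule prod_add[OF assms])
  also have "\<dots> = (\<Sum>B\<in>Pow I. fps_const ((-1) ^ card B * (\<Prod>i\<in>B. x i)) * fps_X ^ card B)"
    using assms by (intro sum.cong) (auto simp: monomial finite_subset)
  finally have "(\<Prod>i\<in>I. one_minus_monom (x i) 1) $ k =
      (\<Sum>B\<in>Pow I. (-1) ^ card B * (\<Prod>i\<in>B. x i) * (if k = card B then 1 else 0))"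
    by (simp add: fps_sum_nth)
  also have "\<dots> = (\<Sum>B\<in>{B. B \<subseteq> I \<and> card B = k}. (-1) ^ k * (\<Prod>i\<in>B. x i))"
    using assms by (intro sum.mono_neutral_cong_right) auto
  finally show ?thesis by (simp add: elem_sym_def sum_distrib_left)
qed

definition fps_agree :: "nat \<Rightarrow> 'a::comm_ring_1 fps \<Rightarrow> 'a fps \<Rightarrow> bool" where
  "fps_agree m F G \<longleftrightarrow> (\<forall>l\<le>m. F $ l = G $ l)"

lemma fps_agree_refl [simp]: "fps_agree m F F"
  by (simp add: fps_agree_def)

lemma fps_agree_mult:
  "fps_agree m F F' \<Longrightarrow> fps_agree m G G' \<Longrightarrow> fps_agree m (F * G) (F' * G')"
  unfolding fps_agree_def fps_mult_nth by (intro allI impI sum.cong) auto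

lemma fps_agree_prod:
  assumes "\<And>i. i \<in> I \<Longrightarrow> fps_agree m (F i) (G i)"
  shows "fps_agree m (\<Prod>i\<in>I. F i) (\<Prod>i\<in>I. G i)"
  using assms by (induction I rule: infinite_finite_induct) (auto intro: fps_agree_mult)

lemma fps_mult_nth_units:
  fixes F G :: "'a::comm_ring_1 fps"
  assumes "F $ 0 = 1" "G $ 0 = 1" "l \<ge> 1"
  shows "(F * G) $ l = F $ l + G $ l + (\<Sum>i\<in>{1..<l}. F $ i * G $ (l - i))"
proof -
  have "{0..l} = insert 0 (insert l {1..<l})" using assms by auto
  then show ?thesis using assms by (simp add: fps_mult_nth add_ac)
qed

definition graded_subring :: "(nat \<Rightarrow> 'a::comm_ring_1 set) \<Rightarrow> bool" where
  "graded_subring G \<longleftrightarrow>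
     (\<forall>h\<ge>1. 0 \<in> G h \<and> (\<forall>x\<in>G h. \<forall>y\<in>G h. x - y \<in> G h)) \<and>
     (\<forall>a\<ge>1. \<forall>b\<ge>1. \<forall>x\<in>G a. \<forall>y\<in>G b. x * y \<in> G (a + b))"

definition unit_series :: "(nat \<Rightarrow> 'a::comm_ring_1 set) \<Rightarrow> 'a fps \<Rightarrow> bool" where
  "unit_series G F \<longleftrightarrow> F $ 0 = 1 \<and> (\<forall>l\<ge>1. F $ l \<in> G l)"

lemma graded_subring_add:
  assumes "graded_subring G" "h \<ge> 1" "x \<in> G h" "y \<in> G h"
  shows "x + y \<in> G h"
proof -
  have "x - (0 - y) \<in> G h" using assms unfolding graded_subring_def by blast
  then show ?thesis by simp
qed

lemma graded_subring_sum:
  assumes "graded_subring G" "h \<ge> 1" "\<And>i. i \<in> I \<Longrightarrow> f i \<in> G h"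
  shows "sum f I \<in> G h"
  using assms(3)
proof (induction I rule: infinite_finite_induct)
  case (insert x F)
  then show ?case using graded_subring_add[OF assms(1,2)] by simp
qed (use assms in \<open>auto simp: graded_subring_def\<close>)

lemma unit_series_1: "graded_subring G \<Longrightarrow> unit_series G 1"
  by (auto simp: unit_series_def graded_subring_def)

lemma unit_series_mult:
  assumes graded: "graded_subring G" and series: "unit_series G F" "unit_series G F'"
  shows "unit_series G (F * F')"
  unfolding unit_series_def
proof (intro conjI allI impI)
  show "(F * F') $ 0 = 1" using series by (simp add: unit_series_def)
next
  fix l :: nat assume l_ge_1: "1 \<le> l"
  have "F $ i * F' $ (l - i) \<in> G l" if "i \<in> {1..<l}" for i
  proof -
    have "F $ i * F' $ (l - i) \<in> G (i + (l - i))"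
      using graded series that unfolding graded_subring_def unit_series_def
      by (metis One_nat_def Suc_leI atLeastLessThan_iff zero_less_diff)
    then show ?thesis using that by simp
  qed
  then have "(\<Sum>i\<in>{1..<l}. F $ i * F' $ (l - i)) \<in> G l"
    by (rule graded_subring_sum[OF graded l_ge_1])
  then show "(F * F') $ l \<in> G l"
    using series l_ge_1 fps_mult_nth_units[of F F' l] graded_subring_add[OF graded l_ge_1]
    by (simp add: unit_series_def)
qed

lemma unit_series_one_minus_monom:
  assumes "graded_subring G" "h \<ge> 1" "c \<in> G h"
  shows "unit_series G (one_minus_monom c h)"
proof -
  have "0 - c \<in> G h" using assms unfolding graded_subring_def by blast
  then show ?thesis using assms
    by (auto simp: unit_series_def one_minus_monom_nth graded_subring_def)
qed

definition binomial_product :: "('a::comm_ring_1 \<times> nat) list \<Rightarrow> 'a fps" where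
  "binomial_product bs = (\<Prod>(c, h)\<leftarrow>bs. one_minus_monom c h)"

lemma binomial_product_Nil [simp]: "binomial_product [] = 1"
  by (simp add: binomial_product_def)

lemma binomial_product_Cons [simp]:
  "binomial_product ((c, h) # bs) = one_minus_monom c h * binomial_product bs"
  by (simp add: binomial_product_def)

lemma unit_series_binomial_product:
  assumes graded: "graded_subring G" and bs: "\<forall>(c, h)\<in>set bs. h \<ge> 1 \<and> c \<in> G h"
  shows "unit_series G (binomial_product bs)"
  using bs
proof (induction bs)
  case Nil
  then show ?case using unit_series_1[OF graded] by simp
next
  case (Cons b bs)
  then have "unit_series G (binomial_product bs)" by simp
  moreover obtain c h where b: "b = (c, h)" by fastforce
  then have "unit_series G (one_minus_monom c h)"
    using Cons.prems by (intro unit_series_one_minus_monom[OF graded]) auto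
  ultimately show ?case unfolding b by (simp add: unit_series_mult[OF graded])
qed

lemma binomial_product_correct_coefficient:
  fixes cs :: "'a::comm_ring_1 list" and bs :: "('a \<times> nat) list" and m :: nat
  defines "bs' \<equiv> map (\<lambda>c. (c, Suc m)) cs @ bs"
  assumes "binomial_product bs $ 0 = 1"
  shows "fps_agree m (binomial_product bs) (binomial_product bs') \<and>
    binomial_product bs' $ Suc m = binomial_product bs $ Suc m - sum_list cs"
  unfolding bs'_def
proof (induction cs)
  case (Cons c cs)
  then have "binomial_product (map (\<lambda>c. (c, Suc m)) cs @ bs) $ 0 = 1"
    using assms(2) by (simp add: fps_agree_def)
  then show ?case using Cons by (simp add: fps_agree_def one_minus_monom_mult_nth)
qed simp

lemma unit_series_binomial_approximation:
  assumes graded: "graded_subring G" and subset: "\<And>h. h \<ge> 1 \<Longrightarrow> S h \<subseteq> G h"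
    and generates: "\<And>h x. h \<ge> 1 \<Longrightarrow> x \<in> G h \<Longrightarrow> \<exists>cs. set cs \<subseteq> S h \<and> x = sum_list cs"
    and series: "unit_series G F"
  shows "\<exists>bs. (\<forall>(c, h)\<in>set bs. h \<ge> 1 \<and> c \<in> S h) \<and> fps_agree m F (binomial_product bs)"
proof (induction m)
  case 0
  then show ?case using series by (intro exI[of _ "[]"]) (simp add: fps_agree_def unit_series_def)
next
  case (Suc m)
  then obtain bs where bs: "\<forall>(c, h)\<in>set bs. h \<ge> 1 \<and> c \<in> S h"
    and agree: "fps_agree m F (binomial_product bs)" by blast
  have "\<forall>(c, h)\<in>set bs. h \<ge> 1 \<and> c \<in> G h" using bs subset by blast
  then have product: "unit_series G (binomial_product bs)"
    by (rule unit_series_binomial_product[OF graded])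
  have "binomial_product bs $ Suc m - F $ Suc m \<in> G (Suc m)"
    using graded product series
    unfolding graded_subring_def unit_series_def by (metis One_nat_def Suc_le_mono le0)
  then obtain cs where cs: "set cs \<subseteq> S (Suc m)"
    "binomial_product bs $ Suc m - F $ Suc m = sum_list cs"
    using generates[of "Suc m"] by auto
  define bs' where "bs' = map (\<lambda>c. (c, Suc m)) cs @ bs"
  have "fps_agree m (binomial_product bs) (binomial_product bs')"
    "binomial_product bs' $ Suc m = F $ Suc m"
    using binomial_product_correct_coefficient[of bs m cs] product cs(2)
    by (simp_all add: bs'_def unit_series_def algebra_simps)
  then have "fps_agree (Suc m) F (binomial_product bs')"
    using agree by (auto simp: fps_agree_def le_Suc_eq)
  moreover have "\<forall>(c, h)\<in>set bs'. h \<ge> 1 \<and> c \<in> S h" using bs cs(1) by (auto simp: bs'_def)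
  ultimately show ?case by blast
qed

lemma unit_series_limit_induct [consumes 2, case_names subset generates one mult binomial limit]:
  assumes graded: "graded_subring G" and series: "unit_series G F"
    and subset: "\<And>h. h \<ge> 1 \<Longrightarrow> S h \<subseteq> G h"
    and generates: "\<And>h x. h \<ge> 1 \<Longrightarrow> x \<in> G h \<Longrightarrow> \<exists>cs. set cs \<subseteq> S h \<and> x = sum_list cs"
    and one: "P 1"
    and mult: "\<And>A B. unit_series G A \<Longrightarrow> unit_series G B \<Longrightarrow> P A \<Longrightarrow> P B \<Longrightarrow> P (A * B)"
    and binomial: "\<And>c h. h \<ge> 1 \<Longrightarrow> c \<in> S h \<Longrightarrow> P (one_minus_monom c h)"
    and limit: "\<And>F. unit_series G F \<Longrightarrow>
      (\<And>m. \<exists>Q. unit_series G Q \<and> P Q \<and> fps_agree m F Q) \<Longrightarrow> P F"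
  shows "P F"
proof (rule limit[OF series])
  fix m
  obtain bs where bs: "\<forall>(c, h)\<in>set bs. h \<ge> 1 \<and> c \<in> S h" "fps_agree m F (binomial_product bs)"
    using unit_series_binomial_approximation[OF graded subset generates series] by blast
  have "unit_series G (binomial_product bs) \<and> P (binomial_product bs)" using bs(1)
  proof (induction bs)
    case Nil
    then show ?case using one unit_series_1[OF graded] by simp
  next
    case (Cons b bs)
    obtain c h where b: "b = (c, h)" by fastforce
    then have c_in: "h \<ge> 1" "c \<in> S h" using Cons.prems by auto
    then have "unit_series G (one_minus_monom c h)"
      using subset by (intro unit_series_one_minus_monom[OF graded]) auto
    then show ?case
      using Cons binomial[OF c_in] mult unit_series_mult[OF graded] by (simp add: b)
  qed
  then show "\<exists>Q. unit_series G Q \<and> P Q \<and> fps_agree m F Q" using bs(2) by blast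
qed

section \<open>The Frobenius of the big Witt vectors\<close>

definition separably_closed :: "'a::field itself \<Rightarrow> bool" where
  "separably_closed (_ :: 'a itself) \<longleftrightarrow>
     (\<forall>f :: 'a poly. separable_poly f \<and> degree f > 0 \<longrightarrow> (\<exists>x. poly f x = 0))"

lemma separable_poly_dvd:
  assumes "separable_poly f" "g dvd f"
  shows "separable_poly g"
proof -
  obtain k where k: "f = g * k" using assms(2) by blast
  have "pderiv f = g * pderiv k + k * pderiv g" by (simp add: k pderiv_mult)
  moreover have "d dvd f" if "d dvd g" for d using that k by simp
  ultimately have "d dvd f \<and> d dvd pderiv f" if "d dvd g" "d dvd pderiv g" for d
    using that by simp
  then show ?thesis using assms(1) unfolding separable_poly_def coprime_def by blast
qed

lemma separable_poly_monom_minus_1: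
  assumes "of_nat m \<noteq> (0::'a::field)"
  shows "separable_poly (monom (1::'a) m - 1)"
proof -
  have "m \<ge> 1" using assms by (cases m) auto
  then have "monom (inverse (of_nat m)) 1 * pderiv (monom (1::'a) m - 1) - (monom 1 m - 1) = 1"
    using assms by (simp add: pderiv_diff pderiv_monom mult_monom)
  then have "d dvd 1" if "d dvd monom (1::'a) m - 1" "d dvd pderiv (monom (1::'a) m - 1)" for d
    using that by (metis dvd_diff dvd_mult)
  then show ?thesis unfolding separable_poly_def by (intro coprimeI) auto
qed

lemma exists_nontrivial_root_of_unity:
  assumes closed: "separably_closed TYPE('a::field)"
    and m_ge_2: "m \<ge> 2" "of_nat m \<noteq> (0::'a)"
  shows "\<exists>\<omega>::'a. \<omega> ^ m = 1 \<and> \<omega> \<noteq> 1"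
proof -
  define f :: "'a poly" where "f = monom 1 m - 1"
  define g :: "'a poly" where "g = (\<Sum>i<m. monom 1 i)"
  have "f = [:0, 1:] ^ m - 1" by (simp add: f_def monom_altdef)
  also have "\<dots> = ([:0, 1:] - 1) * (\<Sum>i<m. [:0, 1:] ^ i)" by (rule power_diff_1_eq)
  finally have factor: "f = [:-1, 1:] * g" by (simp add: g_def one_pCons monom_altdef)
  have "separable_poly g"
    using separable_poly_dvd[OF separable_poly_monom_minus_1[OF m_ge_2(2)]] factor
    by (metis dvd_triv_right f_def)
  moreover have "coeff g (m - 1) \<noteq> 0" using m_ge_2(1) by (simp add: g_def coeff_sum)
  then have "degree g > 0" using le_degree[of g "m - 1"] m_ge_2(1) by simp
  ultimately obtain \<omega> where root: "poly g \<omega> = 0"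
    using closed unfolding separably_closed_def by blast
  have "\<omega> ^ m = 1"
    using arg_cong[OF factor, of "\<lambda>q. poly q \<omega>"] root by (simp add: f_def poly_monom)
  moreover have "\<omega> \<noteq> 1" using root m_ge_2(2) by (auto simp: g_def poly_sum poly_monom)
  ultimately show ?thesis by blast
qed

lemma inj_on_power_root_of_unity:
  fixes \<omega> :: "'a::field"
  assumes prime_l: "prime l" and root_of_unity: "\<omega> ^ l = 1" "\<omega> \<noteq> 1"
  shows "inj_on (\<lambda>i. \<omega> ^ i) {..<l}"
proof (rule linorder_inj_onI')
  fix i j assume ij: "i \<in> {..<l}" "j \<in> {..<l}" "i < j"
  show "\<omega> ^ i \<noteq> \<omega> ^ j"
  proof
    assume eq: "\<omega> ^ i = \<omega> ^ j"
    have "\<omega> \<noteq> 0"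
      using root_of_unity(1) prime_gt_0_nat[OF prime_l]
      by (auto simp: power_0_left split: if_splits)
    moreover have "\<omega> ^ j = \<omega> ^ i * \<omega> ^ (j - i)" using ij by (simp add: power_add[symmetric])
    ultimately have one: "\<omega> ^ (j - i) = 1" using eq by simp
    have "\<not> l dvd j - i" using ij by (auto dest!: dvd_imp_le)
    then have "coprime (j - i) l" using prime_l prime_imp_coprime coprime_commute by blast
    then obtain x y where "(j - i) * x = l * y + 1"
      using ij by (metis bezout_nat coprime_imp_gcd_eq_1 zero_less_diff less_numeral_extra(3))
    then have "\<omega> ^ ((j - i) * x) = (\<omega> ^ l) ^ y * \<omega>" by (simp add: power_add power_mult)
    then show False using root_of_unity by (simp add: power_mult one)
  qed
qed

lemma prod_one_minus_powers:
  fixes \<omega> :: "'a::field"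
  assumes l_ge_1: "l \<ge> 1" and root_of_unity: "\<omega> ^ l = 1" and inj: "inj_on (\<lambda>i. \<omega> ^ i) {..<l}"
  shows "(\<Prod>i<l. [:1, - (\<omega> ^ i):]) = 1 - monom 1 l" (is "?P = ?Q")
proof (rule poly_eqI_degree[where A = "insert 0 ((\<lambda>i. \<omega> ^ i) ` {..<l})"])
  fix x assume "x \<in> insert 0 ((\<lambda>i. \<omega> ^ i) ` {..<l})"
  then consider (zero) "x = 0" | (power) j where "j < l" "x = \<omega> ^ j" by auto
  then show "poly ?P x = poly ?Q x"
  proof cases
    case zero
    then show ?thesis using l_ge_1 by (simp add: poly_prod poly_monom power_0_left)
  next
    case power
    define i where "i = (l - j) mod l"
    have "\<omega> ^ (i + j) = 1" using root_of_unity power by (cases "j = 0") (auto simp: i_def)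
    then have "poly [:1, - (\<omega> ^ i):] x = 0" using power by (simp add: power_add mult.commute)
    moreover have "i < l" using l_ge_1 by (simp add: i_def)
    ultimately have "poly ?P x = 0" by (auto simp: poly_prod)
    moreover have "(\<omega> ^ j) ^ l = (\<omega> ^ l) ^ j" by (simp only: power_mult[symmetric] mult.commute)
    then have "poly ?Q x = 0" using power root_of_unity by (simp add: poly_monom)
    ultimately show ?thesis by simp
  qed
next
  have "\<omega> \<noteq> 0" using root_of_unity l_ge_1 by (auto simp: power_0_left split: if_splits)
  then have card: "card (insert 0 ((\<lambda>i. \<omega> ^ i) ` {..<l})) = Suc l"
    using inj by (auto simp: card_image card_insert_if)
  have "degree ?P \<le> (\<Sum>i<l. degree [:1, - (\<omega> ^ i):])"
    using degree_prod_sum_le[of "{..<l}" "\<lambda>i. [:1, - (\<omega> ^ i):]"]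
    by (simp only: o_def finite_lessThan)
  also have "\<dots> \<le> (\<Sum>i<l. 1)" by (rule sum_mono) simp
  finally show "card (insert 0 ((\<lambda>i. \<omega> ^ i) ` {..<l})) > degree ?P" by (simp add: card)
  have "degree ?Q \<le> l" by (intro degree_diff_le) (auto simp: degree_monom_le)
  then show "card (insert 0 ((\<lambda>i. \<omega> ^ i) ` {..<l})) > degree ?Q" by (simp add: card)
qed

text \<open>In characteristic \<open>l\<close> the only such \<open>\<omega>\<close> is \<open>1\<close>.\<close>

definition generates_roots_of_unity :: "nat \<Rightarrow> 'a::field \<Rightarrow> bool" where
  "generates_roots_of_unity l \<omega> \<longleftrightarrow>
     \<omega> ^ l = 1 \<and> (\<Prod>i<l. one_minus_monom (\<omega> ^ i) 1) = one_minus_monom 1 l"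

lemma one_minus_X_power_CHAR:
  assumes "prime l" "of_nat l = (0::'a::field)"
  shows "one_minus_monom (1::'a) 1 ^ l = one_minus_monom 1 l"
proof -
  have "CHAR('a) dvd l" using assms(2) by (simp add: of_nat_eq_0_iff_char_dvd)
  then have "CHAR('a) = l" using assms(1) by (auto simp: prime_nat_iff)
  then have "(1 + - fps_X) ^ l = 1 ^ l + (- fps_X :: 'a fps) ^ l"
    using assms(1) by (intro freshmans_dream) auto
  also have "(- fps_X :: 'a fps) ^ l = - (fps_X ^ l)"
    using assms(1) \<open>CHAR('a) = l\<close> by (intro minus_power_prime_CHAR) auto
  finally show ?thesis by (simp add: one_minus_monom_def)
qed

lemma exists_generates_roots_of_unity:
  assumes closed: "separably_closed TYPE('a::field)" and prime_l: "prime l"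
  shows "\<exists>\<omega>::'a. generates_roots_of_unity l \<omega>"
proof (cases "of_nat l = (0::'a)")
  case True
  then have "generates_roots_of_unity l (1::'a)"
    using one_minus_X_power_CHAR[OF prime_l True] by (simp add: generates_roots_of_unity_def)
  then show ?thesis by blast
next
  case False
  obtain \<omega> :: 'a where root_of_unity: "\<omega> ^ l = 1" "\<omega> \<noteq> 1"
    using exists_nontrivial_root_of_unity[OF closed prime_ge_2_nat[OF prime_l] False] by blast
  have "(\<Prod>i<l. one_minus_monom (\<omega> ^ i) 1) = fps_of_poly (\<Prod>i<l. [:1, - (\<omega> ^ i):])"
    by (simp only: fps_of_poly_prod fps_of_poly_one_minus_monom)
  also have "\<dots> = fps_of_poly (1 - monom 1 l)"
    using prod_one_minus_powers[OF prime_ge_1_nat[OF prime_l] root_of_unity(1)]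
      inj_on_power_root_of_unity[OF prime_l root_of_unity]
    by simp
  also have "\<dots> = one_minus_monom 1 l"
    by (simp add: fps_of_poly_diff fps_of_poly_monom one_minus_monom_def)
  finally show ?thesis using root_of_unity(1) unfolding generates_roots_of_unity_def by blast
qed

text \<open>For a primitive \<open>l\<close>-th root of unity \<open>\<omega>\<close> this is the norm from \<open>A\<lbrakk>X\<rbrakk>\<close> to \<open>A\<lbrakk>X\<^sup>l\<rbrakk>\<close>.\<close>

definition cyclic_norm :: "nat \<Rightarrow> 'a::comm_ring_1 \<Rightarrow> 'a fps \<Rightarrow> 'a fps" where
  "cyclic_norm l \<omega> F = (\<Prod>i<l. F oo (fps_const (\<omega> ^ i) * fps_X))"

lemma cyclic_norm_mult:
  "cyclic_norm l \<omega> (F * G) = cyclic_norm l \<omega> F * cyclic_norm l (\<omega>::'a::idom) G"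
  by (simp add: cyclic_norm_def fps_compose_mult_distrib prod.distrib)

lemma fps_prod_nth_0: "(\<Prod>i\<in>I. F i) $ 0 = (\<Prod>i\<in>I. (F i :: 'a::comm_ring_1 fps) $ 0)"
  by (induction I rule: infinite_finite_induct) auto

lemma cyclic_norm_nth_0: "F $ 0 = 1 \<Longrightarrow> cyclic_norm l \<omega> F $ 0 = 1"
  by (simp add: cyclic_norm_def fps_prod_nth_0 fps_compose_linear)

lemma cyclic_norm_agree: "fps_agree m F G \<Longrightarrow> fps_agree m (cyclic_norm l \<omega> F) (cyclic_norm l \<omega> G)"
  unfolding cyclic_norm_def
  by (rule fps_agree_prod) (auto simp: fps_agree_def fps_compose_linear)

lemma bij_betw_mult_mod:
  fixes h l :: nat
  assumes "coprime h l" "l \<ge> 1"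
  shows "bij_betw (\<lambda>i. i * h mod l) {..<l} {..<l}"
proof -
  have inj: "inj_on (\<lambda>i. i * h mod l) {..<l}"
  proof (rule inj_onI)
    fix i j assume ij: "i \<in> {..<l}" "j \<in> {..<l}" "i * h mod l = j * h mod l"
    then have "[i * h = j * h] (mod l)" by (simp add: cong_def)
    then have "[i = j] (mod l)" using assms(1) cong_mult_rcancel_nat by blast
    then show "i = j" using ij by (simp add: cong_def)
  qed
  moreover have "(\<lambda>i. i * h mod l) ` {..<l} = {..<l}"
    by (rule endo_inj_surj) (use inj assms(2) in auto)
  ultimately show ?thesis by (simp add: bij_betw_def)
qed

lemma cyclic_norm_one_minus_monom:
  "cyclic_norm l \<omega> (one_minus_monom c h) = (\<Prod>i<l. one_minus_monom (c * \<omega> ^ (i * h)) h)"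
  by (simp add: cyclic_norm_def one_minus_monom_compose_linear power_mult)

lemma cyclic_norm_one_minus_monom_dvd:
  assumes "\<omega> ^ l = 1" "l dvd h"
  shows "cyclic_norm l \<omega> (one_minus_monom c h) = one_minus_monom c h ^ l"
proof -
  obtain q where "h = l * q" using assms(2) by blast
  then have "\<omega> ^ (i * h) = (\<omega> ^ l) ^ (i * q)" for i
    by (simp add: power_mult[symmetric] mult_ac)
  then show ?thesis using assms(1) by (simp add: cyclic_norm_one_minus_monom)
qed

lemma prod_one_minus_monom_eq_compose:
  fixes \<omega> :: "'a::field"
  assumes generator: "generates_roots_of_unity l \<omega>" and "h \<ge> 1" "l \<ge> 1"
  shows "(\<Prod>i<l. one_minus_monom (c * \<omega> ^ i) h) = one_minus_monom (c ^ l) (h * l)"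
proof -
  have nth_0: "(fps_const c * fps_X ^ h) $ 0 = 0" using assms by simp
  note compose = fps_compose_sub_distrib fps_compose_mult_distrib[OF nth_0]
    fps_compose_prod_distrib[OF nth_0] fps_X_power_compose[OF nth_0]
    fps_X_fps_compose_startby0[OF nth_0]
  have "one_minus_monom (\<omega> ^ i) 1 oo (fps_const c * fps_X ^ h) = one_minus_monom (c * \<omega> ^ i) h" for i
    by (simp add: one_minus_monom_def compose mult_ac fps_const_mult[symmetric] del: fps_const_mult)
  then have "(\<Prod>i<l. one_minus_monom (c * \<omega> ^ i) h) =
      (\<Prod>i<l. one_minus_monom (\<omega> ^ i) 1) oo (fps_const c * fps_X ^ h)"
    by (simp add: compose)
  also have "\<dots> = one_minus_monom 1 l oo (fps_const c * fps_X ^ h)"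
    using generator by (simp add: generates_roots_of_unity_def)
  also have "\<dots> = one_minus_monom (c ^ l) (h * l)"
    by (simp add: one_minus_monom_def compose power_mult_distrib power_mult)
  finally show ?thesis .
qed

lemma cyclic_norm_one_minus_monom_coprime:
  fixes \<omega> :: "'a::field"
  assumes generator: "generates_roots_of_unity l \<omega>" and "coprime h l" "h \<ge> 1" "l \<ge> 1"
  shows "cyclic_norm l \<omega> (one_minus_monom c h) = one_minus_monom (c ^ l) (h * l)"
proof -
  have periodic: "\<omega> ^ (i mod l) = \<omega> ^ i" for i
  proof -
    have "\<omega> ^ (l * (i div l) + i mod l) = (\<omega> ^ l) ^ (i div l) * \<omega> ^ (i mod l)"
      by (simp only: power_add power_mult)
    then show ?thesis using generator by (simp add: generates_roots_of_unity_def)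
  qed
  have "cyclic_norm l \<omega> (one_minus_monom c h) = (\<Prod>i<l. one_minus_monom (c * \<omega> ^ (i * h mod l)) h)"
    by (simp add: cyclic_norm_one_minus_monom periodic)
  also have "\<dots> = (\<Prod>i<l. one_minus_monom (c * \<omega> ^ i) h)"
    by (rule prod.reindex_bij_betw[OF bij_betw_mult_mod[OF assms(2,4)]])
  finally show ?thesis using prod_one_minus_monom_eq_compose[OF generator assms(3,4)] by simp
qed

lemma graded_subring_UNIV: "graded_subring (\<lambda>_. UNIV)"
  by (simp add: graded_subring_def)

lemma cyclic_norm_one_minus_monom_nth_not_dvd:
  fixes \<omega> :: "'a::field"
  assumes prime_l: "prime l" and generator: "generates_roots_of_unity l \<omega>" and h_ge_1: "h \<ge> 1"
    and not_dvd: "\<not> l dvd m"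
  shows "cyclic_norm l \<omega> (one_minus_monom c h) $ m = 0"
proof (cases "l dvd h")
  case True
  then have "cyclic_norm l \<omega> (one_minus_monom c h) = one_minus_monom c h ^ l"
    using generator by (simp add: cyclic_norm_one_minus_monom_dvd generates_roots_of_unity_def)
  then show ?thesis
    using True h_ge_1 not_dvd by (auto simp: one_minus_monom_power_nth dest: dvd_trans)
next
  case False
  have l_ge_1: "l \<ge> 1" using prime_l prime_ge_1_nat by blast
  have "coprime h l" using False prime_l prime_imp_coprime coprime_commute by blast
  then have "cyclic_norm l \<omega> (one_minus_monom c h) = one_minus_monom (c ^ l) (h * l)"
    using cyclic_norm_one_minus_monom_coprime[OF generator] h_ge_1 l_ge_1 by blast
  moreover have "m \<noteq> 0" using not_dvd by (metis dvd_0_right)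
  ultimately show ?thesis using h_ge_1 l_ge_1 not_dvd by (auto simp: one_minus_monom_nth)
qed

lemma fps_mult_nth_not_dvd:
  assumes "\<And>i. \<not> l dvd i \<Longrightarrow> F $ i = 0" "\<And>i. \<not> l dvd i \<Longrightarrow> G $ i = 0" "\<not> l dvd m"
  shows "(F * G) $ m = (0::'a::comm_ring_1)"
  unfolding fps_mult_nth
proof (intro sum.neutral ballI)
  fix i assume "i \<in> {0..m}"
  then have "\<not> l dvd i \<or> \<not> l dvd m - i"
    using assms(3) by (metis atLeastAtMost_iff dvd_add le_add_diff_inverse)
  then show "F $ i * G $ (m - i) = 0" using assms(1,2) by auto
qed

lemma cyclic_norm_nth_not_dvd:
  fixes \<omega> :: "'a::field"
  assumes prime_l: "prime l" and generator: "generates_roots_of_unity l \<omega>" and "F $ 0 = 1"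
    and "\<not> l dvd m"
  shows "cyclic_norm l \<omega> F $ m = 0"
proof -
  have "unit_series (\<lambda>_. UNIV) F" using assms(3) by (simp add: unit_series_def)
  with graded_subring_UNIV have "\<forall>m. \<not> l dvd m \<longrightarrow> cyclic_norm l \<omega> F $ m = 0"
  proof (induction F rule: unit_series_limit_induct[where S = "\<lambda>_. UNIV"])
    case (generates h x)
    show ?case by (rule exI[of _ "[x]"]) simp
  next
    case one
    have "cyclic_norm l \<omega> 1 = 1" by (simp add: cyclic_norm_def)
    then show ?case by (auto intro: gr0I)
  next
    case (mult A B)
    then show ?case unfolding cyclic_norm_mult by (blast intro: fps_mult_nth_not_dvd)
  next
    case (binomial c h)
    then show ?case using cyclic_norm_one_minus_monom_nth_not_dvd[OF prime_l generator] by blast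
  next
    case (limit F)
    have "cyclic_norm l \<omega> F $ m = cyclic_norm l \<omega> Q $ m" if "fps_agree m F Q" for m Q
      using cyclic_norm_agree[OF that] by (simp add: fps_agree_def)
    then show ?case using limit(2) by metis
  qed auto
  then show ?thesis using assms(4) by blast
qed

definition norm_frobenius :: "nat \<Rightarrow> 'a::comm_ring_1 \<Rightarrow> 'a fps \<Rightarrow> 'a fps" where
  "norm_frobenius l \<omega> F = Abs_fps (\<lambda>k. cyclic_norm l \<omega> F $ (l * k))"

lemma norm_frobenius_mult:
  fixes \<omega> :: "'a::field"
  assumes prime_l: "prime l" and generator: "generates_roots_of_unity l \<omega>" and F_0: "F $ 0 = 1"
  shows "norm_frobenius l \<omega> (F * G) = norm_frobenius l \<omega> F * norm_frobenius l \<omega> G"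
proof (rule fps_ext)
  fix k
  let ?A = "cyclic_norm l \<omega> F" and ?B = "cyclic_norm l \<omega> G"
  have l_pos: "l > 0" using prime_l prime_gt_0_nat by blast
  have "norm_frobenius l \<omega> (F * G) $ k = (\<Sum>i\<in>{0..l*k}. ?A $ i * ?B $ (l * k - i))"
    by (simp add: norm_frobenius_def cyclic_norm_mult fps_mult_nth)
  also have "\<dots> = (\<Sum>i\<in>(\<lambda>i. l * i) ` {0..k}. ?A $ i * ?B $ (l * k - i))"
  proof (rule sum.mono_neutral_right)
    show "\<forall>i\<in>{0..l * k} - (*) l ` {0..k}. ?A $ i * ?B $ (l * k - i) = 0"
    proof
      fix i assume i: "i \<in> {0..l * k} - (*) l ` {0..k}"
      then have "\<not> l dvd i" using l_pos by auto
      then show "?A $ i * ?B $ (l * k - i) = 0"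
        using cyclic_norm_nth_not_dvd[OF prime_l generator F_0] by simp
    qed
  qed auto
  also have "\<dots> = (\<Sum>i\<in>{0..k}. ?A $ (l * i) * ?B $ (l * k - l * i))"
    using l_pos by (subst sum.reindex) (auto simp: inj_on_def)
  also have "\<dots> = (norm_frobenius l \<omega> F * norm_frobenius l \<omega> G) $ k"
    by (simp add: fps_mult_nth norm_frobenius_def diff_mult_distrib2)
  finally show "norm_frobenius l \<omega> (F * G) $ k = (norm_frobenius l \<omega> F * norm_frobenius l \<omega> G) $ k" .
qed

lemma norm_frobenius_one_minus_monom:
  fixes \<omega> :: "'a::field"
  assumes prime_l: "prime l" and generator: "generates_roots_of_unity l \<omega>" and h_ge_1: "h \<ge> 1"
  shows "norm_frobenius l \<omega> (one_minus_monom c h) =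
    one_minus_monom (c ^ (l div gcd h l)) (h div gcd h l) ^ gcd h l"
proof (cases "l dvd h")
  case True
  have l_pos: "l > 0" using prime_l prime_gt_0_nat by blast
  obtain q where q: "h = l * q" using True by blast
  have "norm_frobenius l \<omega> (one_minus_monom c h) = one_minus_monom c q ^ l"
    using True generator q h_ge_1 l_pos
    by (intro fps_ext) (auto simp: norm_frobenius_def cyclic_norm_one_minus_monom_dvd
        generates_roots_of_unity_def one_minus_monom_power_nth)
  then show ?thesis using q l_pos by simp
next
  case False
  then have coprime: "coprime h l" using prime_l prime_imp_coprime coprime_commute by blast
  have l_ge_1: "l \<ge> 1" using prime_l prime_ge_1_nat by blast
  have "norm_frobenius l \<omega> (one_minus_monom c h) = one_minus_monom (c ^ l) h"
    using h_ge_1 l_ge_1 cyclic_norm_one_minus_monom_coprime[OF generator coprime h_ge_1 l_ge_1, of c]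
    by (intro fps_ext) (auto simp: norm_frobenius_def one_minus_monom_nth mult.commute[of h])
  then show ?thesis using coprime by simp
qed

text \<open>The properties that characterise the Frobenius \<open>1 - y X \<mapsto> 1 - y\<^sup>s X\<close> among operations on series
  with constant term 1.\<close>

locale witt_frobenius =
  fixes s :: nat and \<Psi> :: "'a::field fps \<Rightarrow> 'a fps"
  assumes s_ge_1: "s \<ge> 1"
    and nth_0: "F $ 0 = 1 \<Longrightarrow> \<Psi> F $ 0 = 1"
    and mult: "F $ 0 = 1 \<Longrightarrow> G $ 0 = 1 \<Longrightarrow> \<Psi> (F * G) = \<Psi> F * \<Psi> G"
    and one_minus_monom: "h \<ge> 1 \<Longrightarrow>
      \<Psi> (one_minus_monom c h) = one_minus_monom (c ^ (s div gcd h s)) (h div gcd h s) ^ gcd h s"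
    and agree: "fps_agree (s * k) F G \<Longrightarrow> fps_agree k (\<Psi> F) (\<Psi> G)"
begin

lemma one_minus_monom_obtain:
  assumes h_ge_1: "h \<ge> 1"
  obtains g q e where "h = g * q" "s = g * e" "coprime q e" "g \<ge> 1" "q \<ge> 1" "e \<ge> 1"
    "\<And>c. \<Psi> (one_minus_monom c h) = one_minus_monom (c ^ e) q ^ g"
proof -
  define g where "g = gcd h s"
  have factors: "h = g * (h div g)" "s = g * (s div g)" by (simp_all add: g_def)
  moreover from this have "g \<noteq> 0" "h div g \<noteq> 0" "s div g \<noteq> 0"
    using h_ge_1 s_ge_1 by (auto intro!: Nat.gr0I)
  moreover have "coprime (h div g) (s div g)"
    unfolding g_def using h_ge_1 by (intro div_gcd_coprime) auto
  ultimately show ?thesis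
    using that[of g "h div g" "s div g"] one_minus_monom[OF h_ge_1] by (simp add: g_def Suc_le_eq)
qed

lemma one: "\<Psi> 1 = 1"
proof -
  have "s \<noteq> 0" using s_ge_1 by simp
  then show ?thesis using one_minus_monom[of 1 0] by (simp add: power_0_left)
qed

lemma power: "F $ 0 = 1 \<Longrightarrow> \<Psi> (F ^ m) = \<Psi> F ^ m"
  by (induction m) (simp_all add: one mult fps_nth_power_0)

lemma prod_linear:
  "\<Psi> (\<Prod>i\<in>I. one_minus_monom (y i) 1) = (\<Prod>i\<in>I. one_minus_monom (y i ^ s) 1)"
proof (induction I rule: infinite_finite_induct)
  case (insert i I)
  then show ?case using one_minus_monom[of 1 "y i"] by (simp add: mult fps_prod_nth_0)
qed (simp_all add: one)

end

lemma witt_frobenius_1: "witt_frobenius 1 (\<lambda>F. F)"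
  by unfold_locales auto

lemma witt_frobenius_prime:
  fixes \<omega> :: "'a::field"
  assumes prime_l: "prime l" and generator: "generates_roots_of_unity l \<omega>"
  shows "witt_frobenius l (norm_frobenius l \<omega>)"
proof
  show "l \<ge> 1" using prime_l prime_ge_1_nat by blast
  show "norm_frobenius l \<omega> F $ 0 = 1" if "F $ 0 = 1" for F :: "'a fps"
    using that by (simp add: norm_frobenius_def cyclic_norm_nth_0)
  show "fps_agree k (norm_frobenius l \<omega> F) (norm_frobenius l \<omega> G)"
    if "fps_agree (l * k) F G" for k and F G :: "'a fps"
    using cyclic_norm_agree[OF that, of l \<omega>] by (simp add: fps_agree_def norm_frobenius_def)
qed (use norm_frobenius_mult norm_frobenius_one_minus_monom prime_l generator in auto)

lemma gcd_mult_eq_mult_gcd_div: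
  fixes h s l :: nat
  assumes "h \<ge> 1"
  shows "gcd h (l * s) = gcd h s * gcd (h div gcd h s) l"
proof -
  define g where "g = gcd h s"
  have "coprime (h div g) (s div g)" unfolding g_def using assms by (intro div_gcd_coprime) auto
  then have "gcd (h div g) (l * (s div g)) = gcd (h div g) l"
    by (simp add: gcd_mult_right_right_cancel)
  moreover have "gcd h (l * s) = g * gcd (h div g) (l * (s div g))"
    by (simp add: gcd_mult_distrib_nat g_def mult.left_commute[of _ l])
  ultimately show ?thesis by (simp add: g_def)
qed

lemma witt_frobenius_comp:
  assumes psi: "witt_frobenius s \<Psi>" and phi: "witt_frobenius l \<Phi>"
  shows "witt_frobenius (l * s) (\<lambda>F. \<Phi> (\<Psi> F))"
proof -
  interpret psi: witt_frobenius s \<Psi> by (rule psi)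
  interpret phi: witt_frobenius l \<Phi> by (rule phi)
  show ?thesis
  proof
    fix c :: 'a and h :: nat assume h_ge_1: "1 \<le> h"
    define g where "g = gcd h s"
    define g' where "g' = gcd (h div g) l"
    have g: "g \<ge> 1" "g dvd h" "g dvd s" "g' dvd l"
      using h_ge_1 by (auto simp: g_def g'_def Suc_le_eq)
    have h_div_ge_1: "h div g \<ge> 1"
      using h_ge_1 g by (auto simp: dvd_div_eq_0_iff Suc_le_eq intro!: gr0I)
    have "\<Psi> (one_minus_monom c h) = one_minus_monom (c ^ (s div g)) (h div g) ^ g"
      using psi.one_minus_monom[OF h_ge_1] by (simp add: g_def)
    then have "\<Phi> (\<Psi> (one_minus_monom c h)) =
        one_minus_monom ((c ^ (s div g)) ^ (l div g')) (h div g div g') ^ (g' * g)"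
      using phi.power[of "one_minus_monom (c ^ (s div g)) (h div g)" g]
        phi.one_minus_monom[OF h_div_ge_1] h_div_ge_1
      by (simp add: g'_def power_mult)
    moreover have "(c ^ (s div g)) ^ (l div g') = c ^ (l * s div (g * g'))"
      using g by (simp add: power_mult[symmetric] div_mult_div_if_dvd mult.commute)
    moreover have "h div g div g' = h div (g * g')" by (simp only: div_mult2_eq)
    ultimately show "\<Phi> (\<Psi> (one_minus_monom c h)) =
        one_minus_monom (c ^ (l * s div gcd h (l * s))) (h div gcd h (l * s)) ^ gcd h (l * s)"
      using gcd_mult_eq_mult_gcd_div[OF h_ge_1, of l s]
      by (simp add: g_def[symmetric] g'_def[symmetric] mult.commute)
  next
    fix k and F G :: "'a fps" assume "fps_agree (l * s * k) F G"
    then show "fps_agree k (\<Phi> (\<Psi> F)) (\<Phi> (\<Psi> G))"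
      by (intro phi.agree psi.agree) (simp add: mult_ac)
  qed (use psi.s_ge_1 phi.s_ge_1 in \<open>simp_all add: psi.nth_0 psi.mult phi.nth_0 phi.mult Suc_le_eq\<close>)
qed

lemma exists_witt_frobenius:
  assumes closed: "separably_closed TYPE('a::field)" and "s \<ge> 1"
  shows "\<exists>\<Psi> :: 'a fps \<Rightarrow> 'a fps. witt_frobenius s \<Psi>"
  using assms(2)
proof (induction s rule: prime_divisors_induct)
  case (unit s)
  then show ?case using witt_frobenius_1 by auto
next
  case (factor l s)
  then obtain \<Psi> :: "'a fps \<Rightarrow> 'a fps" where "witt_frobenius s \<Psi>" by auto
  moreover obtain \<omega> :: 'a where "generates_roots_of_unity l \<omega>"
    using exists_generates_roots_of_unity[OF closed] factor by blast
  ultimately show ?case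
    using witt_frobenius_comp witt_frobenius_prime factor by blast
qed simp

section \<open>Valuation estimates\<close>

locale ereal_valuation =
  fixes v :: "'a::field \<Rightarrow> ereal"
  assumes val_eq_PInf_iff: "v x = \<infinity> \<longleftrightarrow> x = 0"
    and val_neq_MInf: "v x \<noteq> - \<infinity>"
    and val_mult: "v (x * y) = v x + v y"
    and val_add: "min (v x) (v y) \<le> v (x + y)"
begin

lemma val_0 [simp]: "v 0 = \<infinity>"
  by (simp add: val_eq_PInf_iff)

lemma val_1 [simp]: "v 1 = 0"
proof -
  have "v 1 = v 1 + v 1" using val_mult[of 1 1] by simp
  then show ?thesis using val_eq_PInf_iff[of 1] val_neq_MInf[of 1] by (cases "v 1") auto
qed

lemma val_minus [simp]: "v (- x) = v x"
proof -
  have "v (-1) + v (-1) = 0" using val_mult[of "-1" "-1"] by simp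
  then have "v (-1) = 0" by (cases "v (-1)") auto
  then show ?thesis using val_mult[of "-1" x] by simp
qed

lemma val_minus_1_power_mult [simp]: "v ((-1) ^ k * x) = v x"
  by (cases "even k") auto

lemma val_add_ge: "b \<le> v x \<Longrightarrow> b \<le> v y \<Longrightarrow> b \<le> v (x + y)"
  using val_add[of x y] by (meson min.boundedI order_trans)

lemma val_diff_ge: "b \<le> v x \<Longrightarrow> b \<le> v y \<Longrightarrow> b \<le> v (x - y)"
  using val_add_ge[of b x "- y"] by simp

lemma val_add_eq:
  assumes "v x < v y"
  shows "v (x + y) = v x"
proof (rule antisym)
  have "min (v (x + y)) (v (- y)) \<le> v (x + y + - y)" by (rule val_add)
  then show "v (x + y) \<le> v x" using assms by (auto simp: min_def split: if_splits)
  show "v x \<le> v (x + y)" using assms by (intro val_add_ge) auto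
qed

lemma val_sum_ge: "(\<And>i. i \<in> I \<Longrightarrow> b \<le> v (f i)) \<Longrightarrow> b \<le> v (sum f I)"
  by (induction I rule: infinite_finite_induct) (auto intro: val_add_ge)

lemma val_sum_gt:
  assumes "b < \<infinity>" "\<And>i. i \<in> I \<Longrightarrow> b < v (f i)"
  shows "b < v (sum f I)"
  using assms(2)
proof (induction I rule: infinite_finite_induct)
  case (insert i I)
  then have "b < min (v (f i)) (v (sum f I))" by simp
  also have "\<dots> \<le> v (f i + sum f I)" by (rule val_add)
  finally show ?case using insert by simp
qed (use assms(1) in auto)

lemma val_sum_distinct:
  assumes finite_nonempty: "finite I" "I \<noteq> {}"
    and distinct: "\<And>i j. i \<in> I \<Longrightarrow> j \<in> I \<Longrightarrow> v (f i) = v (f j) \<Longrightarrow> f i \<noteq> 0 \<Longrightarrow> i = j"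
  obtains i where "i \<in> I" "v (sum f I) = v (f i)" "\<And>j. j \<in> I \<Longrightarrow> v (f i) \<le> v (f j)"
proof -
  have "Min ((\<lambda>i. v (f i)) ` I) \<in> (\<lambda>i. v (f i)) ` I" using finite_nonempty by (intro Min_in) auto
  then obtain i where i: "i \<in> I" "Min ((\<lambda>i. v (f i)) ` I) = v (f i)" by auto
  have least: "v (f i) \<le> v (f j)" if "j \<in> I" for j
    unfolding i(2)[symmetric] using finite_nonempty that by (intro Min_le) auto
  have "v (sum f I) = v (f i)"
  proof (cases "f i = 0")
    case True
    then have "f j = 0" if "j \<in> I" for j using least[OF that] by (simp add: val_eq_PInf_iff)
    then show ?thesis using True by simp
  next
    case False
    have "v (f i) < v (sum f (I - {i}))"
    proof (rule val_sum_gt)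
      show "v (f i) < \<infinity>" using False val_eq_PInf_iff[of "f i"] by (cases "v (f i)") auto
      show "v (f i) < v (f j)" if "j \<in> I - {i}" for j
        using least[of j] distinct[of i j] False that i by (auto simp: less_le)
    qed
    then show ?thesis using finite_nonempty i by (simp add: sum.remove val_add_eq)
  qed
  then show ?thesis using that i least by blast
qed

lemma val_power: "v (x ^ i) = ereal (real i) * v x"
proof (cases "x = 0")
  case True
  then show ?thesis by (cases i) auto
next
  case False
  then obtain r where "v x = ereal r"
    using val_eq_PInf_iff[of x] val_neq_MInf[of x] by (cases "v x") auto
  moreover from this have "v (x ^ i) = ereal (real i * r)"
    by (induction i) (auto simp: val_mult algebra_simps)
  ultimately show ?thesis by simp
qed

lemma val_of_nat_nonneg: "0 \<le> v (of_nat m)"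
  by (induction m) (auto intro: val_add_ge)

lemma val_of_nat_coprime:
  assumes "v (of_nat p) > 0" "coprime m p" "m \<ge> 1"
  shows "v (of_nat m) = 0"
proof (rule ccontr)
  assume "v (of_nat m) \<noteq> 0"
  then have pos: "v (of_nat m) > 0" using val_of_nat_nonneg[of m] by (simp add: less_le)
  obtain x y where "m * x = p * y + 1"
    using assms(2,3) by (metis bezout_nat coprime_imp_gcd_eq_1 not_one_le_zero)
  then have "1 = of_nat (m * x) + - (of_nat (p * y) :: 'a)" by simp
  then have "min (v (of_nat (m * x))) (v (- of_nat (p * y))) \<le> v 1" by (metis val_add)
  moreover have "v (of_nat (m * x)) > 0" "v (- of_nat (p * y)) > 0"
    using pos assms(1) val_of_nat_nonneg[of x] val_of_nat_nonneg[of y]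
    by (simp_all add: val_mult add_pos_nonneg)
  ultimately show False by (simp add: min_def split: if_splits)
qed

lemma val_of_nat_eq_multiplicity:
  assumes residue_char: "prime p" "v (of_nat p) > 0" and "m \<ge> 1"
  shows "v (of_nat m) = ereal (real (multiplicity p m)) * v (of_nat p)"
proof -
  have "\<not> is_unit p" "m \<noteq> 0" using assms by auto
  then obtain m' where m': "m = p ^ multiplicity p m * m'" "\<not> p dvd m'"
    by (metis multiplicity_decompose')
  then have "coprime m' p" "m' \<ge> 1"
    using residue_char(1) prime_imp_coprime coprime_commute by (blast, cases m') auto
  then have "v (of_nat m') = 0" by (rule val_of_nat_coprime[OF residue_char(2)])
  then have "v (of_nat (p ^ multiplicity p m * m')) = ereal (real (multiplicity p m)) * v (of_nat p)"
    by (simp add: val_mult val_power)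
  then show ?thesis using m'(1) by simp
qed

end

locale valued_embedding = tau: field_hom \<tau> + ereal_valuation w
  for \<tau> :: "'k::field \<Rightarrow> 's::field" and w :: "'k \<Rightarrow> ereal" +
  fixes p \<nu> :: nat
  assumes prime_p: "prime p" and val_p_pos: "w (of_nat p) > 0"
begin

definition fractional_ideal :: "ereal \<Rightarrow> 's set" where
  "fractional_ideal b = \<tau> ` {x. b \<le> w x}"

lemma hom_in_fractional_ideal_iff: "\<tau> x \<in> fractional_ideal b \<longleftrightarrow> b \<le> w x"
  by (auto simp: fractional_ideal_def)

lemma of_nat_in_fractional_ideal: "of_nat m \<in> fractional_ideal (w (of_nat m))"
  using hom_in_fractional_ideal_iff[of "of_nat m"] by (simp add: tau.hom_of_nat)

lemma fractional_ideal_0 [simp]: "0 \<in> fractional_ideal b"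
  using hom_in_fractional_ideal_iff[of 0 b] by simp

lemma fractional_ideal_antimono: "y \<in> fractional_ideal b \<Longrightarrow> c \<le> b \<Longrightarrow> y \<in> fractional_ideal c"
  by (auto simp: fractional_ideal_def)

lemma fractional_ideal_add:
  assumes "y \<in> fractional_ideal b" "z \<in> fractional_ideal b"
  shows "y + z \<in> fractional_ideal b"
  using assms unfolding fractional_ideal_def
  by (auto simp: tau.hom_add[symmetric] intro!: imageI val_add_ge)

lemma fractional_ideal_minus: "y \<in> fractional_ideal b \<Longrightarrow> - y \<in> fractional_ideal b"
  unfolding fractional_ideal_def by (auto simp: tau.hom_uminus[symmetric])

lemma fractional_ideal_diff:
  "y \<in> fractional_ideal b \<Longrightarrow> z \<in> fractional_ideal b \<Longrightarrow> y - z \<in> fractional_ideal b"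
  using fractional_ideal_add[of y b "- z"] fractional_ideal_minus[of z b] by simp

lemma fractional_ideal_mult:
  "y \<in> fractional_ideal b \<Longrightarrow> z \<in> fractional_ideal c \<Longrightarrow> y * z \<in> fractional_ideal (b + c)"
  unfolding fractional_ideal_def
  by (auto simp: tau.hom_mult[symmetric] val_mult intro!: imageI add_mono)

lemma fractional_ideal_sum:
  "(\<And>i. i \<in> I \<Longrightarrow> f i \<in> fractional_ideal b) \<Longrightarrow> sum f I \<in> fractional_ideal b"
  by (induction I rule: infinite_finite_induct) (auto intro: fractional_ideal_add)

lemma perturbed_valuation:
  assumes "w x = ereal b" "y \<in> fractional_ideal (ereal b + 1)"
  shows "\<exists>z. \<tau> x + y = \<tau> z \<and> w z = ereal b"
proof -
  obtain x' where x': "y = \<tau> x'" "ereal b + 1 \<le> w x'"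
    using assms(2) by (auto simp: fractional_ideal_def)
  have "w x < ereal b + 1" by (simp add: one_ereal_def assms(1))
  then have "w x < w x'" using x'(2) by (rule less_le_trans)
  then show ?thesis using val_add_eq x'(1) assms(1) by (metis tau.hom_add)
qed

definition trunc_mult :: "nat \<Rightarrow> nat" where
  "trunc_mult k = min (multiplicity p k) \<nu>"

lemma trunc_mult_le [simp]: "trunc_mult k \<le> \<nu>"
  by (simp add: trunc_mult_def)

lemma le_trunc_mult_iff: "k \<ge> 1 \<Longrightarrow> i \<le> trunc_mult k \<longleftrightarrow> i \<le> \<nu> \<and> p ^ i dvd k"
  using prime_p by (auto simp: trunc_mult_def power_dvd_iff_le_multiplicity prime_nat_iff)

lemma trunc_mult_add:
  "a \<ge> 1 \<Longrightarrow> b \<ge> 1 \<Longrightarrow> min (trunc_mult a) (trunc_mult b) \<le> trunc_mult (a + b)"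
  using le_trunc_mult_iff[of a "min (trunc_mult a) (trunc_mult b)"]
    le_trunc_mult_iff[of b "min (trunc_mult a) (trunc_mult b)"]
    le_trunc_mult_iff[of "a + b" "min (trunc_mult a) (trunc_mult b)"] by auto

lemma trunc_mult_dvd: "a dvd b \<Longrightarrow> b \<ge> 1 \<Longrightarrow> trunc_mult a \<le> trunc_mult b"
  unfolding trunc_mult_def by (intro min.mono dvd_imp_multiplicity_le) auto

lemma trunc_mult_mult:
  assumes "s \<ge> 1" "q \<ge> 1"
  shows "trunc_mult (s * q) \<le> multiplicity p s + trunc_mult q"
proof -
  have "multiplicity p (s * q) = multiplicity p s + multiplicity p q"
    using prime_p assms by (intro prime_elem_multiplicity_mult_distrib) auto
  then show ?thesis by (auto simp: trunc_mult_def)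
qed

lemma trunc_mult_p_power: "j \<le> \<nu> \<Longrightarrow> trunc_mult (p ^ j) = j"
  using prime_p by (simp add: trunc_mult_def)

text \<open>The properties of the indices of inseparability that make the estimates work; \<open>\<epsilon> = 0\<close> gives
  bounds and \<open>\<epsilon> = 1\<close> gives congruences modulo strictly larger valuation.\<close>

definition insep_profile :: "ereal \<Rightarrow> (nat \<Rightarrow> ereal) \<Rightarrow> bool" where
  "insep_profile \<epsilon> d \<longleftrightarrow> 0 \<le> \<epsilon> \<and> (\<forall>j\<le>\<nu>. \<epsilon> \<le> d j) \<and> (\<forall>j\<le>\<nu>. \<forall>i\<le>j. d j \<le> d i) \<and>
     (\<forall>j<\<nu>. d j \<le> w (of_nat p) + d (Suc j))"

definition profile_bound :: "int \<Rightarrow> (nat \<Rightarrow> ereal) \<Rightarrow> nat \<Rightarrow> ereal" where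
  "profile_bound t d l = ereal (of_int t * real l) + d (trunc_mult l)"

abbreviation bounded_series :: "int \<Rightarrow> (nat \<Rightarrow> ereal) \<Rightarrow> 's fps \<Rightarrow> bool" where
  "bounded_series t d \<equiv> unit_series (\<lambda>l. fractional_ideal (profile_bound t d l))"

lemma insep_profile_antimono: "insep_profile \<epsilon> d \<Longrightarrow> i \<le> j \<Longrightarrow> j \<le> \<nu> \<Longrightarrow> d j \<le> d i"
  by (simp add: insep_profile_def)

lemma insep_profile_shift:
  assumes profile: "insep_profile \<epsilon> d" and "j + m \<le> \<nu>"
  shows "d j \<le> ereal (real m) * w (of_nat p) + d (j + m)"
  using assms(2)
proof (induction m)
  case (Suc m)
  then have "d j \<le> ereal (real m) * w (of_nat p) + d (j + m)" by simp
  also have "\<dots> \<le> ereal (real m) * w (of_nat p) + (w (of_nat p) + d (j + Suc m))"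
    using profile Suc.prems by (intro add_left_mono) (simp add: insep_profile_def)
  also have "\<dots> = (ereal (real m) * w (of_nat p) + 1 * w (of_nat p)) + d (j + Suc m)"
    by (simp add: add.assoc)
  also have "ereal (real m) * w (of_nat p) + 1 * w (of_nat p) = (ereal (real m) + 1) * w (of_nat p)"
    by (rule ereal_left_distrib[symmetric]) simp_all
  finally show ?case by (simp add: add.commute)
qed (simp add: zero_ereal_def[symmetric])

lemma insep_profile_mult:
  assumes profile: "insep_profile \<epsilon> d" and "s \<ge> 1" "q \<ge> 1"
  shows "d (trunc_mult q) \<le> w (of_nat s) + d (trunc_mult (s * q))"
proof -
  define m where "m = trunc_mult (s * q) - trunc_mult q"
  have "trunc_mult q \<le> trunc_mult (s * q)"
    using assms by (intro trunc_mult_dvd) (auto simp: Suc_le_eq)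
  then have m: "trunc_mult (s * q) = trunc_mult q + m" by (simp add: m_def)
  have "m \<le> multiplicity p s" using trunc_mult_mult[OF assms(2,3)] by (simp add: m_def)
  then have "ereal (real m) * w (of_nat p) \<le> w (of_nat s)"
    using val_p_pos val_of_nat_eq_multiplicity[OF prime_p val_p_pos assms(2)]
    by (auto intro: ereal_mult_right_mono)
  then have "ereal (real m) * w (of_nat p) + d (trunc_mult (s * q)) \<le>
      w (of_nat s) + d (trunc_mult (s * q))" by (rule add_right_mono)
  then show ?thesis
    using insep_profile_shift[OF profile, of "trunc_mult q" m] trunc_mult_le[of "s * q"]
    by (simp add: m)
qed

lemma insep_profile_choose:
  assumes profile: "insep_profile \<epsilon> d" and i_bounds: "1 \<le> i" "i \<le> g" and q_ge_1: "q \<ge> 1"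
  shows "d (trunc_mult (i * q)) \<le> w (of_nat (g choose i)) + d (trunc_mult (g * q))"
proof -
  have pos: "(g choose i) * (i * q) \<ge> 1" using i_bounds q_ge_1 by (simp add: Suc_le_eq)
  have "i * (g choose i) = g * ((g - 1) choose (i - 1))"
    using i_bounds by (intro times_binomial_minus1_eq) auto
  then have "g * q dvd (g choose i) * (i * q)" by (metis dvd_triv_left mult.assoc mult.commute)
  then have "d (trunc_mult ((g choose i) * (i * q))) \<le> d (trunc_mult (g * q))"
    using pos by (intro insep_profile_antimono[OF profile] trunc_mult_dvd) auto
  moreover have "d (trunc_mult (i * q)) \<le>
      w (of_nat (g choose i)) + d (trunc_mult ((g choose i) * (i * q)))"
    using i_bounds q_ge_1 by (intro insep_profile_mult[OF profile]) (auto simp: Suc_le_eq)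
  ultimately show ?thesis by (meson add_left_mono order_trans)
qed

lemma profile_bound_add:
  assumes profile: "insep_profile \<epsilon> d" and ge_1: "a \<ge> 1" "b \<ge> 1"
  shows "profile_bound t d (a + b) + \<epsilon> \<le> profile_bound t d a + profile_bound t d b"
proof -
  have eps: "\<epsilon> \<le> d (trunc_mult a)" "\<epsilon> \<le> d (trunc_mult b)"
    using profile by (auto simp: insep_profile_def)
  have "trunc_mult a \<le> trunc_mult (a + b) \<or> trunc_mult b \<le> trunc_mult (a + b)"
    using trunc_mult_add[OF ge_1] by auto
  then have "d (trunc_mult (a + b)) + \<epsilon> \<le> d (trunc_mult a) + d (trunc_mult b)"
  proof
    assume "trunc_mult a \<le> trunc_mult (a + b)"
    then show ?thesis using eps(2) insep_profile_antimono[OF profile] by (intro add_mono) auto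
  next
    assume "trunc_mult b \<le> trunc_mult (a + b)"
    then have "d (trunc_mult (a + b)) + \<epsilon> \<le> d (trunc_mult b) + d (trunc_mult a)"
      using eps(1) insep_profile_antimono[OF profile] by (intro add_mono) auto
    then show ?thesis by (simp add: add.commute)
  qed
  then have "ereal (of_int t * real (a + b)) + (d (trunc_mult (a + b)) + \<epsilon>) \<le>
      ereal (of_int t * real (a + b)) + (d (trunc_mult a) + d (trunc_mult b))" by (rule add_left_mono)
  also have "ereal (of_int t * real (a + b)) = ereal (of_int t * real a) + ereal (of_int t * real b)"
    by (simp add: algebra_simps)
  finally show ?thesis by (simp add: profile_bound_def algebra_simps)
qed

lemma profile_bound_mult:
  assumes "insep_profile \<epsilon> d" "s \<ge> 1" "k \<ge> 1"
  shows "profile_bound (t * int s) d k \<le> w (of_nat s) + profile_bound t d (s * k)"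
proof -
  have "ereal (of_int (t * int s) * real k) + d (trunc_mult k) \<le>
      ereal (of_int (t * int s) * real k) + (w (of_nat s) + d (trunc_mult (s * k)))"
    by (intro add_left_mono insep_profile_mult[OF assms])
  then show ?thesis by (simp add: profile_bound_def add_ac mult_ac)
qed

lemma insep_profile_le_add_eps: "insep_profile \<epsilon> d \<Longrightarrow> b \<le> b + \<epsilon>"
  using add_left_mono[of 0 \<epsilon> b] by (simp add: insep_profile_def)

lemma graded_subring_profile_bound:
  assumes profile: "insep_profile \<epsilon> d"
  shows "graded_subring (\<lambda>l. fractional_ideal (profile_bound t d l))"
  unfolding graded_subring_def
proof (intro conjI allI impI ballI)
  fix a b :: nat and x y
  assume "a \<ge> 1" "b \<ge> 1"
  then have "profile_bound t d (a + b) \<le> profile_bound t d a + profile_bound t d b"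
    using profile_bound_add[OF profile] insep_profile_le_add_eps[OF profile] order_trans by blast
  moreover assume "x \<in> fractional_ideal (profile_bound t d a)"
    "y \<in> fractional_ideal (profile_bound t d b)"
  ultimately show "x * y \<in> fractional_ideal (profile_bound t d (a + b))"
    using fractional_ideal_mult fractional_ideal_antimono by blast
qed (auto intro: fractional_ideal_diff)

lemma bounded_series_mult:
  "insep_profile \<epsilon> d \<Longrightarrow> bounded_series t d F \<Longrightarrow> bounded_series t d G \<Longrightarrow> bounded_series t d (F * G)"
  by (rule unit_series_mult[OF graded_subring_profile_bound])

lemma bounded_series_mult_cong:
  assumes profile: "insep_profile \<epsilon> d" and bounded: "bounded_series t d F" "bounded_series t d G"
    and l_ge_1: "l \<ge> 1"
  shows "(F * G) $ l - F $ l - G $ l \<in> fractional_ideal (profile_bound t d l + \<epsilon>)"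
proof -
  have "F $ i * G $ (l - i) \<in> fractional_ideal (profile_bound t d l + \<epsilon>)" if "i \<in> {1..<l}" for i
  proof -
    have "F $ i * G $ (l - i) \<in> fractional_ideal (profile_bound t d i + profile_bound t d (l - i))"
      using bounded that by (intro fractional_ideal_mult) (auto simp: unit_series_def)
    moreover have "profile_bound t d (i + (l - i)) + \<epsilon> \<le>
        profile_bound t d i + profile_bound t d (l - i)"
      using that by (intro profile_bound_add[OF profile]) auto
    ultimately show ?thesis using that by (auto intro: fractional_ideal_antimono)
  qed
  then have "(\<Sum>i\<in>{1..<l}. F $ i * G $ (l - i)) \<in> fractional_ideal (profile_bound t d l + \<epsilon>)"
    by (rule fractional_ideal_sum)
  then show ?thesis using fps_mult_nth_units[of F G l] bounded l_ge_1 by (simp add: unit_series_def)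
qed

lemma fractional_ideal_power:
  assumes c_in: "c \<in> fractional_ideal (ereal x + D)" and eps_le: "0 \<le> \<epsilon>" "\<epsilon> \<le> D" and i_ge_2: "i \<ge> 2"
  shows "c ^ i \<in> fractional_ideal (ereal (real i * x) + D + \<epsilon>)"
  using i_ge_2
proof (induction i rule: dec_induct)
  case base
  have "(ereal x + ereal x + D) + \<epsilon> \<le> (ereal x + ereal x + D) + D"
    using eps_le by (intro add_left_mono)
  then have "ereal (real 2 * x) + D + \<epsilon> \<le> (ereal x + D) + (ereal x + D)" by (simp add: add_ac)
  then show ?case
    using fractional_ideal_mult[OF c_in c_in]
    by (simp add: power2_eq_square fractional_ideal_antimono)
next
  case (step i)
  have "(ereal x + ereal (real i * x) + D + \<epsilon>) + 0 \<le> (ereal x + ereal (real i * x) + D + \<epsilon>) + D"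
    using eps_le by (intro add_left_mono) simp
  then have "ereal (real (Suc i) * x) + D + \<epsilon> \<le> (ereal x + D) + (ereal (real i * x) + D + \<epsilon>)"
    by (simp add: algebra_simps)
  then show ?case
    using fractional_ideal_mult[OF c_in step.IH] by (simp add: fractional_ideal_antimono)
qed

lemma fractional_ideal_choose_power:
  assumes profile: "insep_profile \<epsilon> d" and c_in: "c \<in> fractional_ideal (profile_bound t d (g * q))"
    and q_ge_1: "q \<ge> 1" and i_bounds: "i \<ge> 1" "e * i \<ge> 2"
  shows "of_nat (g choose i) * c ^ (e * i) \<in>
    fractional_ideal (profile_bound (t * int (e * g)) d (i * q) + \<epsilon>)"
proof (cases "i \<le> g")
  case True
  let ?x = "of_int t * real (g * q)" and ?D = "d (trunc_mult (g * q))" and ?C = "of_nat (g choose i)"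
  have "0 \<le> \<epsilon>" "\<epsilon> \<le> ?D" using profile by (auto simp: insep_profile_def)
  then have "c ^ (e * i) \<in> fractional_ideal (ereal (real (e * i) * ?x) + ?D + \<epsilon>)"
    using c_in i_bounds(2) unfolding profile_bound_def by (intro fractional_ideal_power)
  then have "?C * c ^ (e * i) \<in> fractional_ideal (w ?C + (ereal (real (e * i) * ?x) + ?D + \<epsilon>))"
    by (intro fractional_ideal_mult of_nat_in_fractional_ideal)
  moreover have "ereal (real (e * i) * ?x) + d (trunc_mult (i * q)) + \<epsilon> \<le>
      ereal (real (e * i) * ?x) + (w ?C + ?D) + \<epsilon>"
    by (intro add_right_mono add_left_mono insep_profile_choose[OF profile i_bounds(1) True q_ge_1])
  moreover have "of_int (t * int (e * g)) * real (i * q) = real (e * i) * ?x" by simp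
  ultimately show ?thesis
    unfolding profile_bound_def by (simp only: add_ac fractional_ideal_antimono)
qed (simp add: binomial_eq_0)

definition frobenius_cong ::
  "ereal \<Rightarrow> (nat \<Rightarrow> ereal) \<Rightarrow> int \<Rightarrow> nat \<Rightarrow> 's fps \<Rightarrow> 's fps \<Rightarrow> bool" where
  "frobenius_cong \<epsilon> d t s F F' \<longleftrightarrow> (\<forall>k\<ge>1.
     F' $ k - of_nat s * F $ (s * k) \<in> fractional_ideal (profile_bound (t * int s) d k + \<epsilon>))"

lemma frobenius_cong_bounded_series:
  assumes profile: "insep_profile \<epsilon> d" and bounded: "bounded_series t d F" "F' $ 0 = 1"
    and cong: "frobenius_cong \<epsilon> d t s F F'" and s_ge_1: "s \<ge> 1"
  shows "bounded_series (t * int s) d F'"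
proof -
  have "F' $ k \<in> fractional_ideal (profile_bound (t * int s) d k)" if k_ge_1: "k \<ge> 1" for k
  proof -
    have "F' $ k - of_nat s * F $ (s * k) \<in> fractional_ideal (profile_bound (t * int s) d k)"
      using cong k_ge_1 insep_profile_le_add_eps[OF profile] fractional_ideal_antimono
      unfolding frobenius_cong_def by blast
    moreover have "of_nat s * F $ (s * k) \<in> fractional_ideal (w (of_nat s) + profile_bound t d (s * k))"
      using bounded k_ge_1 s_ge_1
      by (intro fractional_ideal_mult of_nat_in_fractional_ideal) (auto simp: unit_series_def)
    then have "of_nat s * F $ (s * k) \<in> fractional_ideal (profile_bound (t * int s) d k)"
      using profile_bound_mult[OF profile s_ge_1 k_ge_1] fractional_ideal_antimono by blast
    ultimately show ?thesis using fractional_ideal_add by fastforce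
  qed
  then show ?thesis using bounded by (simp add: unit_series_def)
qed

lemma frobenius_cong_mult:
  assumes profile: "insep_profile \<epsilon> d" and s_ge_1: "s \<ge> 1"
    and F_cong: "bounded_series t d F" "F' $ 0 = 1" "frobenius_cong \<epsilon> d t s F F'"
    and G_cong: "bounded_series t d G" "G' $ 0 = 1" "frobenius_cong \<epsilon> d t s G G'"
  shows "frobenius_cong \<epsilon> d t s (F * G) (F' * G')"
  unfolding frobenius_cong_def
proof (intro allI impI)
  fix k :: nat assume k_ge_1: "1 \<le> k"
  let ?b = "profile_bound (t * int s) d k + \<epsilon>"
  let ?D = "(F * G) $ (s * k) - F $ (s * k) - G $ (s * k)"
  let ?D' = "(F' * G') $ k - F' $ k - G' $ k"
  have target_defect: "?D' \<in> fractional_ideal ?b"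
    using frobenius_cong_bounded_series[OF profile F_cong s_ge_1]
      frobenius_cong_bounded_series[OF profile G_cong s_ge_1]
    by (rule bounded_series_mult_cong[OF profile _ _ k_ge_1])
  have sk_ge_1: "s * k \<ge> 1" using s_ge_1 k_ge_1 by (simp add: Suc_le_eq)
  have "of_nat s * ?D \<in> fractional_ideal (w (of_nat s) + (profile_bound t d (s * k) + \<epsilon>))"
    by (intro fractional_ideal_mult of_nat_in_fractional_ideal
        bounded_series_mult_cong[OF profile _ _ sk_ge_1] F_cong G_cong)
  moreover have "?b \<le> w (of_nat s) + (profile_bound t d (s * k) + \<epsilon>)"
    using add_right_mono[OF profile_bound_mult[OF profile s_ge_1 k_ge_1, of t], of \<epsilon>]
    by (simp add: add_ac)
  ultimately have source_defect: "of_nat s * ?D \<in> fractional_ideal ?b"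
    by (rule fractional_ideal_antimono)
  have factors: "F' $ k - of_nat s * F $ (s * k) \<in> fractional_ideal ?b"
    "G' $ k - of_nat s * G $ (s * k) \<in> fractional_ideal ?b"
    using F_cong G_cong k_ge_1 by (auto simp: frobenius_cong_def)
  have "(F' * G') $ k - of_nat s * (F * G) $ (s * k) = (?D' - of_nat s * ?D) +
      ((F' $ k - of_nat s * F $ (s * k)) + (G' $ k - of_nat s * G $ (s * k)))"
    by (simp add: algebra_simps)
  then show "(F' * G') $ k - of_nat s * (F * G) $ (s * k) \<in> fractional_ideal ?b"
    using fractional_ideal_add[OF fractional_ideal_diff[OF target_defect source_defect]
        fractional_ideal_add[OF factors]]
    by (simp only:)
qed

lemma choose_power_cong:
  assumes profile: "insep_profile \<epsilon> d" and c_in: "c \<in> fractional_ideal (profile_bound t d (g * q))"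
    and q_ge_1: "q \<ge> 1" and e_ge_1: "e \<ge> 1" and i_ge_1: "i \<ge> 1"
  shows "of_nat (g choose i) * (- (c ^ e)) ^ i - (if e * i = 1 then - of_nat (g * e) * c else 0) \<in>
    fractional_ideal (profile_bound (t * int (g * e)) d (i * q) + \<epsilon>)"
proof (cases "e * i = 1")
  case False
  then have "e * i \<ge> 2" using mult_le_mono[OF e_ge_1 i_ge_1] by linarith
  then have "of_nat (g choose i) * c ^ (e * i) \<in>
      fractional_ideal (profile_bound (t * int (g * e)) d (i * q) + \<epsilon>)"
    using fractional_ideal_choose_power[OF profile c_in q_ge_1 i_ge_1] by (simp only: mult.commute)
  moreover have "(- (c ^ e)) ^ i = c ^ (e * i) \<or> (- (c ^ e)) ^ i = - (c ^ (e * i))"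
    by (cases "even i") (auto simp: power_mult)
  ultimately show ?thesis using False fractional_ideal_minus by auto
qed simp

lemma frobenius_cong_one_minus_monom:
  assumes profile: "insep_profile \<epsilon> d" and frobenius: "witt_frobenius s \<Psi>"
    and h_ge_1: "h \<ge> 1" and c_in: "c \<in> fractional_ideal (profile_bound t d h)"
  shows "frobenius_cong \<epsilon> d t s (one_minus_monom c h) (\<Psi> (one_minus_monom c h))"
proof -
  obtain g q e where factors: "h = g * q" "s = g * e" and coprime: "coprime q e"
    and pos: "g \<ge> 1" "q \<ge> 1" "e \<ge> 1"
    and frob: "\<Psi> (one_minus_monom c h) = one_minus_monom (c ^ e) q ^ g"
    using witt_frobenius.one_minus_monom_obtain[OF frobenius h_ge_1] by metis
  have "\<Psi> (one_minus_monom c h) $ k - of_nat s * one_minus_monom c h $ (s * k) \<in>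
      fractional_ideal (profile_bound (t * int s) d k + \<epsilon>)" if k_ge_1: "k \<ge> 1" for k
  proof -
    have source: "one_minus_monom c h $ (s * k) = (if e * k = q then - c else 0)"
      using h_ge_1 k_ge_1 pos by (auto simp: one_minus_monom_nth factors mult.assoc)
    have "q dvd k" if "e * k = q"
      using coprime that by (metis coprime_common_divisor dvd_refl dvd_triv_left mult_unit_dvd_iff')
    then consider (not_dvd) "\<not> q dvd k" "e * k \<noteq> q" | (multiple) i where "k = i * q"
      by (metis dvdE mult.commute)
    then show ?thesis
    proof cases
      case not_dvd
      then show ?thesis by (simp add: frob source one_minus_monom_power_nth[OF pos(2)])
    next
      case multiple
      then have i_ge_1: "i \<ge> 1" using k_ge_1 by (cases i) auto
      have "\<Psi> (one_minus_monom c h) $ k = of_nat (g choose i) * (- (c ^ e)) ^ i"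
        using multiple pos(2) by (simp add: frob one_minus_monom_power_nth[OF pos(2)])
      moreover have "e * k = q \<longleftrightarrow> e * i = 1" using multiple pos(2) by (simp add: mult.assoc[symmetric])
      ultimately have "\<Psi> (one_minus_monom c h) $ k - of_nat s * one_minus_monom c h $ (s * k) =
          of_nat (g choose i) * (- (c ^ e)) ^ i - (if e * i = 1 then - of_nat (g * e) * c else 0)"
        unfolding source by (simp add: factors)
      then show ?thesis
        using choose_power_cong[OF profile _ pos(2,3) i_ge_1] c_in multiple factors by simp
    qed
  qed
  then show ?thesis by (simp add: frobenius_cong_def)
qed

lemma frobenius_cong_witt_frobenius:
  assumes profile: "insep_profile \<epsilon> d" and frobenius: "witt_frobenius s \<Psi>"
    and bounded: "bounded_series t d F"
  shows "frobenius_cong \<epsilon> d t s F (\<Psi> F)"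
proof -
  interpret frobenius: witt_frobenius s \<Psi> by (rule frobenius)
  have "graded_subring (\<lambda>l. fractional_ideal (profile_bound t d l))"
    by (rule graded_subring_profile_bound[OF profile])
  then show ?thesis using bounded
  proof (induction rule:
      unit_series_limit_induct[where S = "\<lambda>l. fractional_ideal (profile_bound t d l)"])
    case (generates h x)
    then show ?case by (intro exI[of _ "[x]"]) simp
  next
    case one
    show ?case using frobenius.s_ge_1 by (simp add: frobenius_cong_def frobenius.one)
  next
    case (mult A B)
    then have nth_0: "A $ 0 = 1" "B $ 0 = 1" by (auto simp: unit_series_def)
    then have "frobenius_cong \<epsilon> d t s (A * B) (\<Psi> A * \<Psi> B)"
      using mult
      by (intro frobenius_cong_mult[OF profile frobenius.s_ge_1]) (auto intro: frobenius.nth_0)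
    then show ?case by (simp add: frobenius.mult nth_0)
  next
    case (binomial c h)
    then show ?case using frobenius_cong_one_minus_monom[OF profile frobenius] by blast
  next
    case (limit F)
    show ?case unfolding frobenius_cong_def
    proof (intro allI impI)
      fix k :: nat assume k_ge_1: "1 \<le> k"
      obtain Q where Q: "frobenius_cong \<epsilon> d t s Q (\<Psi> Q)" "fps_agree (s * k) F Q"
        using limit by blast
      then have "\<Psi> F $ k = \<Psi> Q $ k" "F $ (s * k) = Q $ (s * k)"
        using frobenius.agree by (auto simp: fps_agree_def)
      then show "\<Psi> F $ k - of_nat s * F $ (s * k) \<in>
          fractional_ideal (profile_bound (t * int s) d k + \<epsilon>)"
        using Q(1) k_ge_1 by (simp add: frobenius_cong_def)
    qed
  qed auto
qed

lemma bounded_series_witt_frobenius: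
  assumes profile: "insep_profile \<epsilon> d" and frobenius: "witt_frobenius s \<Psi>"
    and bounded: "bounded_series t d F"
  shows "bounded_series (t * int s) d (\<Psi> F)"
  using frobenius_cong_bounded_series[OF profile bounded _
      frobenius_cong_witt_frobenius[OF profile frobenius bounded]]
    witt_frobenius.s_ge_1[OF frobenius] witt_frobenius.nth_0[OF frobenius] bounded
  by (simp add: unit_series_def)

end

section \<open>Eisenstein series\<close>

lemma cong_same_interval_imp_eq:
  fixes i j m n :: nat
  assumes "[int i = int j] (mod int n)" "i \<in> {m..<m + n}" "j \<in> {m..<m + n}"
  shows "i = j"
proof -
  have "int (i - m) - int (j - m) = int i - int j" using assms(2,3) by auto
  then have "[i - m = j - m] (mod n)"
    using assms(1) by (simp only: cong_int_iff[symmetric] cong_iff_dvd_diff)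
  then have "i - m = j - m" using assms(2,3) by (intro cong_less_modulus_unique_nat) auto
  then show ?thesis using assms(2,3) by auto
qed

lemma multiplicity_choose_power:
  fixes p u :: nat
  assumes "prime p" "\<not> p dvd u"
  shows "multiplicity p ((p ^ b * (u * p ^ m)) choose p ^ b) = m"
proof -
  have "u > 0" using assms(2) by (metis dvd_0_right gr0I)
  moreover have "p > 0" using assms(1) prime_gt_0_nat by blast
  ultimately have "multiplicity p ((p ^ b * (u * p ^ m)) choose p ^ b) = multiplicity p (u * p ^ m)"
    using assms(1) by (intro const_p_fac) auto
  also have "\<dots> = m"
    using assms \<open>u > 0\<close> \<open>p > 0\<close>
    by (simp add: prime_elem_multiplicity_mult_distrib not_dvd_imp_multiplicity_0)
  finally show ?thesis .
qed

text \<open>\<open>a h\<close> is the coefficient of \<open>X\<^sup>h\<close> in \<open>\<Prod>(1 - \<sigma>(\<pi>) X)\<close>, that is \<open>(-1)\<^sup>h c\<^sub>h\<close>.\<close>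

locale eisenstein_series = valued_embedding \<tau> w p \<nu>
  for \<tau> :: "'k::field \<Rightarrow> 's::field" and w p \<nu> +
  fixes n u :: nat and a :: "nat \<Rightarrow> 'k"
  assumes n_eq: "n = u * p ^ \<nu>" and not_p_dvd_u: "\<not> p dvd u"
    and coeff_0: "a 0 = 1" and coeff_gt: "\<And>h. h > n \<Longrightarrow> a h = 0"
    and val_coeff_n: "w (a n) = ereal (real n)"
    and val_coeff_gt: "\<And>h. 1 \<le> h \<Longrightarrow> h < n \<Longrightarrow> ereal (real h) < w (a h)"
    and val_integral: "\<And>x. x \<noteq> 0 \<Longrightarrow> \<exists>z::int. w x = ereal (real n * of_int z)"
begin

lemma u_pos: "u > 0"
  using not_p_dvd_u by (metis dvd_0_right gr0I)

lemma n_ge_1: "n \<ge> 1"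
  using u_pos prime_p prime_gt_0_nat[of p] by (simp add: n_eq Suc_le_eq)

lemma p_power_dvd_n: "i \<le> \<nu> \<Longrightarrow> p ^ i dvd n"
  by (simp add: n_eq le_imp_power_dvd)

lemma trunc_mult_n: "trunc_mult n = \<nu>"
proof -
  have "p ^ \<nu> dvd n" by (simp add: n_eq)
  then show ?thesis using le_trunc_mult_iff[OF n_ge_1, of \<nu>] trunc_mult_le[of n] by simp
qed

lemma trunc_mult_mod:
  assumes "\<not> n dvd l"
  shows "trunc_mult (l mod n) = trunc_mult l"
proof -
  have ge_1: "l mod n \<ge> 1" "l \<ge> 1"
    using assms by (auto simp: Suc_le_eq mod_greater_zero_iff_not_dvd intro: gr0I)
  have "i \<le> trunc_mult (l mod n) \<longleftrightarrow> i \<le> trunc_mult l" for i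
    using le_trunc_mult_iff[OF ge_1(1)] le_trunc_mult_iff[OF ge_1(2)] p_power_dvd_n[of i]
    by (metis dvd_mod_iff)
  then show ?thesis by (metis order_refl antisym)
qed

text \<open>The contribution of \<open>c\<^sub>h\<close> to \<open>i\<^sub>j\<close>: among the \<open>j' \<ge> j\<close> that admit \<open>h\<close>, the smallest one,
  \<open>max j (trunc_mult h)\<close>, is the best; truncated subtraction gives the factor of \<open>e\<^sub>L\<close>.\<close>

definition insep_term :: "nat \<Rightarrow> nat \<Rightarrow> ereal" where
  "insep_term h j = (w (a h) - ereal (real h)) + ereal (real (trunc_mult h - j)) * w (of_nat p)"

definition insep_min :: "nat set \<Rightarrow> nat \<Rightarrow> ereal" where
  "insep_min A j = (INF h\<in>A. insep_term h j)"

lemma insep_term_n: "insep_term n j = ereal (real (\<nu> - j)) * w (of_nat p)"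
  by (simp add: insep_term_def trunc_mult_n val_coeff_n)

lemma val_coeff_minus_ge_1:
  assumes "1 \<le> h" "h < n"
  shows "1 \<le> w (a h) - ereal (real h)"
proof (cases "a h = 0")
  case False
  then obtain z where z: "w (a h) = ereal (real n * of_int z)" using val_integral by blast
  then have "real_of_int (int h) < real_of_int (int n * z)" using val_coeff_gt[OF assms] by simp
  then have "int h + 1 \<le> int n * z" by linarith
  then have "real_of_int (int h + 1) \<le> real_of_int (int n * z)" by linarith
  then show ?thesis using z by (simp add: one_ereal_def)
qed simp

lemma val_p_mult_nonneg: "0 \<le> ereal (real m) * w (of_nat p)"
  using val_p_pos by (simp add: less_imp_le)

lemma insep_term_ge: "w (a h) - ereal (real h) \<le> insep_term h j"
  unfolding insep_term_def using add_left_mono[OF val_p_mult_nonneg] by (metis add.right_neutral)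

lemma insep_term_ge_1: "1 \<le> h \<Longrightarrow> h < n \<Longrightarrow> 1 \<le> insep_term h j"
  using insep_term_ge[of h j] val_coeff_minus_ge_1[of h] order_trans by blast

lemma insep_term_nonneg:
  assumes "1 \<le> h" "h \<le> n"
  shows "0 \<le> insep_term h j"
proof (cases "h = n")
  case True
  then show ?thesis using val_p_mult_nonneg by (simp add: insep_term_n)
next
  case False
  then have "1 \<le> insep_term h j" using assms by (intro insep_term_ge_1) auto
  then show ?thesis by (rule order_trans[rotated]) simp
qed

lemma trunc_mult_less:
  assumes "h \<in> {1..<n}" "insep_term h j < insep_term n j"
  shows "trunc_mult h < \<nu>"
proof (rule ccontr)
  assume "\<not> trunc_mult h < \<nu>"
  then have trunc_eq: "trunc_mult h = \<nu>" using trunc_mult_le[of h] by simp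
  have "0 \<le> w (a h) - ereal (real h)"
    using val_coeff_minus_ge_1[of h] assms(1) by (auto intro: order_trans[of 0 1])
  then have "insep_term n j \<le> insep_term h j"
    unfolding insep_term_n insep_term_def[of h] trunc_eq by (simp add: add_increasing)
  then show False using assms(2) by simp
qed

lemma insep_term_antimono:
  assumes "i \<le> j"
  shows "insep_term h j \<le> insep_term h i"
  unfolding insep_term_def
  using assms val_p_pos by (intro add_left_mono ereal_mult_right_mono) (auto simp: less_imp_le)

lemma insep_term_Suc: "insep_term h j \<le> w (of_nat p) + insep_term h (Suc j)"
proof -
  have "ereal (real (trunc_mult h - j)) * w (of_nat p) \<le>
      (1 + ereal (real (trunc_mult h - Suc j))) * w (of_nat p)"
    using val_p_pos by (intro ereal_mult_right_mono) (auto simp: one_ereal_def)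
  also have "\<dots> = 1 * w (of_nat p) + ereal (real (trunc_mult h - Suc j)) * w (of_nat p)"
    by (rule ereal_left_distrib) simp_all
  finally have "(w (a h) - ereal (real h)) + ereal (real (trunc_mult h - j)) * w (of_nat p) \<le>
      (w (a h) - ereal (real h)) +
        (1 * w (of_nat p) + ereal (real (trunc_mult h - Suc j)) * w (of_nat p))"
    by (rule add_left_mono)
  then show ?thesis by (simp add: insep_term_def add_ac)
qed

lemma insep_min_le: "h \<in> A \<Longrightarrow> insep_min A j \<le> insep_term h j"
  unfolding insep_min_def by (rule INF_lower)

lemma insep_min_attained:
  assumes "finite A" "A \<noteq> {}"
  obtains h where "h \<in> A" "insep_min A j = insep_term h j"
proof -
  have "Min ((\<lambda>h. insep_term h j) ` A) \<in> (\<lambda>h. insep_term h j) ` A"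
    using assms by (intro Min_in) auto
  moreover have "insep_min A j = Min ((\<lambda>h. insep_term h j) ` A)"
    unfolding insep_min_def using assms by (intro Min_Inf[symmetric]) auto
  ultimately show ?thesis using that by auto
qed

lemma insep_profile_insep_min:
  assumes subset: "A \<subseteq> {1..n}" and eps: "0 \<le> \<epsilon>" "\<And>h j. h \<in> A \<Longrightarrow> \<epsilon> \<le> insep_term h j"
  shows "insep_profile \<epsilon> (insep_min A)"
  unfolding insep_profile_def
proof (intro conjI allI impI)
  fix j show "\<epsilon> \<le> insep_min A j" unfolding insep_min_def using eps by (intro INF_greatest)
next
  fix i j :: nat assume "i \<le> j"
  then show "insep_min A j \<le> insep_min A i"
    unfolding insep_min_def by (intro INF_mono) (auto intro: insep_term_antimono)
next
  fix j
  show "insep_min A j \<le> w (of_nat p) + insep_min A (Suc j)"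
  proof (cases "A = {}")
    case True
    then show ?thesis using val_p_pos by (auto simp: insep_min_def top_ereal_def)
  next
    case False
    then obtain h where h: "h \<in> A" "insep_min A (Suc j) = insep_term h (Suc j)"
      using insep_min_attained finite_subset[OF subset] by blast
    have "insep_min A j \<le> insep_term h j" by (rule insep_min_le[OF h(1)])
    also have "\<dots> \<le> w (of_nat p) + insep_term h (Suc j)" by (rule insep_term_Suc)
    finally show ?thesis by (simp add: h(2))
  qed
qed (rule eps(1))

lemma insep_profile_full: "insep_profile 0 (insep_min {1..n})"
  by (rule insep_profile_insep_min) (auto intro: insep_term_nonneg)

lemma insep_profile_top: "insep_profile 0 (insep_min {n})"
  using n_ge_1 by (intro insep_profile_insep_min) (auto intro: insep_term_nonneg)

lemma insep_profile_lower: "insep_profile 1 (insep_min {1..<n})"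
  by (rule insep_profile_insep_min) (auto intro: insep_term_ge_1)

lemma profile_bound_insep_min_le:
  assumes "h \<in> A"
  shows "profile_bound 1 (insep_min A) h \<le> w (a h)"
proof -
  have "insep_min A (trunc_mult h) \<le> w (a h) - ereal (real h)"
    using insep_min_le[OF assms, of "trunc_mult h"]
    by (simp add: insep_term_def zero_ereal_def[symmetric])
  then have "ereal (real h) + insep_min A (trunc_mult h) \<le> ereal (real h) + (w (a h) - ereal (real h))"
    by (rule add_left_mono)
  also have "\<dots> = w (a h)" by (cases "w (a h)") auto
  finally show ?thesis by (simp add: profile_bound_def)
qed

text \<open>The factor \<open>1 + a\<^sub>n X\<^sup>n\<close> splits off the only coefficient with \<open>w (a h) = h\<close>, so that
  \<open>\<epsilon> = 1\<close> is admissible for the quotient.\<close>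

definition eis_series :: "'s fps" where
  "eis_series = Abs_fps (\<lambda>h. \<tau> (a h))"

definition top_factor :: "'s fps" where
  "top_factor = one_minus_monom (\<tau> (- a n)) n"

definition lower_factor :: "'s fps" where
  "lower_factor = Abs_fps (\<lambda>l. if l = 0 then 1 else if n dvd l then 0
     else \<tau> (a (l mod n) * (- a n) ^ (l div n)))"

lemma lower_factor_nth:
  "\<not> n dvd l \<Longrightarrow> lower_factor $ l = \<tau> (a (l mod n) * (- a n) ^ (l div n))"
  by (auto simp: lower_factor_def)

lemma bounded_eis_series: "bounded_series 1 (insep_min {1..n}) eis_series"
proof -
  have "\<tau> (a h) \<in> fractional_ideal (profile_bound 1 (insep_min {1..n}) h)" if "h \<ge> 1" for h
    using that coeff_gt[of h] profile_bound_insep_min_le[of h "{1..n}"]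
    by (cases "h \<le> n") (auto simp: hom_in_fractional_ideal_iff)
  then show ?thesis by (simp add: unit_series_def eis_series_def coeff_0)
qed

lemma bounded_top_factor: "bounded_series 1 (insep_min {n}) top_factor"
  unfolding top_factor_def
  by (rule unit_series_one_minus_monom[OF graded_subring_profile_bound[OF insep_profile_top] n_ge_1])
    (use profile_bound_insep_min_le[of n "{n}"] in \<open>simp add: hom_in_fractional_ideal_iff\<close>)

lemma bounded_lower_factor: "bounded_series 1 (insep_min {1..<n}) lower_factor"
proof -
  let ?b = "profile_bound 1 (insep_min {1..<n})"
  have "?b l \<le> w (a (l mod n) * (- a n) ^ (l div n))" if not_dvd: "\<not> n dvd l" for l
  proof -
    have "l mod n \<in> {1..<n}"
      using not_dvd n_ge_1 by (auto simp: Suc_le_eq mod_greater_zero_iff_not_dvd)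
    then have lower: "?b (l mod n) \<le> w (a (l mod n))" by (rule profile_bound_insep_min_le)
    have "real l = real (l div n * n + l mod n)" by (simp only: div_mult_mod_eq)
    then have "ereal (real l) = ereal (real (l div n) * real n) + ereal (real (l mod n))"
      by (simp only: of_nat_add of_nat_mult plus_ereal.simps)
    then have "?b l = ereal (real (l div n) * real n) + ?b (l mod n)"
      using trunc_mult_mod[OF not_dvd] by (simp only: profile_bound_def of_int_1 mult_1 add.assoc)
    also have "\<dots> \<le> ereal (real (l div n) * real n) + w (a (l mod n))"
      using lower by (rule add_left_mono)
    also have "\<dots> = w (a (l mod n) * (- a n) ^ (l div n))"
      by (simp add: val_mult val_power val_coeff_n add.commute)
    finally show ?thesis .
  qed
  then show ?thesis by (auto simp: unit_series_def lower_factor_def hom_in_fractional_ideal_iff)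
qed

lemma eis_series_eq: "eis_series = top_factor * lower_factor"
proof (rule fps_ext)
  fix l
  have product: "(top_factor * lower_factor) $ l =
      lower_factor $ l - (if n \<le> l then \<tau> (- a n) * lower_factor $ (l - n) else 0)"
    by (simp add: top_factor_def one_minus_monom_mult_nth)
  consider (zero) "l = 0" | (below) "0 < l" "l < n" | (top) "l = n" | (above) "l > n" by linarith
  then show "eis_series $ l = (top_factor * lower_factor) $ l"
  proof cases
    case zero
    then show ?thesis
      using n_ge_1 by (subst product) (simp add: eis_series_def lower_factor_def coeff_0)
  next
    case below
    then have "\<not> n dvd l" by (auto dest: dvd_imp_le)
    then show ?thesis using below by (subst product) (simp add: eis_series_def lower_factor_def)
  next
    case top
    then show ?thesis using n_ge_1
      by (subst product) (simp add: eis_series_def lower_factor_def tau.hom_uminus)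
  next
    case above
    then have "n dvd l - n \<longleftrightarrow> n dvd l" by (metis dvd_minus_self less_imp_not_less)
    moreover have "l div n = Suc ((l - n) div n)" "l mod n = (l - n) mod n"
      using above n_ge_1 by (auto simp: div_if[of l n] mod_if[of l n])
    ultimately have "lower_factor $ l = \<tau> (- a n) * lower_factor $ (l - n)"
      using above by (simp add: lower_factor_def tau.hom_mult[symmetric] mult_ac)
    then show ?thesis using above by (subst product) (simp add: eis_series_def coeff_gt)
  qed
qed

lemma insep_term_integral:
  assumes "insep_term h j = ereal y"
  shows "\<exists>z::int. y = real_of_int (int n * z - int h)"
proof -
  have "a h \<noteq> 0" using assms val_p_pos by (auto simp: insep_term_def)
  then obtain z where z: "w (a h) = ereal (real n * of_int z)" using val_integral by blast
  show ?thesis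
  proof (cases "trunc_mult h \<le> j")
    case True
    then have "y = real n * of_int z - real h" using assms z
      by (simp add: insep_term_def zero_ereal_def[symmetric])
    then show ?thesis by (intro exI[of _ z]) simp
  next
    case False
    have "w (of_nat p) \<noteq> \<infinity>" using assms z False by (auto simp: insep_term_def)
    then have "of_nat p \<noteq> (0::'k)" by auto
    then obtain z' where z': "w (of_nat p) = ereal (real n * of_int z')" using val_integral by blast
    have "y = real n * of_int z - real h + real (trunc_mult h - j) * (real n * of_int z')"
      using assms z z' by (simp add: insep_term_def)
    then show ?thesis
      by (intro exI[of _ "z + int (trunc_mult h - j) * z'"]) (simp add: algebra_simps)
  qed
qed

text \<open>Values of \<open>w\<close> lie in \<open>n \<int>\<close>, so a finite \<open>insep_term h j\<close> is congruent to \<open>- h\<close> modulo \<open>n\<close>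
  and determines \<open>h\<close>.\<close>

lemma insep_term_inj:
  assumes "insep_term h j = ereal y" "insep_term h' j = ereal y" "h \<in> {1..n}" "h' \<in> {1..n}"
  shows "h = h'"
proof -
  obtain z z' where "y = real_of_int (int n * z - int h)" "y = real_of_int (int n * z' - int h')"
    using insep_term_integral assms(1,2) by meson
  then have "int n * z - int h = int n * z' - int h'" by linarith
  then have "int h - int h' = int n * (z - z')" by (simp add: algebra_simps)
  then have "[int h = int h'] (mod int n)" by (simp add: cong_iff_dvd_diff)
  then show ?thesis using assms(3,4) by (intro cong_same_interval_imp_eq[of h h' n 1]) auto
qed

lemma insep_min_unique:
  assumes min_eq: "insep_min {1..n} j = ereal (of_int N)"
  obtains h where "h \<in> {1..n}" "insep_term h j = ereal (of_int N)" "int n dvd N + int h"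
    "\<And>h'. h' \<in> {1..n} - {h} \<Longrightarrow> ereal (of_int N) + 1 \<le> insep_term h' j"
proof -
  have "{1..n} \<noteq> {}" using n_ge_1 by simp
  then obtain h where h: "h \<in> {1..n}" "insep_term h j = ereal (of_int N)"
    using insep_min_attained[of "{1..n}" j] min_eq by (metis finite_atLeastAtMost)
  then obtain z where "real_of_int N = real_of_int (int n * z - int h)"
    using insep_term_integral by blast
  then have "N + int h = int n * z" by linarith
  moreover have "ereal (of_int N) + 1 \<le> insep_term h' j" if h': "h' \<in> {1..n} - {h}" for h'
  proof -
    have ge: "ereal (of_int N) \<le> insep_term h' j"
      using insep_min_le[of h' "{1..n}" j] h' min_eq by simp
    show ?thesis
    proof (cases "insep_term h' j")
      case (real y)
      then obtain z' where y: "y = real_of_int (int n * z' - int h')"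
        using insep_term_integral by blast
      have "y \<noteq> of_int N" using insep_term_inj[of h' j _ h] real h h' by auto
      then have "real_of_int N < real_of_int (int n * z' - int h')" using ge real y by simp
      then have "N + 1 \<le> int n * z' - int h'" by linarith
      then have "real_of_int (N + 1) \<le> y" unfolding y by linarith
      then show ?thesis using real by (simp add: one_ereal_def)
    qed (use ge in auto)
  qed
  ultimately show ?thesis using that h by simp
qed

end

text \<open>\<open>N\<close> is the index of inseparability \<open>i\<^sub>j\<close>, and \<open>\<Psi> eis_series\<close> is the norm of \<open>1 - \<pi>\<^sup>s X\<close>.\<close>

locale eisenstein_power = eisenstein_series \<tau> w p \<nu> n u a + witt_frobenius s \<Psi>
  for \<tau> :: "'k::field \<Rightarrow> 's::field" and w p \<nu> n u a s and \<Psi> :: "'s fps \<Rightarrow> 's fps" +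
  fixes j :: nat and N :: int
  assumes j_le: "j \<le> \<nu>" and insep_min_eq: "insep_min {1..n} j = ereal (of_int N)"
    and n_dvd: "int n dvd int (s * p ^ j) + N"
begin

abbreviation target :: ereal where
  "target \<equiv> ereal (real (s * p ^ j) + of_int N)"

lemma p_power_ge_1: "p ^ j \<ge> 1"
  using prime_p prime_gt_0_nat by (simp add: Suc_le_eq)

lemma frobenius_bounded:
  assumes "insep_profile \<epsilon> d" "bounded_series 1 d F" "k \<ge> 1"
  shows "\<Psi> F $ k \<in> fractional_ideal (ereal (real (s * k)) + d (trunc_mult k))"
  using bounded_series_witt_frobenius[OF assms(1) witt_frobenius_axioms assms(2)] assms(3)
  by (simp add: unit_series_def profile_bound_def)

lemma frobenius_at_p_power:
  assumes "insep_profile \<epsilon> d" "bounded_series 1 d F" "ereal (of_int N) + 1 \<le> d j"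
  shows "\<Psi> F $ (p ^ j) \<in> fractional_ideal (target + 1)"
proof -
  have "ereal (real (s * p ^ j)) + (ereal (of_int N) + 1) \<le> ereal (real (s * p ^ j)) + d j"
    using assms(3) by (rule add_left_mono)
  then have "target + 1 \<le> ereal (real (s * p ^ j)) + d j" by (simp add: one_ereal_def add.assoc)
  then show ?thesis
    using frobenius_bounded[OF assms(1,2) p_power_ge_1] fractional_ideal_antimono
    by (simp add: trunc_mult_p_power[OF j_le])
qed

lemma insep_min_subset_ge:
  assumes "A \<subseteq> {1..n}"
  shows "ereal (of_int N) \<le> insep_min A j"
  using assms unfolding insep_min_eq[symmetric] insep_min_def by (intro INF_superset_mono) auto

lemma cross_term:
  assumes i_range: "i \<in> {1..<p ^ j}"
  shows "\<Psi> top_factor $ i * \<Psi> lower_factor $ (p ^ j - i) \<in> fractional_ideal (target + 1)"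
proof -
  let ?k = "p ^ j" and ?top = "insep_min {n} (trunc_mult i)"
    and ?lower = "insep_min {1..<n} (trunc_mult (p ^ j - i))"
  have "\<not> ?k dvd i" using i_range by (auto dest: dvd_imp_le)
  then have trunc_le: "trunc_mult i \<le> j" using i_range le_trunc_mult_iff[of i j] j_le by simp
  have "ereal (of_int N) \<le> insep_min {n} j" using n_ge_1 by (intro insep_min_subset_ge) simp
  also have "\<dots> \<le> ?top" using insep_profile_antimono[OF insep_profile_top trunc_le j_le] .
  finally have "ereal (of_int N) + 1 \<le> ?top + ?lower"
    using insep_profile_lower by (intro add_mono) (auto simp: insep_profile_def)
  then have "(ereal (real (s * i)) + ereal (real (s * (?k - i)))) + (ereal (of_int N) + 1) \<le>
      (ereal (real (s * i)) + ereal (real (s * (?k - i)))) + (?top + ?lower)" by (rule add_left_mono)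
  moreover have "(ereal (real (s * i)) + ereal (real (s * (?k - i)))) + (ereal (of_int N) + 1) =
      target + 1"
    using i_range by (simp add: one_ereal_def algebra_simps)
  ultimately have "target + 1 \<le>
      (ereal (real (s * i)) + ?top) + (ereal (real (s * (?k - i))) + ?lower)" by (simp only: add_ac)
  moreover have "\<Psi> top_factor $ i * \<Psi> lower_factor $ (?k - i) \<in>
      fractional_ideal ((ereal (real (s * i)) + ?top) + (ereal (real (s * (?k - i))) + ?lower))"
    using i_range
    by (intro fractional_ideal_mult frobenius_bounded[OF insep_profile_top bounded_top_factor]
        frobenius_bounded[OF insep_profile_lower bounded_lower_factor]) auto
  ultimately show ?thesis using fractional_ideal_antimono by blast
qed

lemma eis_series_nth_cong:
  "\<Psi> eis_series $ (p ^ j) - (\<Psi> top_factor $ (p ^ j) + \<Psi> lower_factor $ (p ^ j))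
    \<in> fractional_ideal (target + 1)"
proof -
  have "top_factor $ 0 = 1" "lower_factor $ 0 = 1"
    using bounded_top_factor bounded_lower_factor by (auto simp: unit_series_def)
  then have "\<Psi> eis_series $ (p ^ j) - (\<Psi> top_factor $ (p ^ j) + \<Psi> lower_factor $ (p ^ j)) =
      (\<Sum>i\<in>{1..<p ^ j}. \<Psi> top_factor $ i * \<Psi> lower_factor $ (p ^ j - i))"
    using fps_mult_nth_units[of "\<Psi> top_factor" "\<Psi> lower_factor" "p ^ j"] p_power_ge_1
    by (simp add: eis_series_eq mult nth_0)
  moreover have "(\<Sum>i\<in>{1..<p ^ j}. \<Psi> top_factor $ i * \<Psi> lower_factor $ (p ^ j - i))
      \<in> fractional_ideal (target + 1)"
    using cross_term by (rule fractional_ideal_sum)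
  ultimately show ?thesis by (simp only:)
qed

lemma eis_series_nth_val_dominant:
  assumes "x + y = \<Psi> top_factor $ (p ^ j) + \<Psi> lower_factor $ (p ^ j)"
    and "x = \<tau> x'" "w x' = target" and "y \<in> fractional_ideal (target + 1)"
  shows "\<exists>z. \<Psi> eis_series $ (p ^ j) = \<tau> z \<and> w z = target"
proof -
  define r where "r = \<Psi> eis_series $ (p ^ j) - (\<Psi> top_factor $ (p ^ j) + \<Psi> lower_factor $ (p ^ j))"
  have "y + r \<in> fractional_ideal (target + 1)"
    using fractional_ideal_add[OF assms(4) eis_series_nth_cong] by (simp add: r_def)
  moreover have "\<Psi> eis_series $ (p ^ j) = \<tau> x' + (y + r)"
    using assms(1,2) by (simp add: r_def algebra_simps)
  ultimately show ?thesis using perturbed_valuation[OF assms(3)] by simp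
qed

lemma top_factor_nth_obtain:
  assumes "int n dvd N"
  obtains i g e where "g = i * (u * p ^ (\<nu> - j))" "i * e * n = s * p ^ j" "i \<in> range ((^) p)"
    "\<Psi> top_factor $ (p ^ j) = of_nat (g choose i) * (- (\<tau> (- a n) ^ e)) ^ i"
proof -
  obtain g q e where factors: "n = g * q" "s = g * e" "coprime q e" and pos: "g \<ge> 1" "q \<ge> 1"
    and frob: "\<Psi> top_factor = one_minus_monom (\<tau> (- a n) ^ e) q ^ g"
    using one_minus_monom_obtain[OF n_ge_1] unfolding top_factor_def by metis
  have "int n dvd int (s * p ^ j)" using n_dvd assms by (simp add: dvd_add_left_iff)
  then have "g * q dvd g * (e * p ^ j)"
    unfolding of_nat_dvd_iff factors(1,2) by (simp add: mult.assoc)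
  then have "q dvd e * p ^ j" using pos(1) by simp
  then have q_dvd: "q dvd p ^ j" using factors(3) by (simp add: coprime_dvd_mult_right_iff)
  then obtain b where b: "b \<le> j" "q = p ^ b" using prime_p divides_primepow_nat by blast
  define i where "i = p ^ (j - b)"
  have i_times_q: "i * q = p ^ j" using b by (simp add: i_def power_add[symmetric])
  have "p ^ \<nu> = (i * q) * p ^ (\<nu> - j)" unfolding i_times_q
    using j_le by (simp add: power_add[symmetric])
  then have "g * q = u * ((i * q) * p ^ (\<nu> - j))" using factors(1) n_eq by metis
  then have "g * q = i * (u * p ^ (\<nu> - j)) * q" by (simp only: mult_ac)
  then have "g = i * (u * p ^ (\<nu> - j))" using pos(2) by simp
  moreover have "i * e * n = s * p ^ j" using i_times_q factors(1,2) by (simp add: mult_ac)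
  moreover have "p ^ j div q = i" using div_mult_self_is_m[of q i] i_times_q pos(2) by simp
  then have "\<Psi> top_factor $ (p ^ j) = of_nat (g choose i) * (- (\<tau> (- a n) ^ e)) ^ i"
    using q_dvd by (simp add: frob one_minus_monom_power_nth[OF pos(2)])
  ultimately show ?thesis using that[of g i e] by (simp add: i_def)
qed

lemma top_factor_nth_val:
  assumes "insep_term n j = ereal (of_int N)" "int n dvd N"
  shows "\<exists>x. \<Psi> top_factor $ (p ^ j) = \<tau> x \<and> w x = target"
proof -
  obtain i g e where g_eq: "g = i * (u * p ^ (\<nu> - j))" and i_e_n: "i * e * n = s * p ^ j"
    and i_power: "i \<in> range ((^) p)"
    and top: "\<Psi> top_factor $ (p ^ j) = of_nat (g choose i) * (- (\<tau> (- a n) ^ e)) ^ i"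
    by (rule top_factor_nth_obtain[OF assms(2)])
  have p_pos: "p > 0" using prime_p prime_gt_0_nat by blast
  have "multiplicity p (g choose i) = \<nu> - j"
    using i_power unfolding g_eq by (auto intro: multiplicity_choose_power[OF prime_p not_p_dvd_u])
  moreover have "i \<le> g" unfolding g_eq using u_pos p_pos by simp
  ultimately have val_choose: "w (of_nat (g choose i)) = ereal (of_int N)"
    using assms(1) val_of_nat_eq_multiplicity[OF prime_p val_p_pos, of "g choose i"]
    by (simp add: insep_term_n Suc_le_eq)
  define x where "x = of_nat (g choose i) * (- ((- a n) ^ e)) ^ i"
  have "\<Psi> top_factor $ (p ^ j) = \<tau> x"
    by (simp add: top x_def tau.hom_mult tau.hom_power tau.hom_uminus tau.hom_of_nat)
  moreover have "real i * (real e * real n) = real (s * p ^ j)"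
    using i_e_n by (metis of_nat_mult mult.assoc)
  then have "w x = target"
    by (simp add: x_def val_mult val_power val_coeff_n val_choose add.commute)
  ultimately show ?thesis by blast
qed

lemma multiplicity_exponent:
  assumes trunc_less: "trunc_mult h < \<nu>" and mod: "s * p ^ j mod n = h" and "h \<ge> 1"
  shows "multiplicity p s = trunc_mult h - j"
proof -
  have "\<not> n dvd s * p ^ j" using mod \<open>h \<ge> 1\<close> by (auto simp: dvd_eq_mod_eq_0)
  then have "trunc_mult (s * p ^ j) = trunc_mult h" using trunc_mult_mod mod by metis
  then have "multiplicity p (s * p ^ j) = trunc_mult h"
    using trunc_less by (auto simp: trunc_mult_def min_def split: if_splits)
  moreover have "multiplicity p (s * p ^ j) = multiplicity p s + j"
    using prime_p s_ge_1 by (subst prime_elem_multiplicity_mult_distrib) auto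
  ultimately show ?thesis by simp
qed

lemma lower_factor_nth_val:
  assumes minimizer: "h \<in> {1..<n}" "insep_term h j = ereal (of_int N)" "int n dvd N + int h"
    and less: "insep_term h j < insep_term n j"
  shows "\<exists>x. of_nat s * lower_factor $ (s * p ^ j) = \<tau> x \<and> w x = target"
proof -
  have "int n dvd int (s * p ^ j) - int h" using dvd_diff[OF n_dvd minimizer(3)] by simp
  then have "[s * p ^ j = h] (mod n)" by (simp only: cong_iff_dvd_diff[symmetric] cong_int_iff)
  then have mod: "s * p ^ j mod n = h" using minimizer(1) by (simp add: cong_def)
  have mult_s: "multiplicity p s = trunc_mult h - j"
    using trunc_mult_less[OF minimizer(1) less] mod minimizer(1)
    by (intro multiplicity_exponent) auto
  define m where "m = s * p ^ j div n"
  define x where "x = of_nat s * (a h * (- a n) ^ m)"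
  have "\<not> n dvd s * p ^ j" using mod minimizer(1) by (auto simp: dvd_eq_mod_eq_0)
  then have "of_nat s * lower_factor $ (s * p ^ j) = \<tau> x"
    using mod by (simp add: lower_factor_nth x_def m_def tau.hom_mult tau.hom_of_nat)
  moreover have "w x = target"
  proof -
    have "w x = ereal (real (trunc_mult h - j)) * w (of_nat p) + (w (a h) + ereal (real m * real n))"
      using val_of_nat_eq_multiplicity[OF prime_p val_p_pos s_ge_1] mult_s
      by (simp add: x_def val_mult val_power val_coeff_n)
    also have "w (a h) = (w (a h) - ereal (real h)) + ereal (real h)" by (cases "w (a h)") auto
    also have "ereal (real (trunc_mult h - j)) * w (of_nat p) + ((w (a h) - ereal (real h)) +
          ereal (real h) + ereal (real m * real n)) =
        insep_term h j + (ereal (real h) + ereal (real m * real n))"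
      by (simp only: insep_term_def add_ac)
    also have "ereal (real h) + ereal (real m * real n) = ereal (real (m * n + s * p ^ j mod n))"
      by (simp add: mod)
    also have "\<dots> = ereal (real (s * p ^ j))" unfolding m_def by (simp only: div_mult_mod_eq)
    finally show ?thesis by (simp add: minimizer(2))
  qed
  ultimately show ?thesis by blast
qed

lemma lower_factor_nth_cong:
  "\<Psi> lower_factor $ (p ^ j) - of_nat s * lower_factor $ (s * p ^ j) \<in> fractional_ideal (target + 1)"
proof -
  have "\<Psi> lower_factor $ (p ^ j) - of_nat s * lower_factor $ (s * p ^ j) \<in>
      fractional_ideal (profile_bound (1 * int s) (insep_min {1..<n}) (p ^ j) + 1)"
    using frobenius_cong_witt_frobenius[OF insep_profile_lower witt_frobenius_axioms
        bounded_lower_factor] p_power_ge_1 unfolding frobenius_cong_def by blast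
  moreover have "ereal (of_int N) \<le> insep_min {1..<n} j" by (rule insep_min_subset_ge) auto
  then have "ereal (real (s * p ^ j)) + ereal (of_int N) + 1 \<le>
      profile_bound (1 * int s) (insep_min {1..<n}) (p ^ j) + 1"
    unfolding profile_bound_def trunc_mult_p_power[OF j_le] by (intro add_mono) auto
  ultimately show ?thesis using fractional_ideal_antimono by simp
qed

lemma eis_series_nth_val:
  "\<exists>x. \<Psi> eis_series $ (p ^ j) = \<tau> x \<and> w x = target"
proof -
  obtain h where h: "h \<in> {1..n}" "insep_term h j = ereal (of_int N)" "int n dvd N + int h"
    "\<And>h'. h' \<in> {1..n} - {h} \<Longrightarrow> ereal (of_int N) + 1 \<le> insep_term h' j"
    using insep_min_unique[OF insep_min_eq] by metis
  show ?thesis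
  proof (cases "h = n")
    case True
    have "ereal (of_int N) + 1 \<le> insep_min {1..<n} j"
      unfolding insep_min_def using h(4) True by (intro INF_greatest) auto
    then have "\<Psi> lower_factor $ (p ^ j) \<in> fractional_ideal (target + 1)"
      by (rule frobenius_at_p_power[OF insep_profile_lower bounded_lower_factor])
    moreover obtain x where "\<Psi> top_factor $ (p ^ j) = \<tau> x" "w x = target"
      using top_factor_nth_val h(2,3) True by (auto simp: dvd_add_left_iff)
    ultimately show ?thesis using eis_series_nth_val_dominant by blast
  next
    case False
    then have n_term: "ereal (of_int N) + 1 \<le> insep_term n j" using h(4)[of n] n_ge_1 by simp
    then have "\<Psi> top_factor $ (p ^ j) \<in> fractional_ideal (target + 1)"
      by (intro frobenius_at_p_power[OF insep_profile_top bounded_top_factor])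
        (simp add: insep_min_def)
    moreover have "insep_term h j < insep_term n j"
      by (rule less_le_trans[OF _ n_term]) (simp add: h(2) one_ereal_def)
    then obtain x where x: "of_nat s * lower_factor $ (s * p ^ j) = \<tau> x" "w x = target"
      using lower_factor_nth_val[OF _ h(2,3)] h(1) False by auto
    ultimately have "\<Psi> top_factor $ (p ^ j) + (\<Psi> lower_factor $ (p ^ j) - \<tau> x) \<in>
        fractional_ideal (target + 1)"
      using lower_factor_nth_cong fractional_ideal_add by simp
    then show ?thesis by (rule eis_series_nth_val_dominant[OF _ refl x(2), rotated]) simp
  qed
qed

end

section \<open>Simple extensions and their embeddings\<close>

lemma coprime_poly_bezout:
  fixes f g :: "'a::field poly"
  assumes "coprime f g"
  shows "\<exists>r s. r * f + s * g = 1"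
  using assms
proof (induction "if g = 0 then 0 else Suc (degree g)" arbitrary: f g rule: less_induct)
  case less
  show ?case
  proof (cases "g = 0")
    case True
    then have "f dvd 1" using less.prems by simp
    then obtain r where "1 = f * r" by blast
    then show ?thesis using True by (metis add.right_neutral mult.commute mult_zero_right)
  next
    case False
    then have "coprime g (f mod g)" using less.prems by (simp add: coprime_commute)
    moreover have "(if f mod g = 0 then 0 else Suc (degree (f mod g))) <
        (if g = 0 then 0 else Suc (degree g))"
      using False degree_mod_less[of g f] by auto
    ultimately obtain r s where bezout: "r * g + s * (f mod g) = 1" using less.hyps by blast
    have "s * f = s * (f div g) * g + s * (f mod g)"
      by (metis distrib_left div_mult_mod_eq mult.assoc)
    then have "s * f + (r - s * (f div g)) * g = r * g + s * (f mod g)"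
      by (simp add: left_diff_distrib)
    then show ?thesis using bezout by metis
  qed
qed

lemma separable_poly_splits:
  fixes g :: "'a::field poly"
  assumes closed: "separably_closed TYPE('a)"
  shows "separable_poly g \<Longrightarrow> lead_coeff g = 1 \<Longrightarrow>
    \<exists>R. finite R \<and> g = (\<Prod>x\<in>R. [:- x, 1:])"
proof (induction "degree g" arbitrary: g)
  case 0
  then have "g = 1" by (metis degree_0_id one_pCons)
  then show ?case by (intro exI[of _ "{}"]) auto
next
  case (Suc m)
  then obtain x where "poly g x = 0"
    using closed unfolding separably_closed_def by (metis zero_less_Suc)
  then obtain g' where g': "g = [:- x, 1:] * g'" by (auto simp: poly_eq_0_iff_dvd)
  have "g' \<noteq> 0" using g' Suc by auto
  then have deg: "degree g = Suc (degree g')" unfolding g' by (subst degree_mult_eq) auto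
  have lead: "lead_coeff g' = 1" using Suc.prems(2) g' by (simp only: lead_coeff_mult) simp
  have "separable_poly g'" using separable_poly_dvd[OF Suc.prems(1)] g' by (metis dvd_triv_right)
  then obtain R where R: "finite R" "g' = (\<Prod>x\<in>R. [:- x, 1:])"
    using Suc deg lead by (metis nat.inject)
  have "x \<notin> R"
  proof
    assume "x \<in> R"
    then have "poly g' x = 0" using R by (auto simp: poly_prod)
    then have "[:- x, 1:] dvd g'" by (simp add: poly_eq_0_iff_dvd)
    moreover have "pderiv g = [:- x, 1:] * pderiv g' + g' * pderiv [:- x, 1:]"
      unfolding g' by (rule pderiv_mult)
    ultimately have "[:- x, 1:] dvd pderiv g" by (metis dvd_add dvd_mult2 dvd_triv_left)
    then have "[:- x, 1:] dvd (1 :: 'a poly)"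
      using Suc.prems(1) g' unfolding separable_poly_def coprime_def by (metis dvd_triv_left)
    then show False by (simp add: is_unit_iff_degree)
  qed
  then have "g = (\<Prod>x\<in>insert x R. [:- x, 1:])" using R g' by simp
  then show ?case using R(1) by blast
qed

lemma prod_one_minus_monom_reflect:
  fixes R :: "'a::field set"
  shows "(\<Prod>x\<in>R. one_minus_monom x 1) = fps_of_poly (reflect_poly (\<Prod>x\<in>R. [:- x, 1:]))"
proof -
  have "reflect_poly [:- x, 1:] = [:1, - x:]" for x :: 'a
    by (rule poly_eqI) (auto simp: coeff_reflect_poly coeff_pCons split: nat.splits)
  then show ?thesis
    by (simp only: reflect_poly_prod fps_of_poly_prod fps_of_poly_one_minus_monom)
qed

lemma poly_eq_sum_lessThan:
  fixes g :: "'a::comm_semiring_1 poly"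
  assumes "degree g < m"
  shows "poly g x = (\<Sum>i<m. coeff g i * x ^ i)"
proof -
  have "poly g x = (\<Sum>i\<le>degree g. coeff g i * x ^ i)" by (rule poly_altdef)
  also have "\<dots> = (\<Sum>i<m. coeff g i * x ^ i)"
    using assms by (intro sum.mono_neutral_left) (auto simp: coeff_eq_0)
  finally show ?thesis .
qed

context field_hom
begin

abbreviation eval :: "'b \<Rightarrow> 'a poly \<Rightarrow> 'b" where
  "eval x g \<equiv> poly (map_poly hom g) x"

lemma eval_add: "eval x (f + g) = eval x f + eval x g"
  and eval_diff: "eval x (f - g) = eval x f - eval x g"
  and eval_mult: "eval x (f * g) = eval x f * eval x g"
proof -
  interpret mp: map_poly_comm_ring_hom hom ..
  show "eval x (f + g) = eval x f + eval x g" "eval x (f - g) = eval x f - eval x g"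
    "eval x (f * g) = eval x f * eval x g"
    by (simp_all add: mp.hom_add mp.hom_minus mp.hom_mult)
qed

lemma eval_eq_sum:
  assumes "degree g < m"
  shows "eval x g = (\<Sum>i<m. hom (coeff g i) * x ^ i)"
proof -
  have "degree (map_poly hom g) < m" using assms degree_map_poly_le[of hom g] by simp
  then show ?thesis by (simp add: poly_eq_sum_lessThan coeff_map_poly)
qed

lemma eval_const: "eval x [:c:] = hom c"
  using eval_eq_sum[of "[:c:]" 1 x] by simp

lemma eval_X: "eval x [:0, 1:] = x"
  using eval_eq_sum[of "[:0, 1:]" 2 x] by (simp add: numeral_2_eq_2)

lemma sum_eq_eval: "(\<Sum>i<m. hom (b i) * x ^ i) = eval x (\<Sum>i<m. monom (b i) i)"
proof (cases "m = 0")
  case False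
  have coeff: "coeff (\<Sum>i<m. monom (b i) i) i = (if i < m then b i else 0)" for i
    by (simp add: coeff_sum)
  have "degree (\<Sum>i<m. monom (b i) i) \<le> m - 1" by (rule degree_le) (auto simp: coeff)
  then have "degree (\<Sum>i<m. monom (b i) i) < m" using False by simp
  then show ?thesis by (simp add: eval_eq_sum coeff)
qed simp

lemma separable_poly_map_poly:
  assumes "separable_poly f"
  shows "separable_poly (map_poly hom f)"
proof -
  interpret mp: map_poly_comm_ring_hom hom ..
  obtain r s where "r * f + s * pderiv f = 1"
    using coprime_poly_bezout assms unfolding separable_poly_def by blast
  then have "map_poly hom r * map_poly hom f + map_poly hom s * pderiv (map_poly hom f) = 1"
    by (metis mp.hom_add mp.hom_mult mp.hom_one map_poly_pderiv)
  then have "d dvd 1" if "d dvd map_poly hom f" "d dvd pderiv (map_poly hom f)" for d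
    using that by (metis dvd_add dvd_mult)
  then show ?thesis unfolding separable_poly_def by (intro coprimeI) auto
qed

lemma field_hom_comp:
  assumes "field_hom h"
  shows "field_hom (h \<circ> hom)"
proof -
  interpret h: field_hom h by (rule assms)
  show ?thesis by unfold_locales (simp_all add: hom_add hom_mult h.hom_add h.hom_mult)
qed

lemma vector_space_hom: "vector_space (\<lambda>c x. hom c * x)"
  by (simp add: vector_space_def module_def hom_add hom_mult distrib_left distrib_right mult.assoc)

end

locale algebraic_element = field_hom \<iota>
  for \<iota> :: "'k::field \<Rightarrow> 'l::field" +
  fixes x :: 'l
  assumes algebraic: "\<exists>g. g \<noteq> 0 \<and> eval x g = 0"
begin

definition minimal_annihilator :: "'k poly \<Rightarrow> bool" where
  "minimal_annihilator f \<longleftrightarrow> lead_coeff f = 1 \<and> eval x f = 0 \<and>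
     (\<forall>g. g \<noteq> 0 \<and> eval x g = 0 \<longrightarrow> degree f \<le> degree g)"

lemma exists_minimal_annihilator: "\<exists>f. minimal_annihilator f"
proof -
  obtain g where "g \<noteq> 0 \<and> eval x g = 0" using algebraic by blast
  then obtain f where f: "f \<noteq> 0 \<and> eval x f = 0"
    "\<forall>g. g \<noteq> 0 \<and> eval x g = 0 \<longrightarrow> degree f \<le> degree g"
    using ex_has_least_nat[of "\<lambda>g. g \<noteq> 0 \<and> eval x g = 0" g degree] by blast
  define f' where "f' = [:inverse (lead_coeff f):] * f"
  have "eval x f' = 0" using f(1) by (simp only: f'_def eval_mult) simp
  moreover have "lead_coeff f' = 1" "degree f' = degree f" using f(1) by (simp_all add: f'_def)
  ultimately show ?thesis using f(2) unfolding minimal_annihilator_def by metis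
qed

lemma minimal_annihilator_unique:
  assumes minimal: "minimal_annihilator f" "minimal_annihilator f'"
  shows "f = f'"
proof (rule ccontr)
  assume neq: "f \<noteq> f'"
  have monic: "lead_coeff f = 1" "lead_coeff f' = 1" using minimal by (auto simp: minimal_annihilator_def)
  then have "f \<noteq> 0" "f' \<noteq> 0" by auto
  then have deg: "degree f' = degree f" using minimal by (meson antisym minimal_annihilator_def)
  have "eval x (f - f') = 0" using minimal by (simp add: eval_diff minimal_annihilator_def)
  then have "degree f \<le> degree (f - f')" using minimal(1) neq by (simp add: minimal_annihilator_def)
  moreover have "degree (f - f') \<le> degree f" using deg by (intro degree_diff_le) auto
  ultimately have "degree (f - f') = degree f" by simp
  then have "lead_coeff (f - f') = coeff f (degree f) - coeff f' (degree f')" by (simp add: deg)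
  then have "lead_coeff (f - f') = 0" by (simp only: monic) simp
  then show False using neq by (simp only: leading_coeff_0_iff) simp
qed

lemma minimal_annihilator_min_poly: "minimal_annihilator (min_poly \<iota> x)"
  unfolding min_poly_def minimal_annihilator_def[symmetric]
  by (rule theI') (use exists_minimal_annihilator minimal_annihilator_unique in blast)

lemma min_poly_monic: "lead_coeff (min_poly \<iota> x) = 1"
  and eval_min_poly [simp]: "eval x (min_poly \<iota> x) = 0"
  and min_poly_degree_le: "g \<noteq> 0 \<Longrightarrow> eval x g = 0 \<Longrightarrow> degree (min_poly \<iota> x) \<le> degree g"
  using minimal_annihilator_min_poly unfolding minimal_annihilator_def by blast+

lemma min_poly_nonzero: "min_poly \<iota> x \<noteq> 0"
  using min_poly_monic by auto

lemma eval_eq_0_iff: "eval x g = 0 \<longleftrightarrow> min_poly \<iota> x dvd g"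
proof
  assume "min_poly \<iota> x dvd g"
  then show "eval x g = 0" by (auto simp: eval_mult)
next
  assume annihilates: "eval x g = 0"
  define r where "r = g mod min_poly \<iota> x"
  have "g = min_poly \<iota> x * (g div min_poly \<iota> x) + r" by (simp add: r_def)
  then have "eval x g = eval x (min_poly \<iota> x) * eval x (g div min_poly \<iota> x) + eval x r"
    by (metis eval_add eval_mult)
  then have "eval x r = 0" using annihilates by simp
  then have "r = 0"
    using min_poly_degree_le[of r] degree_mod_less[OF min_poly_nonzero, of g]
    by (fastforce simp: r_def)
  then show "min_poly \<iota> x dvd g" by (simp add: r_def dvd_eq_mod_eq_0)
qed

end

locale simple_extension = algebraic_element \<iota> x + k: field_hom \<kappa>
  for \<iota> :: "'k::field \<Rightarrow> 'l::field" and x :: 'l and \<kappa> :: "'l \<Rightarrow> 's::field" +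
  assumes generated: "\<exists>g. eval x g = \<alpha>"
begin

definition base_emb :: "'k \<Rightarrow> 's" where
  "base_emb = \<kappa> \<circ> \<iota>"

sublocale base: field_hom base_emb
  unfolding base_emb_def by (rule field_hom_comp[OF k.field_hom_axioms])

definition conj_roots :: "'s set" where
  "conj_roots = {y. base.eval y (min_poly \<iota> x) = 0}"

lemma embedding_hom: "\<sigma> \<in> embeddings \<iota> \<kappa> \<Longrightarrow> field_hom \<sigma>"
  by (simp add: embeddings_def)

lemma embedding_base: "\<sigma> \<in> embeddings \<iota> \<kappa> \<Longrightarrow> \<sigma> (\<iota> c) = base_emb c"
  by (auto simp: embeddings_def base_emb_def fun_eq_iff)

lemma embedding_eval:
  assumes "\<sigma> \<in> embeddings \<iota> \<kappa>"
  shows "\<sigma> (eval x g) = base.eval (\<sigma> x) g"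
proof -
  interpret s: field_hom \<sigma> by (rule embedding_hom[OF assms])
  have "map_poly \<sigma> (map_poly \<iota> g) = map_poly base_emb g"
    using embedding_base[OF assms] by (intro poly_eqI) (simp add: coeff_map_poly)
  then show ?thesis by (metis s.poly_map_poly)
qed

lemma kappa_in_embeddings: "\<kappa> \<in> embeddings \<iota> \<kappa>"
  by (simp add: embeddings_def k.field_hom_axioms)

lemma exists_embedding:
  assumes conj_root: "y \<in> conj_roots"
  shows "\<exists>\<sigma>\<in>embeddings \<iota> \<kappa>. \<sigma> x = y"
proof -
  define \<sigma> where "\<sigma> = (\<lambda>\<alpha>. base.eval y (SOME g. eval x g = \<alpha>))"
  have sigma_eval: "\<sigma> (eval x g) = base.eval y g" for g
  proof -
    define g' where "g' = (SOME g'. eval x g' = eval x g)"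
    have "eval x g' = eval x g" unfolding g'_def by (rule someI[of _ g]) simp
    then have "min_poly \<iota> x dvd g' - g" by (simp add: eval_eq_0_iff[symmetric] eval_diff)
    then obtain q where "g' - g = min_poly \<iota> x * q" by blast
    then have "base.eval y g' - base.eval y g = base.eval y (min_poly \<iota> x) * base.eval y q"
      by (metis base.eval_diff base.eval_mult)
    then show ?thesis using conj_root by (simp add: \<sigma>_def g'_def conj_roots_def)
  qed
  have sigma_base: "\<sigma> (\<iota> c) = base_emb c" for c
    using sigma_eval[of "[:c:]"] by (simp only: eval_const base.eval_const)
  have "field_hom \<sigma>"
  proof
    show "\<sigma> 0 = 0" using sigma_base[of 0] by simp
    show "\<sigma> 1 = 1" using sigma_base[of 1] by simp
    fix \<alpha> \<beta>
    obtain g h where as_eval: "\<alpha> = eval x g" "\<beta> = eval x h" using generated by metis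
    show "\<sigma> (\<alpha> + \<beta>) = \<sigma> \<alpha> + \<sigma> \<beta>"
      unfolding as_eval eval_add[symmetric] sigma_eval by (rule base.eval_add)
    show "\<sigma> (\<alpha> * \<beta>) = \<sigma> \<alpha> * \<sigma> \<beta>"
      unfolding as_eval eval_mult[symmetric] sigma_eval by (rule base.eval_mult)
  qed
  then have "\<sigma> \<in> embeddings \<iota> \<kappa>"
    using sigma_base by (simp add: embeddings_def fun_eq_iff base_emb_def)
  moreover have "\<sigma> x = y"
    using sigma_eval[of "[:0, 1:]"] by (simp only: eval_X base.eval_X)
  ultimately show ?thesis by blast
qed

lemma bij_betw_embeddings_conj_roots: "bij_betw (\<lambda>\<sigma>. \<sigma> x) (embeddings \<iota> \<kappa>) conj_roots"
  unfolding bij_betw_def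
proof
  show "inj_on (\<lambda>\<sigma>. \<sigma> x) (embeddings \<iota> \<kappa>)"
  proof (rule inj_onI, rule ext)
    fix \<sigma> \<sigma>' \<alpha> assume "\<sigma> \<in> embeddings \<iota> \<kappa>" "\<sigma>' \<in> embeddings \<iota> \<kappa>" "\<sigma> x = \<sigma>' x"
    then show "\<sigma> \<alpha> = \<sigma>' \<alpha>" using generated[of \<alpha>] embedding_eval by metis
  qed
  have "\<sigma> x \<in> conj_roots" if "\<sigma> \<in> embeddings \<iota> \<kappa>" for \<sigma>
  proof -
    interpret s: field_hom \<sigma> by (rule embedding_hom[OF that])
    show ?thesis using embedding_eval[OF that, of "min_poly \<iota> x"] by (simp add: conj_roots_def)
  qed
  then show "(\<lambda>\<sigma>. \<sigma> x) ` embeddings \<iota> \<kappa> = conj_roots" using exists_embedding by blast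
qed

lemma separable_min_poly:
  assumes "separable_closure (\<kappa> \<circ> \<iota>)"
  shows "separable_poly (min_poly \<iota> x)"
proof -
  obtain g where g: "separable_poly g" "base.eval (\<kappa> x) g = 0"
    using assms unfolding separable_closure_def base_emb_def by blast
  then have "\<kappa> (eval x g) = 0" using embedding_eval[OF kappa_in_embeddings] by simp
  then show ?thesis using separable_poly_dvd g(1) by (simp add: eval_eq_0_iff)
qed

lemma conj_roots_split:
  assumes "separable_closure (\<kappa> \<circ> \<iota>)"
  shows "finite conj_roots \<and> map_poly base_emb (min_poly \<iota> x) = (\<Prod>y\<in>conj_roots. [:- y, 1:])"
proof -
  have "separably_closed TYPE('s)"
    using assms by (simp add: separable_closure_def separably_closed_def)
  moreover have "separable_poly (map_poly base_emb (min_poly \<iota> x))"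
    by (intro base.separable_poly_map_poly separable_min_poly assms)
  moreover have "lead_coeff (map_poly base_emb (min_poly \<iota> x)) = 1"
    using min_poly_monic by (simp add: coeff_map_poly)
  ultimately obtain R where R: "finite R" "map_poly base_emb (min_poly \<iota> x) = (\<Prod>y\<in>R. [:- y, 1:])"
    using separable_poly_splits by blast
  then have "conj_roots = R" by (auto simp: conj_roots_def poly_prod)
  then show ?thesis using R by simp
qed

lemma finite_embeddings: "separable_closure (\<kappa> \<circ> \<iota>) \<Longrightarrow> finite (embeddings \<iota> \<kappa>)"
  using bij_betw_embeddings_conj_roots conj_roots_split bij_betw_finite by blast

lemma prod_embeddings_one_minus_monom:
  assumes "separable_closure (\<kappa> \<circ> \<iota>)"
  shows "(\<Prod>\<sigma>\<in>embeddings \<iota> \<kappa>. one_minus_monom (\<sigma> x) 1) =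
    fps_of_poly (reflect_poly (map_poly base_emb (min_poly \<iota> x)))"
proof -
  have "(\<Prod>\<sigma>\<in>embeddings \<iota> \<kappa>. one_minus_monom (\<sigma> x) 1) = (\<Prod>y\<in>conj_roots. one_minus_monom y 1)"
    by (rule prod.reindex_bij_betw[OF bij_betw_embeddings_conj_roots])
  then show ?thesis
    using conj_roots_split[OF assms] by (simp only: prod_one_minus_monom_reflect)
qed

end

section \<open>Discretely valued fields\<close>

lemma discrete_valuation_range:
  "discrete_valuation v \<Longrightarrow> v ` (UNIV - {0}) = range (\<lambda>m::int. ereal (of_int m))"
  by (simp add: discrete_valuation_def)

lemma discrete_valuation_int:
  assumes "discrete_valuation v" "x \<noteq> 0"
  shows "\<exists>z::int. v x = ereal (of_int z)"
  using imageI[of x "UNIV - {0}" v] assms(2)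
  unfolding discrete_valuation_range[OF assms(1)] by auto

lemma discrete_valuation_surj:
  assumes "discrete_valuation v"
  shows "\<exists>x. x \<noteq> 0 \<and> v x = ereal (of_int z)"
proof -
  have "ereal (of_int z) \<in> v ` (UNIV - {0})"
    unfolding discrete_valuation_range[OF assms] by blast
  then show ?thesis by auto
qed

lemma discrete_valuation_ereal_valuation:
  assumes discrete: "discrete_valuation v"
  shows "ereal_valuation v"
proof
  show infinity: "v x = \<infinity> \<longleftrightarrow> x = 0" for x using discrete by (simp add: discrete_valuation_def)
  show "v x \<noteq> - \<infinity>" for x
    using discrete_valuation_int[OF discrete, of x] infinity[of x] by (cases "x = 0") auto
qed (use discrete in \<open>simp_all add: discrete_valuation_def\<close>)

context ereal_valuation
begin

lemma mem_max_ideal_power_0: "x \<in> max_ideal_power v 0 \<longleftrightarrow> 0 \<le> v x"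
  by (simp add: max_ideal_power_def zero_ereal_def)

lemma mem_max_ideal_power_1: "x \<in> max_ideal_power v 1 \<longleftrightarrow> 1 \<le> v x"
  by (simp add: max_ideal_power_def one_ereal_def)

lemma valuation_ring_cring: "cring (valuation_ring v)"
proof (rule cringI)
  show "abelian_group (valuation_ring v)"
  proof (rule abelian_groupI)
    fix x assume "x \<in> carrier (valuation_ring v)"
    then show "\<exists>y\<in>carrier (valuation_ring v). y \<oplus>\<^bsub>valuation_ring v\<^esub> x = \<zero>\<^bsub>valuation_ring v\<^esub>"
      by (intro bexI[of _ "- x"]) (auto simp: valuation_ring_def mem_max_ideal_power_0)
  qed (auto simp: valuation_ring_def mem_max_ideal_power_0 add_ac intro: val_add_ge)
  show "Group.comm_monoid (valuation_ring v)"
    by (rule comm_monoidI) (auto simp: valuation_ring_def mem_max_ideal_power_0 val_mult mult_ac)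
qed (auto simp: valuation_ring_def distrib_right)

lemma max_ideal_power_1_ideal: "ideal (max_ideal_power v 1) (valuation_ring v)"
proof -
  let ?V = "valuation_ring v" and ?M = "max_ideal_power v 1"
  interpret cring ?V by (rule valuation_ring_cring)
  have "0 \<le> v x" if "1 \<le> v x" for x using that by (rule order_trans[rotated]) simp
  then have subset: "?M \<subseteq> carrier ?V"
    by (auto simp: valuation_ring_def mem_max_ideal_power_0 mem_max_ideal_power_1)
  have minus: "\<ominus>\<^bsub>?V\<^esub> x = - x" if "x \<in> carrier ?V" for x
    using that by (intro minus_equality) (auto simp: valuation_ring_def mem_max_ideal_power_0)
  have "subgroup ?M (add_monoid ?V)"
  proof (rule subgroup.intro)
    fix x assume x: "x \<in> ?M"
    then have "\<ominus>\<^bsub>?V\<^esub> x \<in> ?M" using subset by (auto simp: minus mem_max_ideal_power_1)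
    then show "inv\<^bsub>add_monoid ?V\<^esub> x \<in> ?M" by (simp add: a_inv_def)
  qed (use subset in \<open>auto simp: valuation_ring_def mem_max_ideal_power_1 intro: val_add_ge\<close>)
  moreover have "1 \<le> v (x * y)" if "1 \<le> v x" "0 \<le> v y" for x y
    using add_mono[OF that] by (simp add: val_mult)
  ultimately show ?thesis
    by (intro idealI ring_axioms)
      (auto simp: valuation_ring_def mem_max_ideal_power_0 mem_max_ideal_power_1 mult.commute)
qed

lemma val_residue_char_pos:
  assumes "perfect_of_char (residue_field v) p"
  shows "v (of_nat p) > 0"
proof -
  let ?V = "valuation_ring v" and ?M = "max_ideal_power v 1"
  have zero: "\<zero>\<^bsub>residue_field v\<^esub> = ?M" by (simp add: residue_field_def FactRing_def)
  interpret ideal ?M ?V by (rule max_ideal_power_1_ideal)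
  interpret quot: ring_hom_ring ?V "residue_field v" "\<lambda>x. ?M +>\<^bsub>?V\<^esub> x"
    unfolding residue_field_def by (rule rcos_ring_hom_ring)
  have of_nat: "[k] \<cdot>\<^bsub>?V\<^esub> \<one>\<^bsub>?V\<^esub> = of_nat k" for k :: nat
  proof (induction k)
    case 0
    then show ?case by (simp add: valuation_ring_def add_pow_def nat_pow_def)
  next
    case (Suc k)
    have "[Suc k] \<cdot>\<^bsub>?V\<^esub> \<one>\<^bsub>?V\<^esub> = [k] \<cdot>\<^bsub>?V\<^esub> \<one>\<^bsub>?V\<^esub> \<oplus>\<^bsub>?V\<^esub> \<one>\<^bsub>?V\<^esub>"
      by (simp add: add_pow_def nat_pow_def)
    then show ?case by (simp add: Suc) (simp add: valuation_ring_def)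
  qed
  have "?M +>\<^bsub>?V\<^esub> ([p] \<cdot>\<^bsub>?V\<^esub> \<one>\<^bsub>?V\<^esub>) = [p] \<cdot>\<^bsub>residue_field v\<^esub> \<one>\<^bsub>residue_field v\<^esub>"
    using group_hom.hom_nat_pow[OF quot.a_group_hom, of "\<one>\<^bsub>?V\<^esub>" p] quot.hom_one
    by (simp add: add_pow_def)
  also have "\<dots> = \<zero>\<^bsub>residue_field v\<^esub>" using assms by (simp only: perfect_of_char_def)
  also have "\<dots> = ?M" by (rule zero)
  finally have "?M +>\<^bsub>?V\<^esub> of_nat p = ?M" by (simp only: of_nat)
  moreover have "of_nat p \<in> carrier ?V"
    using val_of_nat_nonneg by (simp add: valuation_ring_def mem_max_ideal_power_0)
  ultimately have "1 \<le> v (of_nat p)"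
    using rcos_const_imp_mem by (simp only: mem_max_ideal_power_1[symmetric])
  then show ?thesis by (rule less_le_trans[rotated]) simp
qed

lemma valuation_ring_span_eq_max_ideal_power:
  assumes ge: "\<And>x. x \<in> S \<Longrightarrow> ereal (of_int m) \<le> v x"
    and attained: "c \<in> S" "v c = ereal (of_int m)"
  shows "valuation_ring_span v S = max_ideal_power v m"
proof (rule subset_antisym; rule subsetI)
  fix y assume "y \<in> valuation_ring_span v S"
  then obtain l :: nat and a s where y: "y = (\<Sum>i<l. a i * s i)"
    and coeffs: "\<forall>i<l. a i \<in> max_ideal_power v 0 \<and> s i \<in> S"
    unfolding valuation_ring_span_def by blast
  have "ereal (of_int m) \<le> v (a i * s i)" if "i \<in> {..<l}" for i
  proof -
    have "0 + ereal (of_int m) \<le> v (a i) + v (s i)"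
      using coeffs that ge by (intro add_mono) (auto simp: mem_max_ideal_power_0)
    then show ?thesis by (simp add: val_mult)
  qed
  then have "ereal (of_int m) \<le> v y" unfolding y by (rule val_sum_ge)
  then show "y \<in> max_ideal_power v m" by (simp add: max_ideal_power_def)
next
  fix y assume "y \<in> max_ideal_power v m"
  then have y: "ereal (of_int m) \<le> v y" by (simp add: max_ideal_power_def)
  have "c \<noteq> 0" using attained(2) by auto
  then have "v y = v (y / c) + ereal (of_int m)" using val_mult[of "y / c" c] attained(2) by simp
  then have "y / c \<in> max_ideal_power v 0"
    using y by (cases "v (y / c)") (auto simp: mem_max_ideal_power_0)
  moreover have "y = (\<Sum>i<(1::nat). (y / c) * c)" using \<open>c \<noteq> 0\<close> by simp
  ultimately show "y \<in> valuation_ring_span v S"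
    unfolding valuation_ring_span_def using attained(1)
    by (intro CollectI exI[of _ "1::nat"] exI[of _ "\<lambda>_. y / c"] exI[of _ "\<lambda>_. c"]) auto
qed

end

section \<open>Totally ramified extensions\<close>

locale totally_ramified_ext = field_hom \<iota> + k: field_hom \<kappa>
  for \<iota> :: "'k::field \<Rightarrow> 'l::field" and \<kappa> :: "'l \<Rightarrow> 's::field" +
  fixes vK :: "'k \<Rightarrow> ereal" and vL :: "'l \<Rightarrow> ereal" and \<pi> :: 'l and p n u \<nu> :: nat
  assumes discrete_vK: "discrete_valuation vK"
    and closure: "separable_closure (\<kappa> \<circ> \<iota>)"
    and ext_degree: "ext_degree \<iota> = n" and n_eq: "n = u * p ^ \<nu>" and not_p_dvd_u: "\<not> p dvd u"
    and ramified: "totally_ramified \<iota> vK vL"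
    and uniformizer: "vL \<pi> = 1"
    and prime_p: "prime p" and vK_p_pos: "vK (of_nat p) > 0"
begin

lemma discrete_vL: "discrete_valuation vL"
  using ramified by (simp add: totally_ramified_def)

sublocale vK: ereal_valuation vK
  by (rule discrete_valuation_ereal_valuation[OF discrete_vK])

sublocale vL: ereal_valuation vL
  by (rule discrete_valuation_ereal_valuation[OF discrete_vL])

definition base_val :: "'k \<Rightarrow> ereal" where
  "base_val c = vL (\<iota> c)"

lemma base_val_eq: "base_val c = ereal (real n) * vK c"
  using ramified ext_degree by (simp add: totally_ramified_def base_val_def)

sublocale base_val: ereal_valuation base_val
  by unfold_locales
    (simp_all add: base_val_def hom_mult hom_add vL.val_eq_PInf_iff vL.val_neq_MInf
      vL.val_mult vL.val_add)

lemma n_pos: "n > 0"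
proof -
  have "u \<noteq> 0" using not_p_dvd_u by (metis dvd_0_right)
  then show ?thesis using n_eq prime_gt_0_nat[OF prime_p] by simp
qed

lemma base_val_integral:
  "c \<noteq> 0 \<Longrightarrow> \<exists>z::int. vK c = ereal (of_int z) \<and> base_val c = ereal (real n * of_int z)"
  using discrete_valuation_int[OF discrete_vK, of c] by (auto simp: base_val_eq)

lemma uniformizer_nonzero: "\<pi> \<noteq> 0"
  using uniformizer by auto

lemma val_uniformizer_power: "vL (\<pi> ^ i) = ereal (real i)"
  by (simp add: vL.val_power uniformizer)

lemma val_monomial: "vL (\<iota> c * \<pi> ^ i) = base_val c + ereal (real i)"
  by (simp add: vL.val_mult base_val_def val_uniformizer_power)

lemma val_monomial_integral:
  assumes "c \<noteq> 0"
  shows "\<exists>z::int. vL (\<iota> c * \<pi> ^ i) = ereal (of_int (int n * z + int i))"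
  using base_val_integral[OF assms] by (auto simp: val_monomial)

lemma val_monomial_distinct:
  assumes in_interval: "i \<in> {m..<m + n}" "j \<in> {m..<m + n}"
    and same_val: "vL (\<iota> b * \<pi> ^ i) = vL (\<iota> c * \<pi> ^ j)" and nonzero: "\<iota> b * \<pi> ^ i \<noteq> 0"
  shows "i = j"
proof -
  have "b \<noteq> 0" using nonzero by auto
  moreover have "\<iota> c * \<pi> ^ j \<noteq> 0" using same_val nonzero vL.val_eq_PInf_iff by metis
  then have "c \<noteq> 0" by auto
  ultimately obtain y z where vals: "vL (\<iota> b * \<pi> ^ i) = ereal (of_int (int n * y + int i))"
    "vL (\<iota> c * \<pi> ^ j) = ereal (of_int (int n * z + int j))"
    using val_monomial_integral by meson
  have "int n * y + int i = int n * z + int j"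
    using same_val unfolding vals by (simp only: ereal.inject of_int_eq_iff)
  then have "int i - int j = int n * (z - y)" by (simp add: algebra_simps)
  then have "[int i = int j] (mod int n)" by (simp add: cong_iff_dvd_diff)
  then show ?thesis using in_interval by (rule cong_same_interval_imp_eq)
qed

definition power_combination :: "nat \<Rightarrow> (nat \<Rightarrow> 'k) \<Rightarrow> 'l" where
  "power_combination m b = (\<Sum>i\<in>{m..<m + n}. \<iota> (b i) * \<pi> ^ i)"

lemma val_power_combination:
  obtains i where "i \<in> {m..<m + n}" "vL (power_combination m b) = vL (\<iota> (b i) * \<pi> ^ i)"
    "\<And>j. j \<in> {m..<m + n} \<Longrightarrow> vL (\<iota> (b i) * \<pi> ^ i) \<le> vL (\<iota> (b j) * \<pi> ^ j)"
proof (rule vL.val_sum_distinct[of "{m..<m + n}" "\<lambda>i. \<iota> (b i) * \<pi> ^ i"])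
  show "{m..<m + n} \<noteq> {}" using n_pos by simp
  show "i = j" if "i \<in> {m..<m + n}" "j \<in> {m..<m + n}"
    "vL (\<iota> (b i) * \<pi> ^ i) = vL (\<iota> (b j) * \<pi> ^ j)" "\<iota> (b i) * \<pi> ^ i \<noteq> 0" for i j
    using val_monomial_distinct that by blast
qed (use that in \<open>auto simp: power_combination_def\<close>)

lemma val_power_combination_le:
  "j \<in> {m..<m + n} \<Longrightarrow> vL (power_combination m b) \<le> vL (\<iota> (b j) * \<pi> ^ j)"
  by (metis val_power_combination[where m = m and b = b])

lemma power_combination_eq_0:
  assumes "power_combination m b = 0" "j \<in> {m..<m + n}"
  shows "b j = 0"
proof -
  have "vL (\<iota> (b j) * \<pi> ^ j) = \<infinity>" using val_power_combination_le[OF assms(2), of b] assms(1) by simp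
  then show ?thesis using uniformizer_nonzero by (simp add: vL.val_eq_PInf_iff)
qed

lemma exists_power_combination: "\<exists>b. \<alpha> = power_combination m b"
proof -
  interpret VS: vector_space "\<lambda>c x. \<iota> c * x" by (rule vector_space_hom)
  have dim: "VS.dim (UNIV :: 'l set) = n" using ext_degree by (simp add: ext_degree_def)
  obtain B where B: "VS.independent B" "UNIV \<subseteq> VS.span B" "card B = VS.dim (UNIV :: 'l set)"
    using VS.basis_exists[of UNIV] by metis
  have "finite B" using B(3) dim n_pos by (metis card_ge_0_finite)
  interpret FD: finite_dimensional_vector_space "\<lambda>c x. \<iota> c * x" B
    by unfold_locales (use B \<open>finite B\<close> in auto)
  define S where "S = (\<lambda>i. \<pi> ^ i) ` {m..<m + n}"
  have inj: "inj_on (\<lambda>i. \<pi> ^ i) {m..<m + n}"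
    by (rule inj_onI) (metis ereal.inject of_nat_eq_iff val_uniformizer_power)
  have sum_S: "(\<Sum>x\<in>S. \<iota> (c x) * x) = power_combination m (\<lambda>i. c (\<pi> ^ i))" for c
    unfolding S_def power_combination_def by (simp add: sum.reindex[OF inj])
  have finite_S: "finite S" by (simp add: S_def)
  have "VS.independent S"
  proof
    assume "VS.dependent S"
    then obtain c x where dependence: "x \<in> S" "c x \<noteq> 0" "(\<Sum>x\<in>S. \<iota> (c x) * x) = 0"
      unfolding VS.dependent_finite[OF finite_S] by blast
    then obtain i where "i \<in> {m..<m + n}" "x = \<pi> ^ i" by (auto simp: S_def)
    then show False using power_combination_eq_0[of m "\<lambda>i. c (\<pi> ^ i)" i] dependence sum_S by simp
  qed
  moreover have "card S = n" by (simp add: S_def card_image[OF inj])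
  ultimately have "UNIV \<subseteq> VS.span S"
    using FD.card_ge_dim_independent[of S UNIV] dim by simp
  then have "\<alpha> \<in> range (\<lambda>c. \<Sum>x\<in>S. \<iota> (c x) * x)" using VS.span_finite[OF finite_S] by auto
  then show ?thesis using sum_S by auto
qed

lemma power_combination_0_eq_eval: "power_combination 0 b = eval \<pi> (\<Sum>i<n. monom (b i) i)"
  using sum_eq_eval[of b \<pi> n] by (simp add: power_combination_def lessThan_atLeast0)

lemma degree_annihilator_ge:
  assumes "eval \<pi> g = 0" "g \<noteq> 0"
  shows "n \<le> degree g"
proof (rule ccontr)
  assume "\<not> n \<le> degree g"
  then have deg: "degree g < n" by simp
  have "power_combination 0 (coeff g) = 0"
    using assms(1) eval_eq_sum[OF deg, of \<pi>]
    by (simp add: power_combination_def lessThan_atLeast0)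
  then have "coeff g i = 0" if "i < n" for i using power_combination_eq_0[of 0 _ i] that by simp
  then show False using deg assms by (metis leading_coeff_0_iff)
qed

lemma exists_monic_annihilator: "\<exists>g. coeff g n = 1 \<and> degree g = n \<and> eval \<pi> g = 0"
proof -
  obtain b where b: "\<pi> ^ n = power_combination 0 b" using exists_power_combination by blast
  define r where "r = (\<Sum>i<n. monom (b i) i)"
  have coeff: "coeff r i = (if i < n then b i else 0)" for i by (simp add: r_def coeff_sum)
  have "degree (monom 1 n - r) = n"
    by (rule antisym) (auto intro!: degree_le le_degree simp: coeff)
  moreover have "eval \<pi> (monom 1 n - r) = 0"
    using b by (simp add: eval_diff power_combination_0_eq_eval r_def map_poly_monom poly_monom)
  moreover have "coeff (monom 1 n - r) n = 1" by (simp add: coeff)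
  ultimately show ?thesis by blast
qed

sublocale simple_extension \<iota> \<pi> \<kappa>
proof
  show "\<exists>g. g \<noteq> 0 \<and> eval \<pi> g = 0" using exists_monic_annihilator by (metis coeff_0 zero_neq_one)
  show "\<exists>g. eval \<pi> g = \<alpha>" for \<alpha>
    using exists_power_combination[of \<alpha> 0] power_combination_0_eq_eval by metis
qed

lemma degree_min_poly: "degree (min_poly \<iota> \<pi>) = n"
proof (rule antisym)
  show "degree (min_poly \<iota> \<pi>) \<le> n"
    using exists_monic_annihilator min_poly_degree_le by (metis coeff_0 zero_neq_one)
  show "n \<le> degree (min_poly \<iota> \<pi>)" by (intro degree_annihilator_ge min_poly_nonzero) simp
qed

definition eis_coeff :: "nat \<Rightarrow> 'k" where
  "eis_coeff h = (if h \<le> n then coeff (min_poly \<iota> \<pi>) (n - h) else 0)"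

lemma uniformizer_power_n:
  "\<pi> ^ n = power_combination 0 (\<lambda>i. - coeff (min_poly \<iota> \<pi>) i)"
proof -
  have "eval \<pi> (min_poly \<iota> \<pi>) = (\<Sum>i<Suc n. \<iota> (coeff (min_poly \<iota> \<pi>) i) * \<pi> ^ i)"
    using degree_min_poly by (intro eval_eq_sum) simp
  moreover have "coeff (min_poly \<iota> \<pi>) n = 1" using min_poly_monic degree_min_poly by simp
  ultimately have "\<pi> ^ n = - (\<Sum>i<n. \<iota> (coeff (min_poly \<iota> \<pi>) i) * \<pi> ^ i)"
    by (simp add: eq_neg_iff_add_eq_0 add.commute)
  then show ?thesis
    by (simp add: power_combination_def hom_uminus sum_negf lessThan_atLeast0)
qed

lemma val_min_poly_coeff_ge:
  assumes "i < n"
  shows "ereal (real n) \<le> base_val (coeff (min_poly \<iota> \<pi>) i) + ereal (real i)"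
  using val_power_combination_le[of i 0 "\<lambda>i. - coeff (min_poly \<iota> \<pi>) i"] assms
  by (simp add: uniformizer_power_n[symmetric] val_uniformizer_power val_monomial)

lemma val_min_poly_coeff_0: "base_val (coeff (min_poly \<iota> \<pi>) 0) = ereal (real n)"
proof -
  let ?b = "\<lambda>i. - coeff (min_poly \<iota> \<pi>) i"
  obtain i where i: "i \<in> {0..<0 + n}" "ereal (real n) = vL (\<iota> (?b i) * \<pi> ^ i)"
    using val_power_combination[of 0 ?b] uniformizer_power_n val_uniformizer_power by metis
  then have "?b i \<noteq> 0" by auto
  then obtain z where "ereal (real n) = ereal (of_int (int n * z + int i))"
    using val_monomial_integral i(2) by metis
  then have "real_of_int (int n) = real_of_int (int n * z + int i)" by simp
  then have "int i = int n * (1 - z)" by (simp only: of_int_eq_iff) (simp add: algebra_simps)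
  then have "int n dvd int i" by simp
  then have "i = 0" using i(1) by (auto dest: dvd_imp_le)
  then show ?thesis using i(2) by (simp add: base_val_def hom_uminus)
qed

lemma val_eis_coeff_gt:
  assumes h_range: "1 \<le> h" "h < n"
  shows "ereal (real h) < base_val (eis_coeff h)"
proof (cases "eis_coeff h = 0")
  case False
  then obtain z where z: "base_val (eis_coeff h) = ereal (real n * of_int z)"
    using base_val_integral by blast
  have "ereal (real n) \<le> base_val (coeff (min_poly \<iota> \<pi>) (n - h)) + ereal (real (n - h))"
    using h_range by (intro val_min_poly_coeff_ge) auto
  then have "real_of_int (int h) \<le> real_of_int (int n * z)"
    using z h_range by (simp add: eis_coeff_def)
  then have "int h \<le> int n * z" by (simp only: of_int_le_iff)
  moreover have "int h \<noteq> int n * z"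
  proof
    assume "int h = int n * z"
    then have "int n dvd int h" by simp
    then show False using h_range by (auto dest: dvd_imp_le)
  qed
  ultimately have "real_of_int (int h) < real_of_int (int n * z)" by (simp only: of_int_less_iff)
  then show ?thesis using z by simp
qed simp

sublocale es: eisenstein_series base_emb base_val p \<nu> n u eis_coeff
proof
  show "0 < base_val (of_nat p)"
    using vK_p_pos n_pos by (cases "vK (of_nat p)") (auto simp: base_val_eq)
  show "eis_coeff 0 = 1" using min_poly_monic degree_min_poly by (simp add: eis_coeff_def)
  show "base_val (eis_coeff n) = ereal (real n)"
    using val_min_poly_coeff_0 by (simp add: eis_coeff_def)
  show "\<exists>z::int. base_val c = ereal (real n * of_int z)" if "c \<noteq> 0" for c
    using base_val_integral[OF that] by blast
  show "eis_coeff h = 0" if "h > n" for h using that by (simp add: eis_coeff_def)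
qed (use n_eq not_p_dvd_u prime_p val_eis_coeff_gt in simp_all)

lemma prod_embeddings_eq_eis_series:
  "(\<Prod>\<sigma>\<in>embeddings \<iota> \<kappa>. one_minus_monom (\<sigma> \<pi>) 1) = es.eis_series"
proof -
  have "fps_of_poly (reflect_poly (map_poly base_emb (min_poly \<iota> \<pi>))) = es.eis_series"
    by (rule fps_ext)
      (auto simp: coeff_reflect_poly es.eis_series_def eis_coeff_def coeff_map_poly degree_min_poly)
  then show ?thesis by (simp only: prod_embeddings_one_minus_monom[OF closure])
qed

lemma prod_embeddings_power:
  assumes "witt_frobenius s \<Psi>"
  shows "(\<Prod>\<sigma>\<in>embeddings \<iota> \<kappa>. one_minus_monom (\<sigma> \<pi> ^ s) 1) = \<Psi> es.eis_series"
  using witt_frobenius.prod_linear[OF assms, of "\<lambda>\<sigma>. \<sigma> \<pi>" "embeddings \<iota> \<kappa>"]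
  by (simp only: prod_embeddings_eq_eis_series)

lemma exists_frobenius: "s \<ge> 1 \<Longrightarrow> \<exists>\<Psi> :: 's fps \<Rightarrow> 's fps. witt_frobenius s \<Psi>"
  using closure exists_witt_frobenius
  by (auto simp: separable_closure_def separably_closed_def)

definition embedding_norm :: "'l fps \<Rightarrow> 's fps" where
  "embedding_norm Q = (\<Prod>\<sigma>\<in>embeddings \<iota> \<kappa>. Abs_fps (\<lambda>k. \<sigma> (Q $ k)))"

lemma embedding_norm_mult: "embedding_norm (P * Q) = embedding_norm P * embedding_norm Q"
  unfolding embedding_norm_def prod.distrib[symmetric]
proof (rule prod.cong)
  fix \<sigma> assume "\<sigma> \<in> embeddings \<iota> \<kappa>"
  then interpret s: field_hom \<sigma> by (rule embedding_hom)
  show "Abs_fps (\<lambda>k. \<sigma> ((P * Q) $ k)) = Abs_fps (\<lambda>k. \<sigma> (P $ k)) * Abs_fps (\<lambda>k. \<sigma> (Q $ k))"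
    by (rule fps_ext) (simp add: fps_mult_nth s.hom_sum s.hom_mult)
qed simp

lemma embedding_norm_agree:
  "fps_agree m P Q \<Longrightarrow> fps_agree m (embedding_norm P) (embedding_norm Q)"
  unfolding embedding_norm_def by (rule fps_agree_prod) (simp add: fps_agree_def)

lemma embedding_norm_one_minus_monom:
  assumes "h \<ge> 1"
  shows "embedding_norm (one_minus_monom c h) = (\<Prod>\<sigma>\<in>embeddings \<iota> \<kappa>. one_minus_monom (\<sigma> c) h)"
  unfolding embedding_norm_def
proof (rule prod.cong)
  fix \<sigma> assume "\<sigma> \<in> embeddings \<iota> \<kappa>"
  then interpret s: field_hom \<sigma> by (rule embedding_hom)
  show "Abs_fps (\<lambda>k. \<sigma> (one_minus_monom c h $ k)) = one_minus_monom (\<sigma> c) h"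
    using assms by (intro fps_ext) (simp add: one_minus_monom_nth s.hom_uminus)
qed simp

lemma embedding_norm_monomial_nth:
  assumes frobenius: "witt_frobenius s \<Psi>" and h_ge_1: "h \<ge> 1"
  shows "embedding_norm (one_minus_monom (\<iota> c * \<pi> ^ s) h) $ l =
    (if h dvd l then base_emb c ^ (l div h) * \<Psi> es.eis_series $ (l div h) else 0)"
proof -
  have "\<sigma> (\<iota> c * \<pi> ^ s) = base_emb c * \<sigma> \<pi> ^ s" if "\<sigma> \<in> embeddings \<iota> \<kappa>" for \<sigma>
  proof -
    interpret s: field_hom \<sigma> by (rule embedding_hom[OF that])
    show ?thesis by (simp add: s.hom_mult s.hom_power embedding_base[OF that])
  qed
  then have "embedding_norm (one_minus_monom (\<iota> c * \<pi> ^ s) h) =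
      (\<Prod>\<sigma>\<in>embeddings \<iota> \<kappa>. one_minus_monom (base_emb c * \<sigma> \<pi> ^ s) h)"
    unfolding embedding_norm_one_minus_monom[OF h_ge_1] by (intro prod.cong) auto
  then show ?thesis
    by (simp only: prod_one_minus_monom_nth[OF h_ge_1] prod_one_minus_monom_scale_nth
        prod_embeddings_power[OF frobenius])
qed

lemma profile_bound_mult_le_val_power:
  assumes h_ge_1: "h \<ge> 1" and q_ge_1: "q \<ge> 1"
    and val_ge: "ereal (of_int r * real h) \<le> vL (\<iota> c * \<pi> ^ s)"
  shows "es.profile_bound r (es.insep_min {1..n}) (h * q) \<le>
    base_val (c ^ q) + es.profile_bound (int s) (es.insep_min {1..n}) q"
proof -
  have "ereal (real q) * ereal (of_int r * real h) \<le> ereal (real q) * (base_val c + ereal (real s))"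
    using val_ge by (intro ereal_mult_left_mono) (auto simp: val_monomial)
  also have "\<dots> = ereal (real q) * base_val c + ereal (real q) * ereal (real s)"
    by (rule ereal_distrib_left) auto
  finally have "ereal (of_int r * real (h * q)) \<le> base_val (c ^ q) + ereal (real s * real q)"
    by (simp add: base_val.val_power mult_ac)
  moreover have "es.insep_min {1..n} (es.trunc_mult (h * q)) \<le> es.insep_min {1..n} (es.trunc_mult q)"
    using h_ge_1 q_ge_1
    by (intro es.insep_profile_antimono[OF es.insep_profile_full] es.trunc_mult_dvd)
      (auto simp: Suc_le_eq)
  ultimately show ?thesis
    unfolding es.profile_bound_def using add_mono by (fastforce simp: add.assoc)
qed

lemma bounded_embedding_norm_monomial:
  assumes s_ge_1: "s \<ge> 1" and h_ge_1: "h \<ge> 1"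
    and val_ge: "ereal (of_int r * real h) \<le> vL (\<iota> c * \<pi> ^ s)"
  shows "es.bounded_series r (es.insep_min {1..n})
    (embedding_norm (one_minus_monom (\<iota> c * \<pi> ^ s) h))"
proof -
  let ?d = "es.insep_min {1..n}"
  obtain \<Psi> :: "'s fps \<Rightarrow> 's fps" where frobenius: "witt_frobenius s \<Psi>"
    using exists_frobenius[OF s_ge_1] by blast
  have bounded: "es.bounded_series (1 * int s) ?d (\<Psi> es.eis_series)"
    using es.insep_profile_full frobenius es.bounded_eis_series
    by (rule es.bounded_series_witt_frobenius)
  have "base_emb c ^ q * \<Psi> es.eis_series $ q \<in> es.fractional_ideal (es.profile_bound r ?d (h * q))"
    if q_ge_1: "q \<ge> 1" for q
  proof -
    have "base_emb c ^ q * \<Psi> es.eis_series $ q \<in>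
        es.fractional_ideal (base_val (c ^ q) + es.profile_bound (int s) ?d q)"
      using bounded q_ge_1
      by (intro es.fractional_ideal_mult)
        (auto simp: unit_series_def es.hom_in_fractional_ideal_iff base.hom_power[symmetric])
    then show ?thesis
      using profile_bound_mult_le_val_power[OF h_ge_1 q_ge_1 val_ge] es.fractional_ideal_antimono
      by blast
  qed
  then have "embedding_norm (one_minus_monom (\<iota> c * \<pi> ^ s) h) $ l \<in>
      es.fractional_ideal (es.profile_bound r ?d l)" if "l \<ge> 1" for l
    using that h_ge_1 by (auto simp: embedding_norm_monomial_nth[OF frobenius h_ge_1] Suc_le_eq)
  then show ?thesis
    using h_ge_1 by (simp add: unit_series_def embedding_norm_one_minus_monom fps_prod_nth_0)
qed

lemma graded_subring_max_ideal_power: "graded_subring (\<lambda>h. max_ideal_power vL (r * int h))"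
  unfolding graded_subring_def
proof (intro conjI allI impI ballI)
  fix a b :: nat and x y
  assume "x \<in> max_ideal_power vL (r * int a)" "y \<in> max_ideal_power vL (r * int b)"
  then have "ereal (of_int r * real a) + ereal (of_int r * real b) \<le> vL x + vL y"
    unfolding max_ideal_power_def by (intro add_mono) auto
  then show "x * y \<in> max_ideal_power vL (r * int (a + b))"
    by (simp add: max_ideal_power_def vL.val_mult algebra_simps)
qed (auto simp: max_ideal_power_def intro: vL.val_diff_ge)

text \<open>Modulo high powers of \<open>X\<close>, the series \<open>1 - \<alpha> X\<close> is a product of binomials
  \<open>1 - b \<pi>\<^sup>s X\<^sup>h\<close> with \<open>b\<close> in \<open>K\<close>, whose norms are under control.\<close>

lemma bounded_embedding_norm:
  assumes "unit_series (\<lambda>h. max_ideal_power vL (r * int h)) F"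
  shows "es.bounded_series r (es.insep_min {1..n}) (embedding_norm F)"
proof -
  define S where
    "S h = {c \<in> max_ideal_power vL (r * int h). \<exists>b s. s \<ge> 1 \<and> c = \<iota> b * \<pi> ^ s}" for h :: nat
  show ?thesis using graded_subring_max_ideal_power assms
  proof (induction rule: unit_series_limit_induct[where S = S])
    case (subset h)
    then show ?case by (auto simp: S_def)
  next
    case (generates h x)
    obtain b where b: "x = power_combination 1 b" using exists_power_combination by blast
    have "\<iota> (b i) * \<pi> ^ i \<in> S h" if "i \<in> {1..<1 + n}" for i
      using val_power_combination_le[OF that, of b] generates(2) that b
      by (auto simp: S_def max_ideal_power_def)
    moreover have "x = sum_list (map (\<lambda>i. \<iota> (b i) * \<pi> ^ i) [1..<1 + n])"
      unfolding b power_combination_def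
      by (subst sum_list_distinct_conv_sum_set) (simp_all only: distinct_upt set_upt)
    ultimately show ?case
      by (intro exI[of _ "map (\<lambda>i. \<iota> (b i) * \<pi> ^ i) [1..<1 + n]"]) auto
  next
    case one
    show ?case using bounded_embedding_norm_monomial[of 1 1 r 0] by simp
  next
    case (mult A B)
    then show ?case
      unfolding embedding_norm_mult by (intro es.bounded_series_mult[OF es.insep_profile_full])
  next
    case (binomial c h)
    then show ?case using bounded_embedding_norm_monomial by (auto simp: S_def max_ideal_power_def)
  next
    case (limit F)
    have "embedding_norm F $ l = embedding_norm Q $ l" if "fps_agree l F Q" for l Q
      using embedding_norm_agree[OF that] by (simp add: fps_agree_def)
    then show ?case using limit(2) unfolding unit_series_def by metis
  qed
qed

end

section \<open>Indices of inseparability\<close>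

lemma exists_coeff_not_dvd_index:
  fixes f :: "'a::field poly"
  assumes "pderiv f \<noteq> 0" "of_nat p = (0::'a)"
  shows "\<exists>i\<ge>1. coeff f i \<noteq> 0 \<and> \<not> p dvd i"
proof -
  obtain m where "coeff (pderiv f) m \<noteq> 0" using assms(1) poly_eqI[of "pderiv f" 0] by auto
  then have m: "of_nat (Suc m) \<noteq> (0::'a)" "coeff f (Suc m) \<noteq> 0" by (auto simp: coeff_pderiv)
  have "\<not> p dvd Suc m"
  proof
    assume "p dvd Suc m"
    then obtain q where "Suc m = p * q" by blast
    then have "of_nat (Suc m) = of_nat p * (of_nat q :: 'a)" by (metis of_nat_mult)
    then show False using m(1) assms(2) by simp
  qed
  then show ?thesis using m(2) by (intro exI[of _ "Suc m"]) simp
qed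

context totally_ramified_ext
begin

lemma vp_trunc_eq_trunc_mult:
  assumes "h \<ge> 1"
  shows "vp_trunc p \<nu> (int h) = enat (es.trunc_mult h)"
proof -
  have "\<not> is_unit p" "\<not> is_unit (int p)" "h \<noteq> 0" "int h \<noteq> 0"
    using assms prime_p by (auto simp: prime_nat_iff)
  then have "i \<le> multiplicity (int p) (int h) \<longleftrightarrow> i \<le> multiplicity p h" for i
    by (metis power_dvd_iff_le_multiplicity of_nat_dvd_iff of_nat_power)
  then have "multiplicity (int p) (int h) = multiplicity p h" by (metis order_refl antisym)
  then show ?thesis using assms by (simp add: vp_trunc_def vp_def es.trunc_mult_def min_def)
qed

lemma vK_min_poly_c:
  assumes "h \<le> n"
  shows "ereal (real n) * vK (min_poly_c \<iota> \<pi> h) = base_val (eis_coeff h)"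
  using assms ext_degree by (simp add: base_val_eq min_poly_c_def eis_coeff_def)

lemma insep_index_unif_eq:
  "insep_index_unif \<iota> vK p \<nu> \<pi> i =
    Min ((\<lambda>h. base_val (eis_coeff h) - ereal (real h)) ` {h \<in> {1..n}. es.trunc_mult h \<le> i})"
proof -
  have "{h. 1 \<le> h \<and> h \<le> n \<and> vp_trunc p \<nu> (int h) \<le> enat i} = {h \<in> {1..n}. es.trunc_mult h \<le> i}"
    using vp_trunc_eq_trunc_mult by auto
  then have "{ereal (real n) * vK (min_poly_c \<iota> \<pi> h) - ereal (real h) | h.
      1 \<le> h \<and> h \<le> n \<and> vp_trunc p \<nu> (int h) \<le> enat i} =
    (\<lambda>h. base_val (eis_coeff h) - ereal (real h)) ` {h \<in> {1..n}. es.trunc_mult h \<le> i}"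
    unfolding setcompr_eq_image using vK_min_poly_c by (intro image_cong) auto
  then show ?thesis by (simp only: insep_index_unif_def ext_degree)
qed

lemma insep_index_unif_le:
  assumes "h \<in> {1..n}" "es.trunc_mult h \<le> i"
  shows "insep_index_unif \<iota> vK p \<nu> \<pi> i \<le> base_val (eis_coeff h) - ereal (real h)"
  unfolding insep_index_unif_eq using assms by (intro Min_le) auto

lemma insep_index_unif_attained:
  obtains h where "h \<in> {1..n}" "es.trunc_mult h \<le> i"
    "insep_index_unif \<iota> vK p \<nu> \<pi> i = base_val (eis_coeff h) - ereal (real h)"
proof -
  have "es.trunc_mult 1 = 0"
    using es.le_trunc_mult_iff[of 1 "Suc 0"] prime_p by (auto simp: not_less_eq_eq prime_nat_iff)
  then have "1 \<in> {h \<in> {1..n}. es.trunc_mult h \<le> i}" using n_pos by auto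
  then have "insep_index_unif \<iota> vK p \<nu> \<pi> i \<in>
      (\<lambda>h. base_val (eis_coeff h) - ereal (real h)) ` {h \<in> {1..n}. es.trunc_mult h \<le> i}"
    unfolding insep_index_unif_eq by (intro Min_in) auto
  then show ?thesis using that by auto
qed

lemma insep_index_ereal_alt:
  "insep_index_ereal \<iota> vK vL p \<nu> \<pi> j =
    Min ((\<lambda>i. insep_index_unif \<iota> vK p \<nu> \<pi> i + ereal (real (i - j)) * base_val (of_nat p)) ` {j..\<nu>})"
proof -
  have "vL (of_nat p) = base_val (of_nat p)" by (simp add: base_val_def hom_of_nat)
  then show ?thesis
    unfolding insep_index_ereal_def setcompr_eq_image atLeastAtMost_def atLeast_def atMost_def
      Collect_conj_eq by simp
qed

lemma insep_index_ereal_eq: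
  assumes j_le: "j \<le> \<nu>"
  shows "insep_index_ereal \<iota> vK vL p \<nu> \<pi> j = es.insep_min {1..n} j"
proof (rule antisym)
  let ?U = "insep_index_unif \<iota> vK p \<nu> \<pi>" and ?e = "base_val (of_nat p)"
  show "insep_index_ereal \<iota> vK vL p \<nu> \<pi> j \<le> es.insep_min {1..n} j"
    unfolding es.insep_min_def
  proof (rule INF_greatest)
    fix h assume h: "h \<in> {1..n}"
    define i where "i = max j (es.trunc_mult h)"
    have "i \<in> {j..\<nu>}" using j_le by (simp add: i_def)
    then have "insep_index_ereal \<iota> vK vL p \<nu> \<pi> j \<le> ?U i + ereal (real (i - j)) * ?e"
      unfolding insep_index_ereal_alt by (intro Min_le) auto
    also have "?U i + ereal (real (i - j)) * ?e \<le> es.insep_term h j"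
      unfolding es.insep_term_def using h
      by (intro add_mono insep_index_unif_le) (auto simp: i_def max_def)
    finally show "insep_index_ereal \<iota> vK vL p \<nu> \<pi> j \<le> es.insep_term h j" .
  qed
  have "insep_index_ereal \<iota> vK vL p \<nu> \<pi> j \<in> (\<lambda>i. ?U i + ereal (real (i - j)) * ?e) ` {j..\<nu>}"
    unfolding insep_index_ereal_alt using j_le by (intro Min_in) auto
  then obtain i where i: "insep_index_ereal \<iota> vK vL p \<nu> \<pi> j = ?U i + ereal (real (i - j)) * ?e"
    by blast
  obtain h where h: "h \<in> {1..n}" "es.trunc_mult h \<le> i" "?U i = base_val (eis_coeff h) - ereal (real h)"
    by (rule insep_index_unif_attained)
  have "es.insep_min {1..n} j \<le> es.insep_term h j" by (rule es.insep_min_le[OF h(1)])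
  also have "\<dots> \<le> ?U i + ereal (real (i - j)) * ?e"
    unfolding es.insep_term_def h(3) using h(2) es.val_p_pos
    by (intro add_left_mono ereal_mult_right_mono) auto
  finally show "es.insep_min {1..n} j \<le> insep_index_ereal \<iota> vK vL p \<nu> \<pi> j" by (simp add: i)
qed

lemma exists_eis_coeff_not_dvd:
  assumes "of_nat p = (0::'k)" "p dvd n"
  shows "\<exists>h\<in>{1..n}. \<not> p dvd h \<and> eis_coeff h \<noteq> 0"
proof -
  have "pderiv (min_poly \<iota> \<pi>) \<noteq> 0"
  proof
    assume "pderiv (min_poly \<iota> \<pi>) = 0"
    then have "is_unit (min_poly \<iota> \<pi>)"
      using separable_min_poly[OF closure] by (simp add: separable_poly_def)
    then show False using degree_min_poly n_pos by (simp add: is_unit_iff_degree min_poly_nonzero)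
  qed
  then obtain i where i: "i \<ge> 1" "coeff (min_poly \<iota> \<pi>) i \<noteq> 0" "\<not> p dvd i"
    using exists_coeff_not_dvd_index assms(1) by blast
  have "i \<le> n" using i(2) degree_min_poly le_degree by metis
  moreover have "\<not> p dvd n - i" using i(3) assms(2) \<open>i \<le> n\<close> by (metis dvd_diffD1)
  moreover from this have "n - i \<noteq> 0" by (metis dvd_0_right)
  ultimately show ?thesis
    using i(1,2) by (intro bexI[of _ "n - i"]) (auto simp: eis_coeff_def Suc_le_eq)
qed

text \<open>Separability of the extension enters here if \<open>p = 0\<close> in \<open>K\<close>.\<close>

lemma exists_finite_insep_term: "\<exists>h\<in>{1..n}. es.insep_term h j \<noteq> \<infinity>"
proof (cases "base_val (of_nat p) = \<infinity> \<and> \<nu> > 0")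
  case True
  then have "p dvd n" using es.p_power_dvd_n[of 1] by simp
  moreover have "of_nat p = (0::'k)" using True base_val.val_eq_PInf_iff by blast
  ultimately obtain h where h: "h \<in> {1..n}" "\<not> p dvd h" "eis_coeff h \<noteq> 0"
    using exists_eis_coeff_not_dvd by blast
  have "es.trunc_mult h = 0" using h(2) by (simp add: es.trunc_mult_def not_dvd_imp_multiplicity_0)
  then have "es.insep_term h j \<noteq> \<infinity>"
    using base_val_integral[OF h(3)] by (auto simp: es.insep_term_def zero_ereal_def[symmetric])
  then show ?thesis using h(1) by blast
next
  case False
  have "ereal (real (\<nu> - j)) * base_val (of_nat p) \<noteq> \<infinity>"
  proof (cases "base_val (of_nat p)")
    case PInf
    then show ?thesis using False by (simp add: zero_ereal_def[symmetric])
  qed auto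
  then show ?thesis using n_pos by (intro bexI[of _ n]) (auto simp: es.insep_term_n)
qed

lemma insep_min_eq_insep_index:
  assumes j_le: "j \<le> \<nu>"
  shows "es.insep_min {1..n} j = ereal (of_int (insep_index \<iota> vK vL p \<nu> \<pi> j))"
proof -
  obtain h where "h \<in> {1..n}" "es.insep_term h j \<noteq> \<infinity>" using exists_finite_insep_term by blast
  then have "es.insep_min {1..n} j \<noteq> \<infinity>" using es.insep_min_le[of h "{1..n}" j] by auto
  moreover have "0 \<le> es.insep_min {1..n} j"
    using es.insep_profile_full j_le by (auto simp: es.insep_profile_def)
  ultimately obtain y where y: "es.insep_min {1..n} j = ereal y"
    by (cases "es.insep_min {1..n} j") auto
  have "{1..n} \<noteq> {}" using n_pos by simp
  then obtain h' where "es.insep_min {1..n} j = es.insep_term h' j"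
    using es.insep_min_attained[of "{1..n}" j] by (metis finite_atLeastAtMost)
  then obtain z where "y = real_of_int (int n * z - int h')"
    using es.insep_term_integral y by metis
  then show ?thesis
    using insep_index_ereal_eq[OF j_le] y by (simp add: insep_index_def)
qed

section \<open>Elementary symmetric functions of conjugates\<close>

lemma conj_sym_eqI:
  assumes "embedding_norm (one_minus_monom \<alpha> 1) $ k = base_emb x"
  shows "conj_sym \<iota> \<kappa> k \<alpha> = (-1) ^ k * x"
proof -
  have "base_emb x = (-1) ^ k * elem_sym k (\<lambda>\<sigma>. \<sigma> \<alpha>) (embeddings \<iota> \<kappa>)"
    using assms prod_one_minus_monom_elem_sym[OF finite_embeddings[OF closure], of "\<lambda>\<sigma>. \<sigma> \<alpha>" k]
    by (simp only: embedding_norm_one_minus_monom[OF order_refl])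
  then have "elem_sym k (\<lambda>\<sigma>. \<sigma> \<alpha>) (embeddings \<iota> \<kappa>) = base_emb ((-1) ^ k * x)"
    by (cases "even k") (simp_all add: base.hom_uminus)
  moreover have "inj base_emb" using base.inj_f by (simp add: inj_def)
  ultimately show ?thesis by (simp add: conj_sym_def base_emb_def[symmetric] the_inv_f_f)
qed

lemma base_val_conj_sym_ge:
  assumes j_le: "j \<le> \<nu>" and in_power: "\<alpha> \<in> max_ideal_power vL r"
  shows "ereal (of_int (insep_index \<iota> vK vL p \<nu> \<pi> j + r * int p ^ j)) \<le>
    base_val (conj_sym \<iota> \<kappa> (p ^ j) \<alpha>)"
proof -
  have "unit_series (\<lambda>h. max_ideal_power vL (r * int h)) (one_minus_monom \<alpha> 1)"
    using in_power by (intro unit_series_one_minus_monom[OF graded_subring_max_ideal_power]) auto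
  then have "es.bounded_series r (es.insep_min {1..n}) (embedding_norm (one_minus_monom \<alpha> 1))"
    by (rule bounded_embedding_norm)
  moreover have "p ^ j \<ge> 1" using prime_p prime_ge_1_nat by auto
  ultimately obtain x where "embedding_norm (one_minus_monom \<alpha> 1) $ (p ^ j) = base_emb x"
    "es.profile_bound r (es.insep_min {1..n}) (p ^ j) \<le> base_val x"
    unfolding unit_series_def es.fractional_ideal_def by blast
  moreover from this have "base_val (conj_sym \<iota> \<kappa> (p ^ j) \<alpha>) = base_val x"
    by (simp add: conj_sym_eqI)
  moreover have "es.profile_bound r (es.insep_min {1..n}) (p ^ j) =
      ereal (of_int (insep_index \<iota> vK vL p \<nu> \<pi> j + r * int p ^ j))"
    unfolding es.profile_bound_def es.trunc_mult_p_power[OF j_le] insep_min_eq_insep_index[OF j_le]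
    by simp
  ultimately show ?thesis by simp
qed

lemma exists_monomial_of_val:
  obtains s b where "s \<ge> 1" "b \<noteq> 0" "vL (\<iota> b * \<pi> ^ s) = ereal (of_int S)"
proof -
  define M where "M = \<bar>S\<bar> + 1"
  define s where "s = nat (S + int n * M)"
  have "M \<le> int n * M" using n_pos by (simp add: M_def)
  then have "1 \<le> S + int n * M" unfolding M_def by linarith
  then have s: "int s = S + int n * M" "s \<ge> 1" by (auto simp: s_def)
  obtain b where b: "b \<noteq> 0" "vK b = ereal (of_int (- M))"
    using discrete_valuation_surj[OF discrete_vK] by blast
  have "vL (\<iota> b * \<pi> ^ s) = ereal (of_int (int s - int n * M))"
    by (simp add: val_monomial base_val_eq b(2))
  then show ?thesis using that[OF s(2) b(1)] by (simp add: s(1))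
qed

lemma base_val_conj_sym_monomial:
  assumes j_le: "j \<le> \<nu>" and s_ge_1: "s \<ge> 1"
    and dvd: "int n dvd int (s * p ^ j) + insep_index \<iota> vK vL p \<nu> \<pi> j"
  shows "base_val (conj_sym \<iota> \<kappa> (p ^ j) (\<iota> b * \<pi> ^ s)) = ereal (real (p ^ j)) * base_val b +
    ereal (real (s * p ^ j) + of_int (insep_index \<iota> vK vL p \<nu> \<pi> j))"
proof -
  obtain \<Psi> :: "'s fps \<Rightarrow> 's fps" where frobenius: "witt_frobenius s \<Psi>"
    using exists_frobenius[OF s_ge_1] by blast
  interpret eisenstein_power base_emb base_val p \<nu> n u eis_coeff s \<Psi> j "insep_index \<iota> vK vL p \<nu> \<pi> j"
    using j_le dvd insep_min_eq_insep_index[OF j_le] es.eisenstein_series_axioms frobenius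
    by (intro eisenstein_power.intro eisenstein_power_axioms.intro)
  obtain x where x: "\<Psi> es.eis_series $ (p ^ j) = base_emb x" "base_val x = target"
    using eis_series_nth_val by blast
  have "embedding_norm (one_minus_monom (\<iota> b * \<pi> ^ s) 1) $ (p ^ j) = base_emb (b ^ p ^ j * x)"
    unfolding embedding_norm_monomial_nth[OF frobenius order_refl]
    by (simp add: x(1) base.hom_mult base.hom_power)
  then have "base_val (conj_sym \<iota> \<kappa> (p ^ j) (\<iota> b * \<pi> ^ s)) = base_val (b ^ p ^ j * x)"
    by (simp add: conj_sym_eqI)
  then show ?thesis by (simp add: base_val.val_mult base_val.val_power x(2))
qed

text \<open>The valuation \<open>m\<close> is attained at \<open>\<alpha> = b \<pi>\<^sup>s\<close> of valuation \<open>S = (n m - i\<^sub>j) / p\<^sup>j\<close>.\<close>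

lemma exists_vK_conj_sym_eq:
  assumes j_le: "j \<le> \<nu>" and p_dvd: "int p ^ j dvd insep_index \<iota> vK vL p \<nu> \<pi> j"
    and m_ge: "insep_index \<iota> vK vL p \<nu> \<pi> j + r * int p ^ j \<le> int n * m"
  shows "\<exists>\<alpha>\<in>max_ideal_power vL r. vK (conj_sym \<iota> \<kappa> (p ^ j) \<alpha>) = ereal (of_int m)"
proof -
  define N where "N = insep_index \<iota> vK vL p \<nu> \<pi> j"
  have "int p ^ j dvd int n" using es.p_power_dvd_n[OF j_le] by (metis of_nat_dvd_iff of_nat_power)
  then have "int p ^ j dvd int n * m - N" using p_dvd by (simp add: N_def)
  then obtain S where S: "int n * m - N = int p ^ j * S" by blast
  have "int p ^ j > 0" using prime_p prime_gt_0_nat by auto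
  moreover have "int p ^ j * r \<le> int p ^ j * S" using m_ge S by (simp add: N_def mult.commute)
  ultimately have "r \<le> S" by simp
  obtain s b where s: "s \<ge> 1" and b: "b \<noteq> 0" "vL (\<iota> b * \<pi> ^ s) = ereal (of_int S)"
    by (rule exists_monomial_of_val)
  obtain z where z: "base_val b = ereal (real n * of_int z)"
    using base_val_integral[OF b(1)] by blast
  have "real_of_int (int n * z + int s) = real_of_int S" using b(2) z by (simp add: val_monomial)
  then have S_eq: "S = int n * z + int s" by (simp only: of_int_eq_iff)
  have val: "int p ^ j * (int n * z) + (int (s * p ^ j) + N) = int n * m"
    using S unfolding S_eq by (simp add: algebra_simps)
  then have "int (s * p ^ j) + N = int n * (m - int p ^ j * z)" by (simp add: algebra_simps)
  then have "int n dvd int (s * p ^ j) + N" by simp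
  then have "base_val (conj_sym \<iota> \<kappa> (p ^ j) (\<iota> b * \<pi> ^ s)) =
      ereal (real_of_int (int p ^ j * (int n * z) + (int (s * p ^ j) + N)))"
    using base_val_conj_sym_monomial[OF j_le s] z by (simp add: N_def)
  also have "\<dots> = ereal (real n * of_int m)" unfolding val by simp
  finally have "vK (conj_sym \<iota> \<kappa> (p ^ j) (\<iota> b * \<pi> ^ s)) = ereal (of_int m)"
    using n_pos unfolding base_val_eq
    by (cases "vK (conj_sym \<iota> \<kappa> (p ^ j) (\<iota> b * \<pi> ^ s))") auto
  moreover have "\<iota> b * \<pi> ^ s \<in> max_ideal_power vL r"
    using \<open>r \<le> S\<close> b(2) by (simp add: max_ideal_power_def)
  ultimately show ?thesis by blast
qed

lemma vK_conj_sym_ge: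
  assumes j_le: "j \<le> \<nu>" and in_power: "\<alpha> \<in> max_ideal_power vL r"
  shows "ereal (of_int \<lceil>real_of_int (insep_index \<iota> vK vL p \<nu> \<pi> j + r * int p ^ j) / real n\<rceil>) \<le>
    vK (conj_sym \<iota> \<kappa> (p ^ j) \<alpha>)"
proof (cases "conj_sym \<iota> \<kappa> (p ^ j) \<alpha> = 0")
  case False
  let ?N = "insep_index \<iota> vK vL p \<nu> \<pi> j + r * int p ^ j"
  obtain z where z: "vK (conj_sym \<iota> \<kappa> (p ^ j) \<alpha>) = ereal (of_int z)"
    "base_val (conj_sym \<iota> \<kappa> (p ^ j) \<alpha>) = ereal (real n * of_int z)"
    using base_val_integral[OF False] by blast
  have "real_of_int ?N \<le> real n * of_int z"
    using base_val_conj_sym_ge[OF j_le in_power] unfolding z by (simp only: ereal_less_eq)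
  then have "real_of_int ?N / real n \<le> of_int z" using n_pos by (simp add: field_simps)
  then show ?thesis by (simp add: z ceiling_le_iff)
qed simp

lemma exists_vK_conj_sym_eq_ceiling:
  assumes "j \<le> \<nu>" "int p ^ j dvd insep_index \<iota> vK vL p \<nu> \<pi> j"
  shows "\<exists>\<alpha>\<in>max_ideal_power vL r. vK (conj_sym \<iota> \<kappa> (p ^ j) \<alpha>) =
    ereal (of_int \<lceil>real_of_int (insep_index \<iota> vK vL p \<nu> \<pi> j + r * int p ^ j) / real n\<rceil>)"
proof (rule exists_vK_conj_sym_eq[OF assms])
  let ?N = "insep_index \<iota> vK vL p \<nu> \<pi> j + r * int p ^ j"
  have "real_of_int ?N / real n \<le> of_int \<lceil>real_of_int ?N / real n\<rceil>" by (rule le_of_int_ceiling)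
  then have "real_of_int ?N \<le> of_int \<lceil>real_of_int ?N / real n\<rceil> * real n"
    using n_pos by (simp only: pos_divide_le_eq of_nat_0_less_iff)
  then have "real_of_int ?N \<le> real_of_int (int n * \<lceil>real_of_int ?N / real n\<rceil>)"
    by (simp add: mult.commute)
  then show "?N \<le> int n * \<lceil>real_of_int ?N / real n\<rceil>" by (simp only: of_int_le_iff)
qed

lemma span_and_min_val_conj_sym:
  assumes j_le: "j \<le> \<nu>" and p_dvd: "int p ^ j dvd insep_index \<iota> vK vL p \<nu> \<pi> j"
  defines "m \<equiv> \<lambda>r. \<lceil>real_of_int (insep_index \<iota> vK vL p \<nu> \<pi> j + r * int p ^ j) / real n\<rceil>"
  shows "valuation_ring_span vK (conj_sym \<iota> \<kappa> (p ^ j) ` max_ideal_power vL r) =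
      max_ideal_power vK (m r)"
    and "min_val_conj_sym \<iota> \<kappa> vK vL (p ^ j) r = ereal (of_int (m r))"
proof -
  have ge: "ereal (of_int (m r)) \<le> vK (conj_sym \<iota> \<kappa> (p ^ j) \<alpha>)" if "\<alpha> \<in> max_ideal_power vL r" for \<alpha>
    unfolding m_def by (rule vK_conj_sym_ge[OF j_le that])
  obtain \<alpha> where \<alpha>: "\<alpha> \<in> max_ideal_power vL r" "vK (conj_sym \<iota> \<kappa> (p ^ j) \<alpha>) = ereal (of_int (m r))"
    using exists_vK_conj_sym_eq_ceiling[OF j_le p_dvd] unfolding m_def by blast
  show "valuation_ring_span vK (conj_sym \<iota> \<kappa> (p ^ j) ` max_ideal_power vL r) =
      max_ideal_power vK (m r)"
    using ge \<alpha> by (intro vK.valuation_ring_span_eq_max_ideal_power[OF _ imageI[OF \<alpha>(1)]]) auto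
  show "min_val_conj_sym \<iota> \<kappa> vK vL (p ^ j) r = ereal (of_int (m r))"
    unfolding min_val_conj_sym_def
    using ge \<alpha>(2) by (intro antisym INF_greatest INF_lower2[OF \<alpha>(1)]) auto
qed

end

lemma power_dvd_of_le_vp:
  assumes "enat j \<le> vp p k"
  shows "int p ^ j dvd k"
  using assms multiplicity_dvd'[of j "int p" k] by (cases "k = 0") (auto simp: vp_def)

theorem theorem5p1:
  fixes \<iota> :: "'k::field \<Rightarrow> 'l::field"
    and \<kappa> :: "'l \<Rightarrow> 's::field"
    and vK :: "'k \<Rightarrow> ereal" and vL :: "'l \<Rightarrow> ereal"
    and \<pi> :: 'l
    and p n u \<nu> j :: nat
  assumes "discrete_valuation vK" and "complete_valuation vK"
    and "perfect_of_char (residue_field vK) p"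
    and "field_hom \<iota>" and "field_hom \<kappa>"
    and "separable_closure (\<kappa> \<circ> \<iota>)"
    and "ext_degree \<iota> = n" and "n = u * p ^ \<nu>" and "\<not> p dvd u"
    and "totally_ramified \<iota> vK vL"
    and "vL \<pi> = 1"
    and "j \<le> \<nu>"
    and "enat j \<le> min (vp p (insep_index \<iota> vK vL p \<nu> \<pi> j)) (enat \<nu>)"
  shows "\<forall>r::int.
      valuation_ring_span vK (conj_sym \<iota> \<kappa> (p ^ j) ` max_ideal_power vL r) =
        max_ideal_power vK
          \<lceil>real_of_int (insep_index \<iota> vK vL p \<nu> \<pi> j + r * int p ^ j) / real n\<rceil> \<and>
      min_val_conj_sym \<iota> \<kappa> vK vL (p ^ j) r =
        ereal (real_of_int
          \<lceil>real_of_int (insep_index \<iota> vK vL p \<nu> \<pi> j + r * int p ^ j) / real n\<rceil>)"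
proof -
  have "prime p" using assms(3) by (simp add: perfect_of_char_def)
  moreover have "vK (of_nat p) > 0"
    using assms(1,3)
    by (intro ereal_valuation.val_residue_char_pos discrete_valuation_ereal_valuation)
  ultimately interpret totally_ramified_ext \<iota> \<kappa> vK vL \<pi> p n u \<nu>
    by (intro totally_ramified_ext.intro totally_ramified_ext_axioms.intro) (use assms in auto)
  have "int p ^ j dvd insep_index \<iota> vK vL p \<nu> \<pi> j"
    using assms(13) by (intro power_dvd_of_le_vp) simp
  then show ?thesis using span_and_min_val_conj_sym[OF assms(12)] by blast
qed

end
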